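(* The quantum automorphism group of the Petersen graph (the compact quantum group $G$ with $\mathbb C(G)=A(\mathtt P)$, where $\mathtt P$ is the Petersen graph) has an irreducible $5$-dimensional representation. In particular it is not isomorphic to the quantum symmetric group $\mathcal Q_5$; that is, $A(\mathtt P)$ and $A_s(5)$ are not isomorphic as Hopf $\mathbb C^*$-algebras.
   Context: A Hopf $\mathbb C^*$-algebra is a unital $\mathbb C^*$-algebra $A$ with morphisms $\Delta:A\to A\otimes A$ ($\mathbb C^*$-tensor product), $\varepsilon:A\to\mathbb C$, $S:A\to A^{op}$ satisfying the usual axioms of comultiplication, counit and antipode, and $S^2=\mathrm{id}$. One writes $A=\mathbb C(G)$ and calls $G$ the corresponding compact quantum group; isomorphisms of compact quantum groups correspond to isomorphisms of Hopf $\mathbb C^*$-algebras. A $k$-dimensional representation of $G$ is a matrix $v\in M_k(A)$ with $\Delta(v_{ij})=\sum_l v_{il}\otimes v_{lj}$ and $\varepsilon(v_{ij})=\delta_{ij}$; it is irreducible if the only matrices $T\in M_k(\mathbb C)$ with $Tv=vT$ are the scalar ones. A magic unitary is a square matrix over a unital $\mathbb C^*$-algebra whose entries are projections and each of whose rows and columns consists of pairwise orthogonal projections with sum $1$. $A_s(n)$ is the universal unital $\mathbb C^*$-algebra generated by the entries $u_{ij}$ ($1\le i,j\le n$) of a magic unitary $u$, with $\Delta(u_{ij})=\sum_k u_{ik}\otimes u_{kj}$, $\varepsilon(u_{ij})=\delta_{ij}$, $S(u_{ij})=u_{ji}$; the corresponding compact quantum group is $\mathcal Q_n$, the quantum symmetric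 group. For a finite (simple, undirected) graph $X$ with vertex set $\{1,\dots,n\}$ and adjacency matrix $d$, $A(X)$ is the quotient of $A_s(n)$ by the relations $du=ud$, with the induced Hopf $\mathbb C^*$-algebra structure; its compact quantum group is the quantum automorphism group of $X$. *)

theory Defs
  imports Complex_Main "HOL-Library.FuncSet" "HOL-Algebra.QuotRing" "HOL-Algebra.Module"
begin

section \<open>Complex unital *-algebras and C*-algebras as records\<close>

record 'a star_algebra = "(complex, 'a) module" +
  star :: "'a \<Rightarrow> 'a"

record 'a cstar_algebra = "'a star_algebra" +
  cnorm :: "'a \<Rightarrow> real"

definition complex_star_algebra :: "complex star_algebra" where
  "complex_star_algebra =
    \<lparr>carrier = UNIV, mult = (*), one = 1, zero = 0, add = (+), smult = (*), star = cnj\<rparr>"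

definition opposite_algebra :: "('a, 'x) star_algebra_scheme \<Rightarrow> ('a, 'x) star_algebra_scheme" where
  "opposite_algebra A = A\<lparr>mult := (\<lambda>x y. y \<otimes>\<^bsub>A\<^esub> x)\<rparr>"

text \<open>Unital *-homomorphisms; they are made extensional so that a homomorphism is determined by its
  values on the carrier and can be named by a definite description.\<close>

definition star_hom ::
    "('a, 'x) star_algebra_scheme \<Rightarrow> ('b, 'y) star_algebra_scheme \<Rightarrow> ('a \<Rightarrow> 'b) set" where
  "star_hom A B = {f \<in> ring_hom A B \<inter> extensional (carrier A).
     \<forall>a\<in>carrier A. (\<forall>c. f (c \<odot>\<^bsub>A\<^esub> a) = c \<odot>\<^bsub>B\<^esub> f a) \<and> f (star A a) = star B (f a)}"

definition cstar_seminorm :: "('a, 'x) star_algebra_scheme \<Rightarrow> ('a \<Rightarrow> real) \<Rightarrow> bool" where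
  "cstar_seminorm A q \<longleftrightarrow>
     (\<forall>x\<in>carrier A. 0 \<le> q x \<and> (\<forall>c. q (c \<odot>\<^bsub>A\<^esub> x) = cmod c * q x) \<and>
        q (star A x \<otimes>\<^bsub>A\<^esub> x) = (q x)\<^sup>2) \<and>
     (\<forall>x\<in>carrier A. \<forall>y\<in>carrier A.
        q (x \<oplus>\<^bsub>A\<^esub> y) \<le> q x + q y \<and> q (x \<otimes>\<^bsub>A\<^esub> y) \<le> q x * q y)"

definition cstar_norm :: "('a, 'x) star_algebra_scheme \<Rightarrow> ('a \<Rightarrow> real) \<Rightarrow> bool" where
  "cstar_norm A q \<longleftrightarrow> cstar_seminorm A q \<and> (\<forall>x\<in>carrier A. q x = 0 \<longrightarrow> x = \<zero>\<^bsub>A\<^esub>)"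


section \<open>Separated completion of a *-algebra with respect to a C*-seminorm\<close>

definition cauchy_seqs :: "('a, 'x) star_algebra_scheme \<Rightarrow> ('a \<Rightarrow> real) \<Rightarrow> (nat \<Rightarrow> 'a) set" where
  "cauchy_seqs A q = {s. (\<forall>k. s k \<in> carrier A) \<and>
     (\<forall>e>0. \<exists>N. \<forall>m\<ge>N. \<forall>n\<ge>N. q (s m \<ominus>\<^bsub>A\<^esub> s n) < e)}"

definition null_rel :: "('a, 'x) star_algebra_scheme \<Rightarrow> ('a \<Rightarrow> real) \<Rightarrow> (nat \<Rightarrow> 'a) rel" where
  "null_rel A q = {(s, t). s \<in> cauchy_seqs A q \<and> t \<in> cauchy_seqs A q \<and>
     (\<lambda>k. q (s k \<ominus>\<^bsub>A\<^esub> t k)) \<longlonglongrightarrow> 0}"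

definition cstar_completion ::
    "('a, 'x) star_algebra_scheme \<Rightarrow> ('a \<Rightarrow> real) \<Rightarrow> (nat \<Rightarrow> 'a) set cstar_algebra" where
  "cstar_completion A q =
    \<lparr>carrier = cauchy_seqs A q // null_rel A q,
     mult = (\<lambda>X Y. \<Union>s\<in>X. \<Union>t\<in>Y. null_rel A q `` {\<lambda>k. s k \<otimes>\<^bsub>A\<^esub> t k}),
     one = null_rel A q `` {\<lambda>_. \<one>\<^bsub>A\<^esub>},
     zero = null_rel A q `` {\<lambda>_. \<zero>\<^bsub>A\<^esub>},
     add = (\<lambda>X Y. \<Union>s\<in>X. \<Union>t\<in>Y. null_rel A q `` {\<lambda>k. s k \<oplus>\<^bsub>A\<^esub> t k}),
     smult = (\<lambda>c X. \<Union>s\<in>X. null_rel A q `` {\<lambda>k. c \<odot>\<^bsub>A\<^esub> s k}),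
     star = (\<lambda>X. \<Union>s\<in>X. null_rel A q `` {\<lambda>k. star A (s k)}),
     cnorm = (\<lambda>X. THE l. \<forall>s\<in>X. (\<lambda>k. q (s k)) \<longlonglongrightarrow> l)\<rparr>"

definition completion_embed ::
    "('a, 'x) star_algebra_scheme \<Rightarrow> ('a \<Rightarrow> real) \<Rightarrow> 'a \<Rightarrow> (nat \<Rightarrow> 'a) set" where
  "completion_embed A q x = null_rel A q `` {\<lambda>_. x}"


section \<open>Quotients\<close>

text \<open>\<open>I\<close> is meant to be a two-sided ideal with \<open>star I \<subseteq> I\<close>.\<close>

definition star_quotient :: "('a, 'x) star_algebra_scheme \<Rightarrow> 'a set \<Rightarrow> 'a set star_algebra" where
  "star_quotient A I =
    \<lparr>carrier = carrier (A Quot I), mult = mult (A Quot I), one = one (A Quot I),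
     zero = zero (A Quot I), add = add (A Quot I),
     smult = (\<lambda>c X. \<Union>x\<in>X. I +>\<^bsub>A\<^esub> (c \<odot>\<^bsub>A\<^esub> x)),
     star = (\<lambda>X. \<Union>x\<in>X. I +>\<^bsub>A\<^esub> star A x)\<rparr>"

definition cstar_quotient :: "('a, 'x) cstar_algebra_scheme \<Rightarrow> 'a set \<Rightarrow> 'a set cstar_algebra" where
  "cstar_quotient A I =
     star_algebra.extend (star_quotient A I) (cstar_algebra.fields (\<lambda>X. Inf (cnorm A ` X)))"

definition norm_closed :: "('a, 'x) cstar_algebra_scheme \<Rightarrow> 'a set \<Rightarrow> bool" where
  "norm_closed A I \<longleftrightarrow> (\<forall>s x. (\<forall>k. s k \<in> I) \<and> x \<in> carrier A \<and>
     (\<lambda>k. cnorm A (s (k::nat) \<ominus>\<^bsub>A\<^esub> x)) \<longlonglongrightarrow> 0 \<longrightarrow> x \<in> I)"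

definition closed_ideal_gen :: "('a, 'x) cstar_algebra_scheme \<Rightarrow> 'a set \<Rightarrow> 'a set" where
  "closed_ideal_gen A S = \<Inter>{I. ideal I A \<and> norm_closed A I \<and> S \<subseteq> I}"


section \<open>Universal C*-algebras given by generators and relations\<close>

text \<open>The *-algebra \<open>\<complex>[M]\<close> of finitely supported functions on a monoid \<open>M\<close>, with convolution product
  and with the conjugate-linear extension of an involutive anti-automorphism \<open>J\<close> of \<open>M\<close> as star.\<close>

definition star_monoid_algebra ::
    "('m, 'x) monoid_scheme \<Rightarrow> ('m \<Rightarrow> 'm) \<Rightarrow> ('m \<Rightarrow> complex) star_algebra" where
  "star_monoid_algebra M J =
    \<lparr>carrier = {f. finite {x. f x \<noteq> 0} \<and> {x. f x \<noteq> 0} \<subseteq> carrier M},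
     mult = (\<lambda>f g z. \<Sum>(x, y)\<in>{(x, y). f x \<noteq> 0 \<and> g y \<noteq> 0 \<and> x \<otimes>\<^bsub>M\<^esub> y = z}. f x * g y),
     one = (\<lambda>z. of_bool (z = \<one>\<^bsub>M\<^esub>)),
     zero = (\<lambda>_. 0),
     add = (\<lambda>f g z. f z + g z),
     smult = (\<lambda>c f z. c * f z),
     star = (\<lambda>f z. \<Sum>x\<in>{x. f x \<noteq> 0 \<and> J x = z}. cnj (f x))\<rparr>"

definition monoid_point :: "'m \<Rightarrow> 'm \<Rightarrow> complex" where
  "monoid_point x = (\<lambda>z. of_bool (z = x))"

text \<open>Words in the letters \<open>(g, False)\<close>, standing for the generator \<open>g\<close>, and \<open>(g, True)\<close>, standing
  for its adjoint.\<close>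

definition free_star_algebra :: "'g set \<Rightarrow> (('g \<times> bool) list \<Rightarrow> complex) star_algebra" where
  "free_star_algebra G = star_monoid_algebra
     \<lparr>carrier = lists (G \<times> UNIV), mult = (@), one = []\<rparr> (\<lambda>w. rev (map (apsnd Not) w))"

definition free_gen :: "'g \<Rightarrow> ('g \<times> bool) list \<Rightarrow> complex" where
  "free_gen g = monoid_point [(g, False)]"

text \<open>The supremum of all C*-seminorms compatible with the relations \<open>r = 0\<close> for \<open>r \<in> R\<close>. It is
  finite as soon as the relations bound the generators, e.g. force them to be projections.\<close>

definition universal_seminorm ::
    "'g set \<Rightarrow> (('g \<times> bool) list \<Rightarrow> complex) set \<Rightarrow> (('g \<times> bool) list \<Rightarrow> complex) \<Rightarrow> real" where
  "universal_seminorm G R x =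
     Sup {q x | q. cstar_seminorm (free_star_algebra G) q \<and> (\<forall>r\<in>R. q r = 0)}"

type_synonym 'g universal = "(nat \<Rightarrow> ('g \<times> bool) list \<Rightarrow> complex) set"

definition universal_cstar ::
    "'g set \<Rightarrow> (('g \<times> bool) list \<Rightarrow> complex) set \<Rightarrow> 'g universal cstar_algebra" where
  "universal_cstar G R = cstar_completion (free_star_algebra G) (universal_seminorm G R)"

definition universal_gen :: "'g set \<Rightarrow> (('g \<times> bool) list \<Rightarrow> complex) set \<Rightarrow> 'g \<Rightarrow> 'g universal" where
  "universal_gen G R g =
     completion_embed (free_star_algebra G) (universal_seminorm G R) (free_gen g)"


section \<open>Tensor products\<close>

text \<open>The algebraic tensor product is \<open>\<complex>[A \<times> B]\<close> modulo the relations of bilinearity. Their linear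
  span is stable under multiplication by the basis elements \<open>(x, y)\<close>, hence is already an ideal.\<close>

definition pair_algebra :: "('a, 'x) star_algebra_scheme \<Rightarrow> ('b, 'y) star_algebra_scheme \<Rightarrow>
    ('a \<times> 'b \<Rightarrow> complex) star_algebra" where
  "pair_algebra A B = star_monoid_algebra (A \<times>\<times> B) (map_prod (star A) (star B))"

definition bilinear_relations :: "('a, 'x) star_algebra_scheme \<Rightarrow> ('b, 'y) star_algebra_scheme \<Rightarrow>
    ('a \<times> 'b \<Rightarrow> complex) set" where
  "bilinear_relations A B = (let P = pair_algebra A B; p = (\<lambda>a b. monoid_point (a, b)) in
     {p (a \<oplus>\<^bsub>A\<^esub> a') b \<ominus>\<^bsub>P\<^esub> (p a b \<oplus>\<^bsub>P\<^esub> p a' b) | a a' b.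
        a \<in> carrier A \<and> a' \<in> carrier A \<and> b \<in> carrier B} \<union>
     {p a (b \<oplus>\<^bsub>B\<^esub> b') \<ominus>\<^bsub>P\<^esub> (p a b \<oplus>\<^bsub>P\<^esub> p a b') | a b b'.
        a \<in> carrier A \<and> b \<in> carrier B \<and> b' \<in> carrier B} \<union>
     {p (c \<odot>\<^bsub>A\<^esub> a) b \<ominus>\<^bsub>P\<^esub> (c \<odot>\<^bsub>P\<^esub> p a b) | c a b. a \<in> carrier A \<and> b \<in> carrier B} \<union>
     {p a (c \<odot>\<^bsub>B\<^esub> b) \<ominus>\<^bsub>P\<^esub> (c \<odot>\<^bsub>P\<^esub> p a b) | c a b. a \<in> carrier A \<and> b \<in> carrier B})"

definition bilinear_ideal :: "('a, 'x) star_algebra_scheme \<Rightarrow> ('b, 'y) star_algebra_scheme \<Rightarrow>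
    ('a \<times> 'b \<Rightarrow> complex) set" where
  "bilinear_ideal A B = Idl\<^bsub>pair_algebra A B\<^esub> (bilinear_relations A B)"

definition alg_tensor :: "('a, 'x) star_algebra_scheme \<Rightarrow> ('b, 'y) star_algebra_scheme \<Rightarrow>
    ('a \<times> 'b \<Rightarrow> complex) set star_algebra" where
  "alg_tensor A B = star_quotient (pair_algebra A B) (bilinear_ideal A B)"

text \<open>The spatial norm, as the least C*-norm on the algebraic tensor product (Takesaki).\<close>

definition min_tensor_norm :: "('a, 'x) star_algebra_scheme \<Rightarrow> ('b, 'y) star_algebra_scheme \<Rightarrow>
    ('a \<times> 'b \<Rightarrow> complex) set \<Rightarrow> real" where
  "min_tensor_norm A B x = Inf {q x | q. cstar_norm (alg_tensor A B) q}"

type_synonym ('a, 'b) ctensor = "(nat \<Rightarrow> ('a \<times> 'b \<Rightarrow> complex) set) set"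

definition cstar_tensor :: "('a, 'x) star_algebra_scheme \<Rightarrow> ('b, 'y) star_algebra_scheme \<Rightarrow>
    ('a, 'b) ctensor cstar_algebra" where
  "cstar_tensor A B = cstar_completion (alg_tensor A B) (min_tensor_norm A B)"

definition pure_tensor :: "('a, 'x) star_algebra_scheme \<Rightarrow> ('b, 'y) star_algebra_scheme \<Rightarrow>
    'a \<Rightarrow> 'b \<Rightarrow> ('a, 'b) ctensor" where
  "pure_tensor A B a b = completion_embed (alg_tensor A B) (min_tensor_norm A B)
     (bilinear_ideal A B +>\<^bsub>pair_algebra A B\<^esub> monoid_point (a, b))"

definition tensor_map ::
    "('a, 'x) star_algebra_scheme \<Rightarrow> ('b, 'y) star_algebra_scheme \<Rightarrow>
     ('c, 'z) star_algebra_scheme \<Rightarrow> ('d, 'w) star_algebra_scheme \<Rightarrow>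
     ('a \<Rightarrow> 'c) \<Rightarrow> ('b \<Rightarrow> 'd) \<Rightarrow> ('a, 'b) ctensor \<Rightarrow> ('c, 'd) ctensor" where
  "tensor_map A B C D f g = (THE h. h \<in> star_hom (cstar_tensor A B) (cstar_tensor C D) \<and>
     (\<forall>a\<in>carrier A. \<forall>b\<in>carrier B. h (pure_tensor A B a b) = pure_tensor C D (f a) (g b)))"


section \<open>Hopf C*-algebras, representations, isomorphisms\<close>

record 'a hopf_cstar = "'a cstar_algebra" +
  comult :: "'a \<Rightarrow> ('a, 'a) ctensor"
  counit :: "'a \<Rightarrow> complex"
  antipode :: "'a \<Rightarrow> 'a"

text \<open>The Hopf structure on a C*-algebra generated by the entries of \<open>u = (u\<^sub>i\<^sub>j)\<close>, \<open>i, j \<in> V\<close>, for which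
  \<open>u\<close> is a corepresentation. Unital *-homomorphisms of C*-algebras are contractive, so each of the
  three maps is unique when it exists.\<close>

definition matrix_hopf ::
    "'a cstar_algebra \<Rightarrow> 'v set \<Rightarrow> ('v \<Rightarrow> 'v \<Rightarrow> 'a) \<Rightarrow> 'a hopf_cstar" where
  "matrix_hopf A V u = cstar_algebra.extend A (hopf_cstar.fields
     (THE f. f \<in> star_hom A (cstar_tensor A A) \<and> (\<forall>i\<in>V. \<forall>j\<in>V.
        f (u i j) = (\<Oplus>\<^bsub>cstar_tensor A A\<^esub>k\<in>V. pure_tensor A A (u i k) (u k j))))
     (THE f. f \<in> star_hom A complex_star_algebra \<and> (\<forall>i\<in>V. \<forall>j\<in>V. f (u i j) = of_bool (i = j)))
     (THE f. f \<in> star_hom A (opposite_algebra A) \<and> (\<forall>i\<in>V. \<forall>j\<in>V. f (u i j) = u j i)))"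

definition hopf_isomorphic :: "'a hopf_cstar \<Rightarrow> 'b hopf_cstar \<Rightarrow> bool" where
  "hopf_isomorphic A B \<longleftrightarrow> (\<exists>f\<in>star_hom A B. bij_betw f (carrier A) (carrier B) \<and>
     (\<forall>a\<in>carrier A. comult B (f a) = tensor_map A A B B f f (comult A a) \<and>
        counit B (f a) = counit A a \<and> antipode B (f a) = f (antipode A a)))"

definition representation :: "'a hopf_cstar \<Rightarrow> nat \<Rightarrow> (nat \<Rightarrow> nat \<Rightarrow> 'a) \<Rightarrow> bool" where
  "representation A k v \<longleftrightarrow> (\<forall>i\<in>{1..k}. \<forall>j\<in>{1..k}. v i j \<in> carrier A \<and>
     comult A (v i j) = (\<Oplus>\<^bsub>cstar_tensor A A\<^esub>l\<in>{1..k}. pure_tensor A A (v i l) (v l j)) \<and>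
     counit A (v i j) = of_bool (i = j))"

definition irreducible_representation ::
    "'a hopf_cstar \<Rightarrow> nat \<Rightarrow> (nat \<Rightarrow> nat \<Rightarrow> 'a) \<Rightarrow> bool" where
  "irreducible_representation A k v \<longleftrightarrow> representation A k v \<and>
     (\<forall>T :: nat \<Rightarrow> nat \<Rightarrow> complex.
        (\<forall>i\<in>{1..k}. \<forall>j\<in>{1..k}. (\<Oplus>\<^bsub>A\<^esub>l\<in>{1..k}. T i l \<odot>\<^bsub>A\<^esub> v l j) = (\<Oplus>\<^bsub>A\<^esub>l\<in>{1..k}. T l j \<odot>\<^bsub>A\<^esub> v i l))
        \<longrightarrow> (\<exists>c. \<forall>i\<in>{1..k}. \<forall>j\<in>{1..k}. T i j = c * of_bool (i = j)))"


section \<open>Quantum symmetric groups and quantum automorphism groups of graphs\<close>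

text \<open>Magic unitaries are indexed by an arbitrary finite set \<open>V\<close>, so that graphs need not have vertex
  set \<open>{1..n}\<close>.\<close>

definition magic_relations :: "'v set \<Rightarrow> ((('v \<times> 'v) \<times> bool) list \<Rightarrow> complex) set" where
  "magic_relations V = (let F = free_star_algebra (V \<times> V); u = (\<lambda>i j. free_gen (i, j)) in
     {star F (u i j) \<ominus>\<^bsub>F\<^esub> u i j | i j. i \<in> V \<and> j \<in> V} \<union>
     {(u i j \<otimes>\<^bsub>F\<^esub> u i j) \<ominus>\<^bsub>F\<^esub> u i j | i j. i \<in> V \<and> j \<in> V} \<union>
     {u i j \<otimes>\<^bsub>F\<^esub> u i k | i j k. i \<in> V \<and> j \<in> V \<and> k \<in> V \<and> j \<noteq> k} \<union>
     {u i j \<otimes>\<^bsub>F\<^esub> u k j | i j k. i \<in> V \<and> j \<in> V \<and> k \<in> V \<and> i \<noteq> k} \<union>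
     {(\<Oplus>\<^bsub>F\<^esub>j\<in>V. u i j) \<ominus>\<^bsub>F\<^esub> \<one>\<^bsub>F\<^esub> | i. i \<in> V} \<union>
     {(\<Oplus>\<^bsub>F\<^esub>i\<in>V. u i j) \<ominus>\<^bsub>F\<^esub> \<one>\<^bsub>F\<^esub> | j. j \<in> V})"

definition perm_cstar :: "'v set \<Rightarrow> ('v \<times> 'v) universal cstar_algebra" where
  "perm_cstar V = universal_cstar (V \<times> V) (magic_relations V)"

definition perm_gen :: "'v set \<Rightarrow> 'v \<Rightarrow> 'v \<Rightarrow> ('v \<times> 'v) universal" where
  "perm_gen V i j = universal_gen (V \<times> V) (magic_relations V) (i, j)"

definition A_s :: "nat \<Rightarrow> (nat \<times> nat) universal hopf_cstar" where
  "A_s n = matrix_hopf (perm_cstar {1..n}) {1..n} (perm_gen {1..n})"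

definition adjacency_matrix :: "('v \<Rightarrow> 'v \<Rightarrow> bool) \<Rightarrow> 'v \<Rightarrow> 'v \<Rightarrow> complex" where
  "adjacency_matrix E i j = of_bool (E i j)"

text \<open>The entries of \<open>d u - u d\<close> in the universal algebra.\<close>

definition graph_relations :: "'v set \<Rightarrow> ('v \<Rightarrow> 'v \<Rightarrow> bool) \<Rightarrow> ('v \<times> 'v) universal set" where
  "graph_relations V E = (let A = perm_cstar V; d = adjacency_matrix E; u = perm_gen V in
     {(\<Oplus>\<^bsub>A\<^esub>k\<in>V. d i k \<odot>\<^bsub>A\<^esub> u k j) \<ominus>\<^bsub>A\<^esub> (\<Oplus>\<^bsub>A\<^esub>k\<in>V. d k j \<odot>\<^bsub>A\<^esub> u i k) | i j. i \<in> V \<and> j \<in> V})"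

definition graph_ideal :: "'v set \<Rightarrow> ('v \<Rightarrow> 'v \<Rightarrow> bool) \<Rightarrow> ('v \<times> 'v) universal set" where
  "graph_ideal V E = closed_ideal_gen (perm_cstar V) (graph_relations V E)"

definition A_graph :: "'v set \<Rightarrow> ('v \<Rightarrow> 'v \<Rightarrow> bool) \<Rightarrow> ('v \<times> 'v) universal set hopf_cstar" where
  "A_graph V E = matrix_hopf (cstar_quotient (perm_cstar V) (graph_ideal V E)) V
     (\<lambda>i j. graph_ideal V E +>\<^bsub>perm_cstar V\<^esub> perm_gen V i j)"

text \<open>The Petersen graph as the Kneser graph \<open>K(5,2)\<close>.\<close>

definition petersen_verts :: "nat set set" where
  "petersen_verts = {e. e \<subseteq> {1..5} \<and> card e = 2}"

definition petersen_adj :: "nat set \<Rightarrow> nat set \<Rightarrow> bool" where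
  "petersen_adj e f \<longleftrightarrow> e \<inter> f = {}"

definition A_petersen :: "(nat set \<times> nat set) universal set hopf_cstar" where
  "A_petersen = A_graph petersen_verts petersen_adj"

end

theory Submission
  imports Defs "HOL-Analysis.Operator_Norm" "HOL-Analysis.Elementary_Normed_Spaces"
    "HOL-Analysis.Cartesian_Space"
begin

text \<open>The Petersen graph has no quantum symmetry. In \<open>A(P)\<close> the relation \<open>du = ud\<close> says that
  \<open>u\<^sub>i\<^sub>j u\<^sub>k\<^sub>l = 0\<close> unless \<open>(i, k)\<close> and \<open>(j, l)\<close> are both equal, both adjacent or both at distance two.
  Since two vertices have at most one common neighbour and the graph is cubic of diameter two, this
  forces \<open>u\<^sub>i\<^sub>j u\<^sub>k\<^sub>l u\<^sub>i\<^sub>s = 0\<close> for \<open>j \<noteq> s\<close>, so that all entries of \<open>u\<close> commute. Hence \<open>A(P)\<close> is the algebra of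
  functions on the finite automorphism group of the graph; its tensor square is the algebra of
  functions on pairs of automorphisms, and representations are matrix representations of this
  group. The eigenspace of the graph for the eigenvalue \<open>1\<close> has dimension five and is irreducible,
  because the automorphism group acts transitively on pairs of vertices of each kind. On the other
  hand \<open>A\<^sub>s(5)\<close> is not commutative: a block magic unitary built from two noncommuting projections
  of \<open>\<complex>\<^sup>2\<close> gives a C*-seminorm that does not vanish on a commutator.\<close>

section \<open>Star-algebras and algebras of functions\<close>

text \<open>Nothing in the statement can be computed directly: the universal algebras are
  completions for a supremum of seminorms, the tensor norm is an infimum, and the structure maps are
  definite descriptions. One device removes all of this, namely identifying an algebra with the
  functions on a finite set. Then *-homomorphisms are pullbacks along maps of points, the least
  C*-norm is the supremum norm, and completing changes nothing. To get there, the closed ideal of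
  the graph relations must be recognised as the common kernel of the evaluations at automorphisms.
  One inclusion is analytic: evaluations are bounded by the universal norm. The other is algebraic
  and is proved before completing, where elements are finite sums of words; commutativity turns
  products of entries along a map into minimal projections with sum one. The number five is the
  multiplicity of the eigenvalue 1 in the spectrum 3, 1, -2 of the graph. A supremum of seminorms is
  bounded below by each of its members, so a single matrix model shows that \<open>A_s 5\<close> is
  not commutative.\<close>

lemma (in ring) minus_mult_distrib:
  assumes "x \<in> carrier R" "y \<in> carrier R" "z \<in> carrier R"
  shows "(x \<otimes> z) \<ominus> (y \<otimes> z) = (x \<ominus> y) \<otimes> z"
  using assms by algebra

lemma (in ring) minus_minus_self:
  assumes "x \<in> carrier R" "y \<in> carrier R"
  shows "(x \<ominus> y) \<ominus> x = \<ominus> y"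
  using assms by algebra

text \<open>The records of the statement carry operations but no laws. This locale collects the
  algebraic laws, without any norm, for the free algebra, the algebra on pairs and all algebras of
  functions.\<close>

locale star_alg = ring A for A :: "('a, 'x) star_algebra_scheme" (structure) +
  assumes smult_closed [simp]: "x \<in> carrier A \<Longrightarrow> c \<odot> x \<in> carrier A"
    and smult_add: "x \<in> carrier A \<Longrightarrow> y \<in> carrier A \<Longrightarrow> c \<odot> (x \<oplus> y) = c \<odot> x \<oplus> c \<odot> y"
    and add_smult: "x \<in> carrier A \<Longrightarrow> (c + d) \<odot> x = c \<odot> x \<oplus> d \<odot> x"
    and smult_smult: "x \<in> carrier A \<Longrightarrow> c \<odot> (d \<odot> x) = (c * d) \<odot> x"
    and one_smult [simp]: "x \<in> carrier A \<Longrightarrow> 1 \<odot> x = x"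
    and smult_mult: "x \<in> carrier A \<Longrightarrow> y \<in> carrier A \<Longrightarrow> (c \<odot> x) \<otimes> y = c \<odot> (x \<otimes> y)"
    and mult_smult: "x \<in> carrier A \<Longrightarrow> y \<in> carrier A \<Longrightarrow> x \<otimes> (c \<odot> y) = c \<odot> (x \<otimes> y)"
    and star_closed [simp]: "x \<in> carrier A \<Longrightarrow> star A x \<in> carrier A"
    and star_add: "x \<in> carrier A \<Longrightarrow> y \<in> carrier A \<Longrightarrow> star A (x \<oplus> y) = star A x \<oplus> star A y"
    and star_mult: "x \<in> carrier A \<Longrightarrow> y \<in> carrier A \<Longrightarrow> star A (x \<otimes> y) = star A y \<otimes> star A x"
    and star_smult: "x \<in> carrier A \<Longrightarrow> star A (c \<odot> x) = cnj c \<odot> star A x"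
    and star_star [simp]: "x \<in> carrier A \<Longrightarrow> star A (star A x) = x"
begin

lemma zero_smult [simp]:
  assumes "x \<in> carrier A"
  shows "0 \<odot> x = \<zero>"
proof -
  have "0 \<odot> x \<oplus> 0 \<odot> x = 0 \<odot> x" using add_smult[of x 0 0] assms by simp
  thus ?thesis using add.l_cancel_one'[of "0 \<odot> x" "0 \<odot> x"] assms by simp
qed

lemma uminus_smult:
  assumes "x \<in> carrier A"
  shows "(-1) \<odot> x = \<ominus> x"
proof -
  have "(-1) \<odot> x \<oplus> x = \<zero>" using add_smult[of x "-1" 1] assms by simp
  thus ?thesis using assms by (intro minus_equality[symmetric]) simp_all
qed

lemma smult_zero [simp]: "c \<odot> \<zero> = \<zero>"
  using smult_smult[of \<zero> c 0] by simp

lemma smult_uminus: "x \<in> carrier A \<Longrightarrow> c \<odot> (\<ominus> x) = \<ominus> (c \<odot> x)"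
  using smult_smult[of x c "-1"] smult_smult[of x "-1" c] by (simp add: uminus_smult)

lemma smult_minus: "x \<in> carrier A \<Longrightarrow> y \<in> carrier A \<Longrightarrow> c \<odot> (x \<ominus> y) = c \<odot> x \<ominus> c \<odot> y"
  unfolding minus_eq by (simp add: smult_add smult_uminus)

lemma star_uminus: "x \<in> carrier A \<Longrightarrow> star A (\<ominus> x) = \<ominus> star A x"
  using star_smult[of x "-1"] by (simp add: uminus_smult)

lemma star_minus: "x \<in> carrier A \<Longrightarrow> y \<in> carrier A \<Longrightarrow> star A (x \<ominus> y) = star A x \<ominus> star A y"
  unfolding minus_eq by (simp add: star_add star_uminus)

text \<open>Scaling by \<open>c\<close> is multiplication by \<open>c \<odot> \<one>\<close>, so a
  ring ideal of a unital algebra is automatically a linear subspace, and the ring-theoretic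
  \<open>ideal\<close> can serve for quotients of algebras.\<close>

lemma smult_in_ideal:
  assumes "ideal I A" "x \<in> I"
  shows "c \<odot> x \<in> I"
proof -
  interpret ideal I A by fact
  have "c \<odot> x = (c \<odot> \<one>) \<otimes> x"
    using assms by (simp add: smult_mult)
  thus ?thesis using I_l_closed assms by simp
qed

lemma coset_eq_iff:
  assumes "ideal J A" "x \<in> carrier A" "y \<in> carrier A"
  shows "J +> x = J +> y \<longleftrightarrow> x \<ominus> y \<in> J"
proof -
  interpret J: ideal J A by fact
  have "x \<in> J +> y \<longleftrightarrow> x \<ominus> y \<in> J"
    using J.a_rcos_module_minus[OF ring_axioms assms(3,2)] .
  moreover have "J +> x = J +> y \<longleftrightarrow> x \<in> J +> y"
    using J.a_rcos_self[OF assms(2)] J.a_repr_independence'[OF _ assms(3), of x] by auto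
  ultimately show ?thesis by (simp only:)
qed

lemma coset_smult_cong:
  assumes "ideal J A" "x \<in> carrier A" "y \<in> carrier A" "J +> x = J +> y"
  shows "J +> (c \<odot> x) = J +> (c \<odot> y)"
  using assms smult_in_ideal[of J "x \<ominus> y" c] by (simp add: coset_eq_iff smult_minus)

end

text \<open>\<open>h\<close> identifies \<open>B\<close> with the *-algebra of all complex functions on the finite set \<open>X\<close>.\<close>

locale function_model =
  fixes B :: "('b, 'x) star_algebra_scheme" (structure)
    and X :: "'p set" and h :: "'p \<Rightarrow> 'b \<Rightarrow> complex"
  assumes finite_points: "finite X"
    and closed: "\<zero> \<in> carrier B" "\<one> \<in> carrier B"
      "x \<in> carrier B \<Longrightarrow> y \<in> carrier B \<Longrightarrow> x \<oplus> y \<in> carrier B"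
      "x \<in> carrier B \<Longrightarrow> y \<in> carrier B \<Longrightarrow> x \<otimes> y \<in> carrier B"
      "x \<in> carrier B \<Longrightarrow> c \<odot> x \<in> carrier B"
      "x \<in> carrier B \<Longrightarrow> star B x \<in> carrier B"
    and ev_zero: "p \<in> X \<Longrightarrow> h p \<zero> = 0"
    and ev_one: "p \<in> X \<Longrightarrow> h p \<one> = 1"
    and ev_add: "p \<in> X \<Longrightarrow> x \<in> carrier B \<Longrightarrow> y \<in> carrier B \<Longrightarrow> h p (x \<oplus> y) = h p x + h p y"
    and ev_mult: "p \<in> X \<Longrightarrow> x \<in> carrier B \<Longrightarrow> y \<in> carrier B \<Longrightarrow> h p (x \<otimes> y) = h p x * h p y"
    and ev_smult: "p \<in> X \<Longrightarrow> x \<in> carrier B \<Longrightarrow> h p (c \<odot> x) = c * h p x"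
    and ev_star: "p \<in> X \<Longrightarrow> x \<in> carrier B \<Longrightarrow> h p (star B x) = cnj (h p x)"
    and ev_eqI: "x \<in> carrier B \<Longrightarrow> y \<in> carrier B \<Longrightarrow> (\<And>p. p \<in> X \<Longrightarrow> h p x = h p y) \<Longrightarrow> x = y"
    and ev_surj: "\<exists>x\<in>carrier B. \<forall>p\<in>X. h p x = \<phi> p"
begin

lemmas ev_simps = ev_zero ev_one ev_add ev_mult ev_smult ev_star

text \<open>Every law is an equation between elements of the carrier, so \<open>ev_eqI\<close>
  reduces it to the same law for complex numbers. The additive inverse of \<open>x\<close> is
  \<open>(-1) \<odot> x\<close>.\<close>

lemma star_alg: "star_alg B"
proof -
  note ev_simps [simp] and closed [simp]
  have "abelian_group B"
  proof (rule abelian_groupI)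
    fix x assume "x \<in> carrier B"
    thus "\<exists>y\<in>carrier B. y \<oplus> x = \<zero>"
      by (intro bexI[of _ "(-1) \<odot> x"] ev_eqI) simp_all
  next
    fix x y z assume "x \<in> carrier B" "y \<in> carrier B" "z \<in> carrier B"
    thus "(x \<oplus> y) \<oplus> z = x \<oplus> (y \<oplus> z)" by (intro ev_eqI) simp_all
  next
    fix x y assume "x \<in> carrier B" "y \<in> carrier B"
    thus "x \<oplus> y = y \<oplus> x" by (intro ev_eqI) simp_all
  next
    fix x assume "x \<in> carrier B"
    thus "\<zero> \<oplus> x = x" by (intro ev_eqI) simp_all
  qed simp_all
  moreover have "Group.monoid B"
    by (rule monoidI; (rule ev_eqI)?) simp_all
  ultimately have "ring B"
    by (rule ringI) (rule ev_eqI; simp add: algebra_simps)+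
  thus ?thesis
    by (intro star_alg.intro star_alg_axioms.intro)
      (simp_all, (rule ev_eqI; simp add: algebra_simps)+)
qed

sublocale star_alg B by (rule star_alg)

lemma mult_commute: "x \<in> carrier B \<Longrightarrow> y \<in> carrier B \<Longrightarrow> x \<otimes> y = y \<otimes> x"
  by (rule ev_eqI) (simp_all add: ev_simps)

lemma ev_finsum:
  assumes "p \<in> X" "f \<in> S \<rightarrow> carrier B" "finite S"
  shows "h p (finsum B f S) = (\<Sum>i\<in>S. h p (f i))"
  using assms(3,2)
proof (induction S)
  case (insert i S)
  thus ?case using assms(1)
    by (subst finsum_insert) (auto simp: ev_add Pi_def intro!: finsum_closed)
qed (simp add: ev_zero assms(1))

definition elt :: "('p \<Rightarrow> complex) \<Rightarrow> 'b" where
  "elt \<phi> = (SOME x. x \<in> carrier B \<and> (\<forall>p\<in>X. h p x = \<phi> p))"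

lemma elt: "elt \<phi> \<in> carrier B" "p \<in> X \<Longrightarrow> h p (elt \<phi>) = \<phi> p"
proof -
  have "elt \<phi> \<in> carrier B \<and> (\<forall>p\<in>X. h p (elt \<phi>) = \<phi> p)"
    unfolding elt_def by (rule someI_ex) (use ev_surj[of \<phi>] in blast)
  thus "elt \<phi> \<in> carrier B" "p \<in> X \<Longrightarrow> h p (elt \<phi>) = \<phi> p" by auto
qed

definition indicator_elt :: "'p set \<Rightarrow> 'b" where
  "indicator_elt S = elt (\<lambda>q. of_bool (q \<in> S))"

lemma indicator_elt [simp]:
  "indicator_elt S \<in> carrier B" "p \<in> X \<Longrightarrow> h p (indicator_elt S) = of_bool (p \<in> S)"
  by (simp_all add: indicator_elt_def elt)

text \<open>The unit is the sum of the indicators of single points, so an additive property of these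
  indicators passes to it. This serves both to locate characters and to prove membership in the
  ideal of the tensor relations.\<close>

lemma one_by_points:
  assumes "Q \<zero>" and add: "\<And>a b. a \<in> carrier B \<Longrightarrow> b \<in> carrier B \<Longrightarrow> Q a \<Longrightarrow> Q b \<Longrightarrow> Q (a \<oplus> b)"
    and point: "\<And>p. p \<in> X \<Longrightarrow> Q (indicator_elt {p})"
  shows "Q \<one>"
proof -
  have "Q (indicator_elt S)" if "finite S" "S \<subseteq> X" for S
    using that
  proof induction
    case empty
    have "indicator_elt {} = \<zero>" by (rule ev_eqI) (simp_all add: ev_simps)
    thus ?case using assms(1) by simp
  next
    case (insert p S)
    have "indicator_elt (insert p S) = indicator_elt {p} \<oplus> indicator_elt S"
      using insert.hyps by (intro ev_eqI) (auto simp: ev_simps)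
    thus ?case using insert point add by simp
  qed
  from this[OF finite_points] have "Q (indicator_elt X)" by simp
  moreover have "indicator_elt X = \<one>" by (rule ev_eqI) (simp_all add: ev_simps)
  ultimately show ?thesis by simp
qed

lemma mult_indicator: "p \<in> X \<Longrightarrow> a \<in> carrier B \<Longrightarrow> indicator_elt {p} \<otimes> a = h p a \<odot> indicator_elt {p}"
  by (rule ev_eqI) (auto simp: ev_simps)

text \<open>The unit is a sum of orthogonal idempotents \<open>indicator_elt {p}\<close>, so a character is nonzero on
  exactly one of them.\<close>

lemma character_is_evaluation:
  assumes add: "\<And>x y. x \<in> carrier B \<Longrightarrow> y \<in> carrier B \<Longrightarrow> \<theta> (x \<oplus> y) = \<theta> x + \<theta> y"
    and mult: "\<And>x y. x \<in> carrier B \<Longrightarrow> y \<in> carrier B \<Longrightarrow> \<theta> (x \<otimes> y) = \<theta> x * \<theta> y"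
    and smult: "\<And>x c. x \<in> carrier B \<Longrightarrow> \<theta> (c \<odot> x) = c * \<theta> x"
    and one: "\<theta> \<one> = (1::complex)"
  shows "\<exists>p\<in>X. \<forall>x\<in>carrier B. \<theta> x = h p x"
proof -
  have "\<exists>p\<in>X. \<theta> (indicator_elt {p}) \<noteq> 0"
  proof (rule ccontr)
    assume "\<not> (\<exists>p\<in>X. \<theta> (indicator_elt {p}) \<noteq> 0)"
    moreover have "\<theta> \<zero> = 0" using smult[of \<zero> 0] by simp
    ultimately have "\<theta> \<one> = 0"
      using add by (intro one_by_points[where Q = "\<lambda>x. \<theta> x = 0"]) auto
    thus False using one by simp
  qed
  then obtain p where p: "p \<in> X" "\<theta> (indicator_elt {p}) \<noteq> 0" by blast
  have "\<theta> x = h p x" if x: "x \<in> carrier B" for x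
  proof -
    have "\<theta> (indicator_elt {p}) * \<theta> x = \<theta> (indicator_elt {p} \<otimes> x)"
      using x by (simp add: mult)
    also have "\<dots> = h p x * \<theta> (indicator_elt {p})"
      using p x by (simp only: mult_indicator smult indicator_elt)
    finally show ?thesis using p by simp
  qed
  thus ?thesis using p by blast
qed

end

text \<open>With the complex numbers as the functions on one point, the counit is treated by the
  same theory of homomorphisms as the comultiplication.\<close>

lemma function_model_complex: "function_model complex_star_algebra {()} (\<lambda>_ c. c)"
  by unfold_locales (auto simp: complex_star_algebra_def)

section \<open>Homomorphisms between algebras of functions on finite sets\<close>

locale function_models = B: function_model B X h + D: function_model D Y k
  for B :: "('b, 'x) star_algebra_scheme" and X :: "'p set" and h
    and D :: "('d, 'y) star_algebra_scheme" and Y :: "'q set" and k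
begin

text \<open>The *-homomorphism dual to a map of points. It is restricted to the carrier because the
  members of \<open>star_hom\<close> are extensional.\<close>

definition pullback :: "('q \<Rightarrow> 'p) \<Rightarrow> 'b \<Rightarrow> 'd" where
  "pullback \<tau> = (\<lambda>x\<in>carrier B. D.elt (\<lambda>q. h (\<tau> q) x))"

lemma pullback:
  assumes "x \<in> carrier B"
  shows "pullback \<tau> x \<in> carrier D" "q \<in> Y \<Longrightarrow> k q (pullback \<tau> x) = h (\<tau> q) x"
  using assms by (auto simp: pullback_def D.elt)

lemma pullback_star_hom:
  assumes "\<tau> \<in> Y \<rightarrow> X"
  shows "pullback \<tau> \<in> star_hom B D"
proof -
  have \<tau>: "\<tau> q \<in> X" if "q \<in> Y" for q using assms that by auto
  show ?thesis
    unfolding star_hom_def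
    by (auto intro!: ring_hom_memI D.ev_eqI simp: pullback B.ev_simps D.ev_simps \<tau>)
      (auto simp: pullback_def)
qed

text \<open>Following \<open>f\<close> by the evaluation at \<open>q\<close> gives a character of
  \<open>B\<close>, and characters are evaluations.\<close>

lemma star_hom_is_pullback:
  assumes "f \<in> star_hom B D" "q \<in> Y"
  shows "\<exists>p\<in>X. \<forall>x\<in>carrier B. k q (f x) = h p x"
proof (rule B.character_is_evaluation)
  have f: "f \<in> ring_hom B D" "\<And>a c. a \<in> carrier B \<Longrightarrow> f (c \<odot>\<^bsub>B\<^esub> a) = c \<odot>\<^bsub>D\<^esub> f a"
    using assms(1) by (auto simp: star_hom_def)
  note f_simps = ring_hom_closed[OF f(1)] ring_hom_add[OF f(1)] ring_hom_mult[OF f(1)]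
    ring_hom_one[OF f(1)] f(2)
  show "k q (f (x \<oplus>\<^bsub>B\<^esub> y)) = k q (f x) + k q (f y)"
    "k q (f (x \<otimes>\<^bsub>B\<^esub> y)) = k q (f x) * k q (f y)" if "x \<in> carrier B" "y \<in> carrier B" for x y
    using that assms(2) by (simp_all add: f_simps D.ev_simps)
  show "k q (f (c \<odot>\<^bsub>B\<^esub> x)) = c * k q (f x)" if "x \<in> carrier B" for x c
    using that assms(2) by (simp add: f_simps D.ev_simps)
  show "k q (f \<one>\<^bsub>B\<^esub>) = 1" using assms(2) by (simp add: f_simps D.ev_simps)
qed

text \<open>Evaluates the definite descriptions in \<open>matrix_hopf\<close>. Instead of showing
  that the \<open>u i j\<close> generate \<open>B\<close>, it is enough that they separate points:
  at each \<open>q\<close> the homomorphism is the evaluation at some point, and its values on the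
  \<open>u i j\<close> force this point to be \<open>\<tau> q\<close>.\<close>

lemma the_star_hom_eq_pullback:
  assumes u: "\<And>i j. i \<in> V \<Longrightarrow> j \<in> V \<Longrightarrow> u i j \<in> carrier B"
    and sep: "\<And>p p'. p \<in> X \<Longrightarrow> p' \<in> X \<Longrightarrow> (\<And>i j. i \<in> V \<Longrightarrow> j \<in> V \<Longrightarrow> h p (u i j) = h p' (u i j)) \<Longrightarrow> p = p'"
    and \<tau>: "\<tau> \<in> Y \<rightarrow> X"
    and r: "\<And>i j. i \<in> V \<Longrightarrow> j \<in> V \<Longrightarrow> r i j \<in> carrier D"
    and r\<tau>: "\<And>i j q. i \<in> V \<Longrightarrow> j \<in> V \<Longrightarrow> q \<in> Y \<Longrightarrow> k q (r i j) = h (\<tau> q) (u i j)"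
  shows "(THE f. f \<in> star_hom B D \<and> (\<forall>i\<in>V. \<forall>j\<in>V. f (u i j) = r i j)) = pullback \<tau>"
proof (rule the_equality, intro conjI ballI)
  show "pullback \<tau> \<in> star_hom B D" using \<tau> by (rule pullback_star_hom)
  show "pullback \<tau> (u i j) = r i j" if "i \<in> V" "j \<in> V" for i j
    using that by (intro D.ev_eqI) (auto simp: pullback u r r\<tau>)
next
  fix f assume f: "f \<in> star_hom B D \<and> (\<forall>i\<in>V. \<forall>j\<in>V. f (u i j) = r i j)"
  hence f': "f \<in> ring_hom B D" "f \<in> extensional (carrier B)" by (auto simp: star_hom_def)
  show "f = pullback \<tau>"
  proof (rule extensionalityI[OF f'(2)])
    show "pullback \<tau> \<in> extensional (carrier B)" by (simp add: pullback_def)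
    fix x assume x: "x \<in> carrier B"
    show "f x = pullback \<tau> x"
    proof (rule D.ev_eqI)
      fix q assume q: "q \<in> Y"
      obtain p where p: "p \<in> X" "\<And>x. x \<in> carrier B \<Longrightarrow> k q (f x) = h p x"
        using star_hom_is_pullback[of f q] f q by blast
      have "p = \<tau> q"
        using p q \<tau> f r\<tau> u by (intro sep) (auto simp flip: p(2))
      thus "k q (f x) = k q (pullback \<tau> x)" using p x q by (simp add: pullback)
    qed (use x ring_hom_closed[OF f'(1)] in \<open>auto simp: pullback\<close>)
  qed
qed

end

section \<open>The *-algebra of an involutive monoid\<close>

text \<open>The linear extension of \<open>\<phi>\<close> to finitely supported functions. The
  convolution product sums over fibres of the multiplication, which is awkward to iterate; against a
  test function it becomes an iterated sum, so identities in the algebra are proved by testing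
  against every \<open>\<phi>\<close>.\<close>

definition pairing :: "('m \<Rightarrow> complex) \<Rightarrow> ('m \<Rightarrow> complex) \<Rightarrow> complex" where
  "pairing \<phi> f = (\<Sum>x | f x \<noteq> 0. f x * \<phi> x)"

lemma pairing_superset:
  assumes "finite S" "{x. f x \<noteq> 0} \<subseteq> S"
  shows "pairing \<phi> f = (\<Sum>x\<in>S. f x * \<phi> x)"
  unfolding pairing_def using assms by (intro sum.mono_neutral_left) auto

lemma pairing_cong: "(\<And>x. f x \<noteq> 0 \<Longrightarrow> \<phi> x = \<psi> x) \<Longrightarrow> pairing \<phi> f = pairing \<psi> f"
  unfolding pairing_def by (intro sum.cong) auto

lemma pairing_point [simp]: "pairing \<phi> (monoid_point x) = \<phi> x"
  by (simp add: pairing_def monoid_point_def)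

lemma pairing_indicator: "finite {x. f x \<noteq> 0} \<Longrightarrow> pairing (monoid_point x) f = f x"
  by (subst pairing_superset[of "insert x {x. f x \<noteq> 0}"])
    (auto simp: monoid_point_def of_bool_def if_distrib sum.If_cases cong: if_cong)

lemma eq_by_pairing:
  assumes "finite {x. f x \<noteq> 0}" "finite {x. g x \<noteq> 0}" "\<And>\<phi>. pairing \<phi> f = pairing \<phi> g"
  shows "f = g"
proof
  fix x show "f x = g x"
    using pairing_indicator[OF assms(1), of x] pairing_indicator[OF assms(2), of x] assms(3) by simp
qed

lemma pairing_add:
  assumes "finite {x. f x \<noteq> 0}" "finite {x. g x \<noteq> 0}"
  shows "pairing \<phi> (\<lambda>x. f x + g x) = pairing \<phi> f + pairing \<phi> g"
proof -
  let ?S = "{x. f x \<noteq> 0} \<union> {x. g x \<noteq> 0}"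
  have "pairing \<phi> (\<lambda>x. f x + g x) = (\<Sum>x\<in>?S. (f x + g x) * \<phi> x)"
    using assms by (intro pairing_superset) auto
  moreover have "pairing \<phi> f = (\<Sum>x\<in>?S. f x * \<phi> x)" "pairing \<phi> g = (\<Sum>x\<in>?S. g x * \<phi> x)"
    using assms by (intro pairing_superset; auto)+
  ultimately show ?thesis by (simp add: sum.distrib distrib_right)
qed

lemma pairing_scale: "finite {x. f x \<noteq> 0} \<Longrightarrow> pairing \<phi> (\<lambda>x. c * f x) = c * pairing \<phi> f"
  by (subst pairing_superset[of "{x. f x \<noteq> 0}"])
    (auto simp: pairing_def sum_distrib_left mult.assoc)

lemma pairing_fun_add: "pairing (\<lambda>x. \<phi> x + \<psi> x) f = pairing \<phi> f + pairing \<psi> f"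
  by (simp add: pairing_def sum.distrib distrib_left)

lemma pairing_fun_scale: "pairing (\<lambda>x. c * \<phi> x) f = c * pairing \<phi> f"
  by (simp add: pairing_def sum_distrib_left mult.left_commute)

text \<open>Instantiated twice: by words with reversal, and by the product of the multiplicative
  monoids of two algebras with their involutions.\<close>

locale involutive_monoid = monoid M for M (structure) +
  fixes J
  assumes J_closed [simp]: "x \<in> carrier M \<Longrightarrow> J x \<in> carrier M"
    and J_J [simp]: "x \<in> carrier M \<Longrightarrow> J (J x) = x"
    and J_mult: "x \<in> carrier M \<Longrightarrow> y \<in> carrier M \<Longrightarrow> J (x \<otimes> y) = J y \<otimes> J x"
begin

abbreviation A where "A \<equiv> star_monoid_algebra M J"

lemma carrier_iff: "f \<in> carrier A \<longleftrightarrow> finite {x. f x \<noteq> 0} \<and> {x. f x \<noteq> 0} \<subseteq> carrier M"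
  by (simp add: star_monoid_algebra_def)

lemma finite_support: "f \<in> carrier A \<Longrightarrow> finite {x. f x \<noteq> 0}"
  and support_carrier: "f \<in> carrier A \<Longrightarrow> f x \<noteq> 0 \<Longrightarrow> x \<in> carrier M"
  by (auto simp: carrier_iff)

lemma point_closed [simp]: "x \<in> carrier M \<Longrightarrow> monoid_point x \<in> carrier A"
  by (auto simp: carrier_iff monoid_point_def)

lemma one_eq_point: "\<one>\<^bsub>A\<^esub> = monoid_point \<one>"
  by (auto simp: star_monoid_algebra_def monoid_point_def)

lemma mult_closed:
  assumes "f \<in> carrier A" "g \<in> carrier A"
  shows "f \<otimes>\<^bsub>A\<^esub> g \<in> carrier A"
proof -
  have "{z. (f \<otimes>\<^bsub>A\<^esub> g) z \<noteq> 0} \<subseteq> (\<lambda>(x, y). x \<otimes> y) ` ({x. f x \<noteq> 0} \<times> {y. g y \<noteq> 0})"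
  proof clarify
    fix z assume "(f \<otimes>\<^bsub>A\<^esub> g) z \<noteq> 0"
    then obtain x y where "f x \<noteq> 0" "g y \<noteq> 0" "x \<otimes> y = z"
      unfolding star_monoid_algebra_def by (auto elim!: sum.not_neutral_contains_not_neutral)
    thus "z \<in> (\<lambda>(x, y). x \<otimes> y) ` ({x. f x \<noteq> 0} \<times> {y. g y \<noteq> 0})" by auto
  qed
  moreover have "finite ((\<lambda>(x, y). x \<otimes> y) ` ({x. f x \<noteq> 0} \<times> {y. g y \<noteq> 0}))"
    using assms by (intro finite_imageI finite_cartesian_product finite_support)
  moreover have "(\<lambda>(x, y). x \<otimes> y) ` ({x. f x \<noteq> 0} \<times> {y. g y \<noteq> 0}) \<subseteq> carrier M"
    using assms support_carrier by fastforce
  ultimately show ?thesis unfolding carrier_iff by (blast intro: finite_subset)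
qed

text \<open>The sum over all pairs of support points is grouped by the value of the product; the
  groups are exactly the sums that define the convolution.\<close>

lemma pairing_mult:
  assumes "f \<in> carrier A" "g \<in> carrier A"
  shows "pairing \<phi> (f \<otimes>\<^bsub>A\<^esub> g) = pairing (\<lambda>x. pairing (\<lambda>y. \<phi> (x \<otimes> y)) g) f"
proof -
  let ?S = "{x. f x \<noteq> 0} \<times> {y. g y \<noteq> 0}" and ?m = "\<lambda>(x, y). x \<otimes> y"
  have fin: "finite ?S" using assms by (intro finite_cartesian_product finite_support)
  have fg: "(f \<otimes>\<^bsub>A\<^esub> g) z = (\<Sum>w\<in>{w \<in> ?S. ?m w = z}. f (fst w) * g (snd w))" for z
    unfolding star_monoid_algebra_def by (auto intro!: sum.cong)
  have supp: "{z. (f \<otimes>\<^bsub>A\<^esub> g) z \<noteq> 0} \<subseteq> ?m ` ?S"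
  proof clarify
    fix z assume "(f \<otimes>\<^bsub>A\<^esub> g) z \<noteq> 0"
    thus "z \<in> ?m ` ?S" unfolding fg
      by (elim sum.not_neutral_contains_not_neutral) blast
  qed
  have "pairing \<phi> (f \<otimes>\<^bsub>A\<^esub> g) = (\<Sum>z\<in>?m ` ?S. (f \<otimes>\<^bsub>A\<^esub> g) z * \<phi> z)"
    using fin supp by (intro pairing_superset) auto
  also have "\<dots> = (\<Sum>z\<in>?m ` ?S. \<Sum>w\<in>{w \<in> ?S. ?m w = z}. f (fst w) * g (snd w) * \<phi> (?m w))"
    by (intro sum.cong refl) (auto simp: fg sum_distrib_right)
  also have "\<dots> = (\<Sum>w\<in>?S. f (fst w) * g (snd w) * \<phi> (?m w))"
    by (rule sum.image_gen[OF fin, symmetric])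
  also have "\<dots> = (\<Sum>x | f x \<noteq> 0. \<Sum>y | g y \<noteq> 0. f x * g y * \<phi> (x \<otimes> y))"
    by (subst sum.cartesian_product) (simp add: case_prod_beta)
  finally show ?thesis by (simp add: pairing_def sum_distrib_left mult.assoc)
qed

lemma star_closed:
  assumes "f \<in> carrier A"
  shows "star A f \<in> carrier A"
proof -
  have "{z. star A f z \<noteq> 0} \<subseteq> J ` {x. f x \<noteq> 0}"
  proof clarify
    fix z assume "star A f z \<noteq> 0"
    thus "z \<in> J ` {x. f x \<noteq> 0}" unfolding star_monoid_algebra_def
      by (auto elim!: sum.not_neutral_contains_not_neutral)
  qed
  moreover have "finite (J ` {x. f x \<noteq> 0})" using assms by (intro finite_imageI finite_support)
  moreover have "J ` {x. f x \<noteq> 0} \<subseteq> carrier M" using assms support_carrier by fastforce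
  ultimately show ?thesis unfolding carrier_iff by (blast intro: finite_subset)
qed

lemma pairing_star:
  assumes "f \<in> carrier A"
  shows "pairing \<phi> (star A f) = cnj (pairing (\<lambda>x. cnj (\<phi> (J x))) f)"
proof -
  let ?S = "{x. f x \<noteq> 0}"
  have fin: "finite ?S" using assms by (rule finite_support)
  have f: "star A f z = (\<Sum>w\<in>{w \<in> ?S. J w = z}. cnj (f w))" for z
    unfolding star_monoid_algebra_def by simp
  have supp: "{z. star A f z \<noteq> 0} \<subseteq> J ` ?S"
  proof clarify
    fix z assume "star A f z \<noteq> 0"
    thus "z \<in> J ` ?S" unfolding f
      by (elim sum.not_neutral_contains_not_neutral) blast
  qed
  have "pairing \<phi> (star A f) = (\<Sum>z\<in>J ` ?S. star A f z * \<phi> z)"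
    using fin supp by (intro pairing_superset) auto
  also have "\<dots> = (\<Sum>z\<in>J ` ?S. \<Sum>w\<in>{w \<in> ?S. J w = z}. cnj (f w) * \<phi> (J w))"
    by (intro sum.cong refl) (auto simp: f sum_distrib_right)
  also have "\<dots> = (\<Sum>w\<in>?S. cnj (f w) * \<phi> (J w))"
    by (rule sum.image_gen[OF fin, symmetric])
  finally show ?thesis by (simp add: pairing_def)
qed

lemma add_closed: "f \<in> carrier A \<Longrightarrow> g \<in> carrier A \<Longrightarrow> f \<oplus>\<^bsub>A\<^esub> g \<in> carrier A"
  unfolding carrier_iff
  by (auto simp: star_monoid_algebra_def elim: finite_subset[rotated, OF finite_UnI])
    (metis (mono_tags, lifting) add_cancel_left_left mem_Collect_eq subsetD)

lemma scale_closed: "f \<in> carrier A \<Longrightarrow> c \<odot>\<^bsub>A\<^esub> f \<in> carrier A"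
  unfolding carrier_iff
  by (auto simp: star_monoid_algebra_def elim: finite_subset[rotated])

lemma pairing_plus:
  "f \<in> carrier A \<Longrightarrow> g \<in> carrier A \<Longrightarrow> pairing \<phi> (f \<oplus>\<^bsub>A\<^esub> g) = pairing \<phi> f + pairing \<phi> g"
  using pairing_add[OF finite_support finite_support, of f g \<phi>] by (simp add: star_monoid_algebra_def)

lemma pairing_smult: "f \<in> carrier A \<Longrightarrow> pairing \<phi> (c \<odot>\<^bsub>A\<^esub> f) = c * pairing \<phi> f"
  using pairing_scale[OF finite_support, of f \<phi> c] by (simp add: star_monoid_algebra_def)

lemma pairing_zero: "pairing \<phi> \<zero>\<^bsub>A\<^esub> = 0"
  by (simp add: star_monoid_algebra_def pairing_def)

lemma pairing_one: "pairing \<phi> \<one>\<^bsub>A\<^esub> = \<phi> \<one>"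
  by (simp add: one_eq_point)

lemma alg_eqI: "f \<in> carrier A \<Longrightarrow> g \<in> carrier A \<Longrightarrow> (\<And>\<phi>. pairing \<phi> f = pairing \<phi> g) \<Longrightarrow> f = g"
  by (rule eq_by_pairing[OF finite_support finite_support])

lemmas pairing_simps = pairing_plus pairing_smult pairing_zero pairing_one pairing_mult pairing_star

lemma zero_closed: "\<zero>\<^bsub>A\<^esub> \<in> carrier A"
  by (simp add: star_monoid_algebra_def)

lemma one_closed': "\<one>\<^bsub>A\<^esub> \<in> carrier A"
  by (simp add: one_eq_point)

lemmas closed = add_closed scale_closed star_closed mult_closed zero_closed one_closed'

lemma star_alg: "star_alg A"
proof -
  note closed [simp] pairing_simps [simp]
  have sc: "f x \<noteq> 0 \<Longrightarrow> x \<in> carrier M" if "f \<in> carrier A" for f x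
    using support_carrier[OF that] .
  have "abelian_group A"
  proof (rule abelian_groupI)
    fix x assume "x \<in> carrier A"
    thus "\<exists>y\<in>carrier A. y \<oplus>\<^bsub>A\<^esub> x = \<zero>\<^bsub>A\<^esub>"
      by (intro bexI[of _ "(-1) \<odot>\<^bsub>A\<^esub> x"] alg_eqI) simp_all
  next
    fix x y z assume "x \<in> carrier A" "y \<in> carrier A" "z \<in> carrier A"
    thus "(x \<oplus>\<^bsub>A\<^esub> y) \<oplus>\<^bsub>A\<^esub> z = x \<oplus>\<^bsub>A\<^esub> (y \<oplus>\<^bsub>A\<^esub> z)" by (intro alg_eqI) simp_all
  next
    fix x y assume "x \<in> carrier A" "y \<in> carrier A"
    thus "x \<oplus>\<^bsub>A\<^esub> y = y \<oplus>\<^bsub>A\<^esub> x" by (intro alg_eqI) simp_all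
  next
    fix x assume "x \<in> carrier A"
    thus "\<zero>\<^bsub>A\<^esub> \<oplus>\<^bsub>A\<^esub> x = x" by (intro alg_eqI) simp_all
  qed simp_all
  moreover have "Group.monoid A"
  proof (rule monoidI)
    fix f g k assume *: "f \<in> carrier A" "g \<in> carrier A" "k \<in> carrier A"
    show "f \<otimes>\<^bsub>A\<^esub> g \<otimes>\<^bsub>A\<^esub> k = f \<otimes>\<^bsub>A\<^esub> (g \<otimes>\<^bsub>A\<^esub> k)"
      using * by (intro alg_eqI) (auto intro!: pairing_cong simp: m_assoc sc[OF *(1)] sc[OF *(2)] sc[OF *(3)])
  next
    fix f assume *: "f \<in> carrier A"
    show "\<one>\<^bsub>A\<^esub> \<otimes>\<^bsub>A\<^esub> f = f" "f \<otimes>\<^bsub>A\<^esub> \<one>\<^bsub>A\<^esub> = f"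
      using * by (auto intro!: alg_eqI pairing_cong simp: sc[OF *])
  qed simp_all
  moreover have "(f \<oplus>\<^bsub>A\<^esub> g) \<otimes>\<^bsub>A\<^esub> k = f \<otimes>\<^bsub>A\<^esub> k \<oplus>\<^bsub>A\<^esub> g \<otimes>\<^bsub>A\<^esub> k"
    "k \<otimes>\<^bsub>A\<^esub> (f \<oplus>\<^bsub>A\<^esub> g) = k \<otimes>\<^bsub>A\<^esub> f \<oplus>\<^bsub>A\<^esub> k \<otimes>\<^bsub>A\<^esub> g"
    if "f \<in> carrier A" "g \<in> carrier A" "k \<in> carrier A" for f g k
    using that by (intro alg_eqI; simp add: pairing_fun_add)+
  ultimately have "ring A" by (intro ringI)
  moreover have "star_alg_axioms A"
  proof
    fix f c d assume f: "f \<in> carrier A"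
    show "star A (star A f) = f"
      using f sc[OF f] by (intro alg_eqI) (auto intro!: pairing_cong)
    show "(c + d) \<odot>\<^bsub>A\<^esub> f = c \<odot>\<^bsub>A\<^esub> f \<oplus>\<^bsub>A\<^esub> d \<odot>\<^bsub>A\<^esub> f" "c \<odot>\<^bsub>A\<^esub> (d \<odot>\<^bsub>A\<^esub> f) = (c * d) \<odot>\<^bsub>A\<^esub> f"
      "1 \<odot>\<^bsub>A\<^esub> f = f" "star A (c \<odot>\<^bsub>A\<^esub> f) = cnj c \<odot>\<^bsub>A\<^esub> star A f"
      using f by (intro alg_eqI; simp add: distrib_right)+
    fix g assume g: "g \<in> carrier A"
    show "c \<odot>\<^bsub>A\<^esub> (f \<oplus>\<^bsub>A\<^esub> g) = c \<odot>\<^bsub>A\<^esub> f \<oplus>\<^bsub>A\<^esub> c \<odot>\<^bsub>A\<^esub> g"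
      "c \<odot>\<^bsub>A\<^esub> f \<otimes>\<^bsub>A\<^esub> g = c \<odot>\<^bsub>A\<^esub> (f \<otimes>\<^bsub>A\<^esub> g)" "f \<otimes>\<^bsub>A\<^esub> (c \<odot>\<^bsub>A\<^esub> g) = c \<odot>\<^bsub>A\<^esub> (f \<otimes>\<^bsub>A\<^esub> g)"
      "star A (f \<oplus>\<^bsub>A\<^esub> g) = star A f \<oplus>\<^bsub>A\<^esub> star A g"
      using f g by (intro alg_eqI; simp add: distrib_left pairing_fun_scale)+
    show "star A (f \<otimes>\<^bsub>A\<^esub> g) = star A g \<otimes>\<^bsub>A\<^esub> star A f"
    proof (rule alg_eqI)
      fix \<phi>
      have "pairing \<phi> (star A (f \<otimes>\<^bsub>A\<^esub> g)) =
          cnj (\<Sum>x | f x \<noteq> 0. \<Sum>y | g y \<noteq> 0. f x * g y * cnj (\<phi> (J y \<otimes> J x)))"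
        using f g sc[OF f] sc[OF g]
        by (auto simp: pairing_def[of _ f] pairing_def[of _ g] sum_distrib_left J_mult mult.assoc
          intro!: sum.cong arg_cong[of _ _ cnj])
      also have "\<dots> = cnj (\<Sum>y | g y \<noteq> 0. \<Sum>x | f x \<noteq> 0. f x * g y * cnj (\<phi> (J y \<otimes> J x)))"
        by (subst sum.swap) simp
      also have "\<dots> = pairing \<phi> (star A g \<otimes>\<^bsub>A\<^esub> star A f)"
        using f g by (simp add: pairing_def[of _ f] pairing_def[of _ g] sum_distrib_left mult_ac)
      finally show "pairing \<phi> (star A (f \<otimes>\<^bsub>A\<^esub> g)) = pairing \<phi> (star A g \<otimes>\<^bsub>A\<^esub> star A f)" .
    qed (use f g in simp_all)
  qed simp_all
  ultimately show ?thesis by (rule star_alg.intro)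
qed

lemma point_mult:
  assumes "x \<in> carrier M" "y \<in> carrier M"
  shows "monoid_point x \<otimes>\<^bsub>A\<^esub> monoid_point y = monoid_point (x \<otimes> y)"
  using assms by (intro alg_eqI) (simp_all add: mult_closed pairing_mult)

lemma star_point: "x \<in> carrier M \<Longrightarrow> star A (monoid_point x) = monoid_point (J x)"
  by (intro alg_eqI) (simp_all add: star_closed pairing_star)

lemma pairing_minus:
  assumes "f \<in> carrier A" "g \<in> carrier A"
  shows "pairing \<phi> (f \<ominus>\<^bsub>A\<^esub> g) = pairing \<phi> f - pairing \<phi> g"
proof -
  interpret A: star_alg A by (rule star_alg)
  show ?thesis using assms
    by (simp add: A.minus_eq pairing_plus pairing_smult flip: A.uminus_smult)
qed

text \<open>For multiplicative \<open>\<phi>\<close> the iterated sum factors. Hence characters of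
  the monoid extend to characters of its algebra.\<close>

lemma pairing_mult_character:
  assumes "f \<in> carrier A" "g \<in> carrier A"
    and mult: "\<And>x y. x \<in> carrier M \<Longrightarrow> y \<in> carrier M \<Longrightarrow> \<phi> (x \<otimes> y) = \<phi> x * \<phi> y"
  shows "pairing \<phi> (f \<otimes>\<^bsub>A\<^esub> g) = pairing \<phi> f * pairing \<phi> g"
proof -
  have "pairing \<phi> (f \<otimes>\<^bsub>A\<^esub> g) = pairing (\<lambda>x. pairing (\<lambda>y. \<phi> (x \<otimes> y)) g) f"
    using assms(1,2) by (rule pairing_mult)
  also have "\<dots> = pairing (\<lambda>x. pairing \<phi> g * \<phi> x) f"
  proof (rule pairing_cong)
    fix x assume "f x \<noteq> 0"
    hence "x \<in> carrier M" using support_carrier assms(1) by blast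
    hence "pairing (\<lambda>y. \<phi> (x \<otimes> y)) g = pairing (\<lambda>y. \<phi> x * \<phi> y) g"
      using mult support_carrier[OF assms(2)] by (intro pairing_cong) simp
    thus "pairing (\<lambda>y. \<phi> (x \<otimes> y)) g = pairing \<phi> g * \<phi> x"
      by (simp only: pairing_fun_scale mult.commute[of "pairing \<phi> g"])
  qed
  also have "\<dots> = pairing \<phi> f * pairing \<phi> g"
    unfolding pairing_fun_scale by (rule mult.commute)
  finally show ?thesis .
qed

lemma pairing_star_character:
  assumes "f \<in> carrier A" and star: "\<And>x. x \<in> carrier M \<Longrightarrow> \<phi> (J x) = cnj (\<phi> x)"
  shows "pairing \<phi> (star A f) = cnj (pairing \<phi> f)"
proof -
  have "pairing (\<lambda>x. cnj (\<phi> (J x))) f = pairing \<phi> f"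
    using star support_carrier[OF assms(1)] by (intro pairing_cong) simp
  thus ?thesis using pairing_star[OF assms(1)] by simp
qed

text \<open>An element is a finite linear combination of points; the proof cuts it off to a finite
  set \<open>S\<close> and lets \<open>S\<close> grow to the support.\<close>

lemma carrier_induct [consumes 1, case_names zero add smult point]:
  assumes f: "f \<in> carrier A"
    and zero: "P \<zero>\<^bsub>A\<^esub>"
    and add: "\<And>f g. f \<in> carrier A \<Longrightarrow> g \<in> carrier A \<Longrightarrow> P f \<Longrightarrow> P g \<Longrightarrow> P (f \<oplus>\<^bsub>A\<^esub> g)"
    and smult: "\<And>c f. f \<in> carrier A \<Longrightarrow> P f \<Longrightarrow> P (c \<odot>\<^bsub>A\<^esub> f)"
    and point: "\<And>x. x \<in> carrier M \<Longrightarrow> P (monoid_point x)"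
  shows "P f"
proof -
  have "P (\<lambda>x. if x \<in> S then f x else 0)" if "finite S" "S \<subseteq> carrier M" for S
    using that
  proof (induction S)
    case empty
    thus ?case using zero by (simp add: star_monoid_algebra_def)
  next
    case (insert x S)
    have "(\<lambda>y. if y \<in> insert x S then f y else 0) =
        f x \<odot>\<^bsub>A\<^esub> monoid_point x \<oplus>\<^bsub>A\<^esub> (\<lambda>y. if y \<in> S then f y else 0)"
      using insert.hyps by (auto simp: star_monoid_algebra_def monoid_point_def)
    moreover have "(\<lambda>y. if y \<in> S then f y else 0) \<in> carrier A"
      using insert.prems insert.hyps by (auto simp: carrier_iff)
    ultimately show ?case
      using insert by (auto intro!: add smult point scale_closed)
  qed
  hence "P (\<lambda>x. if x \<in> {x. f x \<noteq> 0} then f x else 0)" using f unfolding carrier_iff by blast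
  moreover have "(\<lambda>x. if x \<in> {x. f x \<noteq> 0} then f x else 0) = f" by auto
  ultimately show ?thesis by (simp only:)
qed

end

section \<open>Completions\<close>

locale seminormed_star_alg = star_alg +
  fixes q
  assumes seminorm: "cstar_seminorm A q"
begin

lemma q_nonneg: "x \<in> carrier A \<Longrightarrow> 0 \<le> q x"
  and q_smult: "x \<in> carrier A \<Longrightarrow> q (c \<odot> x) = cmod c * q x"
  and q_cstar: "x \<in> carrier A \<Longrightarrow> q (star A x \<otimes> x) = (q x)\<^sup>2"
  and q_add: "x \<in> carrier A \<Longrightarrow> y \<in> carrier A \<Longrightarrow> q (x \<oplus> y) \<le> q x + q y"
  and q_mult: "x \<in> carrier A \<Longrightarrow> y \<in> carrier A \<Longrightarrow> q (x \<otimes> y) \<le> q x * q y"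
  using seminorm by (simp_all add: cstar_seminorm_def)

lemma q_zero [simp]: "q \<zero> = 0"
  using q_smult[of \<zero> 0] by simp

lemma q_self [simp]: "x \<in> carrier A \<Longrightarrow> q (x \<ominus> x) = 0"
  by (simp add: minus_eq r_neg)

lemma q_uminus: "x \<in> carrier A \<Longrightarrow> q (\<ominus> x) = q x"
  using q_smult[of x "-1"] by (simp add: uminus_smult)

lemma q_minus_commute:
  assumes "x \<in> carrier A" "y \<in> carrier A"
  shows "q (x \<ominus> y) = q (y \<ominus> x)"
proof -
  have "y \<ominus> x = \<ominus> (x \<ominus> y)" using assms by algebra
  thus ?thesis using assms by (simp add: q_uminus)
qed

lemma q_triangle:
  assumes "x \<in> carrier A" "y \<in> carrier A" "z \<in> carrier A"
  shows "q (x \<ominus> z) \<le> q (x \<ominus> y) + q (y \<ominus> z)"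
proof -
  have "x \<ominus> z = (x \<ominus> y) \<oplus> (y \<ominus> z)" using assms by algebra
  thus ?thesis using assms q_add[of "x \<ominus> y" "y \<ominus> z"] by simp
qed

lemma q_diff:
  assumes "x \<in> carrier A" "y \<in> carrier A"
  shows "\<bar>q x - q y\<bar> \<le> q (x \<ominus> y)"
proof -
  have "q a \<le> q (a \<ominus> b) + q b" if "a \<in> carrier A" "b \<in> carrier A" for a b
    using q_triangle[of a b \<zero>] that by (simp add: minus_eq)
  from this[of x y] this[of y x] show ?thesis
    using assms q_minus_commute[of x y] by linarith
qed

text \<open>The C*-identity and submultiplicativity give
  \<open>q x * q x \<le> q (star A x) * q x\<close>. Cancel \<open>q x\<close>, then apply the same
  bound to \<open>star A x\<close>.\<close>

lemma q_star:
  assumes "x \<in> carrier A"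
  shows "q (star A x) = q x"
proof -
  have "q x \<le> q (star A x)" if "x \<in> carrier A" for x
  proof (cases "q x = 0")
    case False
    have "q x * q x = q (star A x \<otimes> x)"
      unfolding q_cstar[OF that] by (rule power2_eq_square[symmetric])
    also have "\<dots> \<le> q (star A x) * q x"
      using that by (intro q_mult star_closed)
    finally show ?thesis
      using False q_nonneg[OF that] by (intro mult_right_le_imp_le[of "q x" "q x"]) auto
  next
    case True
    thus ?thesis using q_nonneg[OF star_closed[OF that]] by simp
  qed
  from this[OF assms] this[OF star_closed[OF assms]] assms show ?thesis by simp
qed

lemma q_star_minus: "x \<in> carrier A \<Longrightarrow> y \<in> carrier A \<Longrightarrow> q (star A x \<ominus> star A y) = q (x \<ominus> y)"
  by (simp add: q_star flip: star_minus)

lemma q_smult_minus: "x \<in> carrier A \<Longrightarrow> y \<in> carrier A \<Longrightarrow> q (c \<odot> x \<ominus> c \<odot> y) = cmod c * q (x \<ominus> y)"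
  by (simp add: q_smult flip: smult_minus)

lemma q_add_minus_add:
  assumes "x \<in> carrier A" "y \<in> carrier A" "x' \<in> carrier A" "y' \<in> carrier A"
  shows "q ((x \<oplus> y) \<ominus> (x' \<oplus> y')) \<le> q (x \<ominus> x') + q (y \<ominus> y')"
proof -
  have "(x \<oplus> y) \<ominus> (x' \<oplus> y') = (x \<ominus> x') \<oplus> (y \<ominus> y')" using assms by algebra
  thus ?thesis using assms q_add[of "x \<ominus> x'" "y \<ominus> y'"] by simp
qed

lemma q_mult_minus_mult:
  assumes "x \<in> carrier A" "y \<in> carrier A" "x' \<in> carrier A" "y' \<in> carrier A"
  shows "q (x \<otimes> y \<ominus> x' \<otimes> y') \<le> q (x \<ominus> x') * q y + q x' * q (y \<ominus> y')"
proof -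
  have "x \<otimes> y \<ominus> x' \<otimes> y' = ((x \<ominus> x') \<otimes> y) \<oplus> (x' \<otimes> (y \<ominus> y'))" using assms by algebra
  thus ?thesis using assms q_add[of "(x \<ominus> x') \<otimes> y" "x' \<otimes> (y \<ominus> y')"]
      q_mult[of "x \<ominus> x'" y] q_mult[of x' "y \<ominus> y'"] by simp
qed

abbreviation "C \<equiv> cauchy_seqs A q"
abbreviation "cls s \<equiv> null_rel A q `` {s}"
abbreviation "Cp \<equiv> cstar_completion A q"

lemma cauchy_carrier: "s \<in> C \<Longrightarrow> s k \<in> carrier A"
  by (simp add: cauchy_seqs_def)

lemma cauchyD: "s \<in> C \<Longrightarrow> e > 0 \<Longrightarrow> \<exists>N. \<forall>m\<ge>N. \<forall>n\<ge>N. q (s m \<ominus> s n) < e"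
  by (simp add: cauchy_seqs_def)

lemma cauchy_bounded:
  assumes "s \<in> C"
  obtains K where "K > 0" "\<And>k. q (s k) \<le> K"
proof -
  have [simp]: "s k \<in> carrier A" for k using assms by (rule cauchy_carrier)
  obtain N where N: "\<And>m n. m \<ge> N \<Longrightarrow> n \<ge> N \<Longrightarrow> q (s m \<ominus> s n) < 1"
    using cauchyD[OF assms, of 1] by auto
  \<comment> \<open>The maximum bounds the terms up to \<open>N\<close>; the added 1 covers the
    tail, whose terms differ from \<open>s N\<close> by less than 1.\<close>
  define K where "K = Max ((\<lambda>k. q (s k)) ` {..N}) + 1"
  have le: "q (s k) \<le> K - 1" if "k \<le> N" for k
    using that by (auto simp: K_def intro!: Max_ge)
  have "q (s k) \<le> K" for k
  proof (cases "k \<le> N")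
    case False
    thus ?thesis using N[of k N] q_diff[of "s k" "s N"] le[of N] by simp
  qed (use le[of k] in simp)
  moreover have "K > 0" using le[of 0] q_nonneg[of "s 0"] by simp
  ultimately show ?thesis using that by blast
qed

lemma const_cauchy: "x \<in> carrier A \<Longrightarrow> (\<lambda>_. x) \<in> C"
  by (simp add: cauchy_seqs_def)

lemma cauchy_lipschitz:
  assumes s: "s \<in> C" and t: "\<And>k. t k \<in> carrier A"
    and le: "\<And>m n. q (t m \<ominus> t n) \<le> K * q (s m \<ominus> s n)"
  shows "t \<in> C"
  unfolding cauchy_seqs_def
proof (intro CollectI conjI allI impI t)
  fix e :: real assume "e > 0"
  \<comment> \<open>The denominator \<open>\<bar>K\<bar> + 1\<close> is positive for every real
    \<open>K\<close>, including zero.\<close>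
  then obtain N where N: "\<And>m n. m \<ge> N \<Longrightarrow> n \<ge> N \<Longrightarrow> q (s m \<ominus> s n) < e / (\<bar>K\<bar> + 1)"
    using cauchyD[OF s, of "e / (\<bar>K\<bar> + 1)"] by auto
  have "q (t m \<ominus> t n) < e" if "m \<ge> N" "n \<ge> N" for m n
  proof -
    have "q (t m \<ominus> t n) \<le> (\<bar>K\<bar> + 1) * q (s m \<ominus> s n)"
      using le[of m n] q_nonneg[of "s m \<ominus> s n"] cauchy_carrier[OF s]
      by (smt (verit) minus_closed mult_right_mono)
    also have "\<dots> < (\<bar>K\<bar> + 1) * (e / (\<bar>K\<bar> + 1))"
      using N[OF that] by (intro mult_strict_left_mono) auto
    finally show ?thesis by simp
  qed
  thus "\<exists>N. \<forall>m\<ge>N. \<forall>n\<ge>N. q (t m \<ominus> t n) < e" by blast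
qed

text \<open>The bound has the shape of the product estimate \<open>q_mult_minus_mult\<close>, where
  \<open>K\<close> and \<open>L\<close> bound the two factors; sums are the case
  \<open>K = L = 1\<close>.\<close>

lemma cauchy_combine:
  assumes s: "s \<in> C" and t: "t \<in> C" and u: "\<And>k. u k \<in> carrier A" and "K > 0" "L > 0"
    and le: "\<And>m n. q (u m \<ominus> u n) \<le> q (s m \<ominus> s n) * K + L * q (t m \<ominus> t n)"
  shows "u \<in> C"
  unfolding cauchy_seqs_def
proof (intro CollectI conjI allI impI u)
  fix e :: real assume e: "e > 0"
  obtain N1 where N1: "\<And>m n. m \<ge> N1 \<Longrightarrow> n \<ge> N1 \<Longrightarrow> q (s m \<ominus> s n) < e / (2 * K)"
    using cauchyD[OF s, of "e / (2 * K)"] e \<open>K > 0\<close> by auto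
  obtain N2 where N2: "\<And>m n. m \<ge> N2 \<Longrightarrow> n \<ge> N2 \<Longrightarrow> q (t m \<ominus> t n) < e / (2 * L)"
    using cauchyD[OF t, of "e / (2 * L)"] e \<open>L > 0\<close> by auto
  have "q (u m \<ominus> u n) < e" if "m \<ge> max N1 N2" "n \<ge> max N1 N2" for m n
  proof -
    have "q (s m \<ominus> s n) * K < e / (2 * K) * K" "L * q (t m \<ominus> t n) < L * (e / (2 * L))"
      using N1[of m n] N2[of m n] that assms(4,5)
      by (auto intro: mult_strict_right_mono mult_strict_left_mono simp del: times_divide_eq_left times_divide_eq_right)
    thus ?thesis using le[of m n] assms(4,5) by simp
  qed
  thus "\<exists>N. \<forall>m\<ge>N. \<forall>n\<ge>N. q (u m \<ominus> u n) < e" by blast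
qed

lemma smult_cauchy: "s \<in> C \<Longrightarrow> (\<lambda>k. c \<odot> s k) \<in> C"
  by (rule cauchy_lipschitz[of s _ "cmod c"]) (simp_all add: cauchy_carrier q_smult_minus)

lemma star_cauchy: "s \<in> C \<Longrightarrow> (\<lambda>k. star A (s k)) \<in> C"
  by (rule cauchy_lipschitz[of s _ 1]) (simp_all add: cauchy_carrier q_star_minus)

lemma add_cauchy: "s \<in> C \<Longrightarrow> t \<in> C \<Longrightarrow> (\<lambda>k. s k \<oplus> t k) \<in> C"
  by (rule cauchy_combine[of s t _ 1 1]) (simp_all add: cauchy_carrier q_add_minus_add)

lemma mult_cauchy:
  assumes s: "s \<in> C" and t: "t \<in> C"
  shows "(\<lambda>k. s k \<otimes> t k) \<in> C"
proof -
  have [simp]: "s k \<in> carrier A" "t k \<in> carrier A" for k using assms cauchy_carrier by auto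
  obtain K where K: "K > 0" "\<And>k. q (t k) \<le> K" using cauchy_bounded[OF t] by blast
  obtain L where L: "L > 0" "\<And>k. q (s k) \<le> L" using cauchy_bounded[OF s] by blast
  show ?thesis
  proof (rule cauchy_combine[OF s t _ K(1) L(1)])
    fix m n
    have "q (s m \<ominus> s n) * q (t m) \<le> q (s m \<ominus> s n) * K"
      by (rule mult_left_mono[OF K(2)]) (simp add: q_nonneg)
    moreover have "q (s n) * q (t m \<ominus> t n) \<le> L * q (t m \<ominus> t n)"
      by (rule mult_right_mono[OF L(2)]) (simp add: q_nonneg)
    ultimately show "q (s m \<otimes> t m \<ominus> s n \<otimes> t n) \<le> q (s m \<ominus> s n) * K + L * q (t m \<ominus> t n)"
      using q_mult_minus_mult[of "s m" "t m" "s n" "t n"] by simp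
  qed simp
qed

lemma equiv_null_rel: "equiv C (null_rel A q)"
proof (rule equivI)
  show "null_rel A q \<subseteq> C \<times> C" by (auto simp: null_rel_def)
  show "refl_on C (null_rel A q)"
    by (rule refl_onI) (auto simp: null_rel_def cauchy_carrier)
  show "sym (null_rel A q)"
  proof (rule symI)
    fix s t assume st: "(s, t) \<in> null_rel A q"
    hence "q (t k \<ominus> s k) = q (s k \<ominus> t k)" for k
      by (intro q_minus_commute) (auto simp: null_rel_def cauchy_carrier)
    thus "(t, s) \<in> null_rel A q" using st by (simp add: null_rel_def)
  qed
  show "trans (null_rel A q)"
  proof (rule transI)
    fix s t u assume st: "(s, t) \<in> null_rel A q" "(t, u) \<in> null_rel A q"
    hence [simp]: "s k \<in> carrier A" "t k \<in> carrier A" "u k \<in> carrier A" for k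
      by (auto simp: null_rel_def cauchy_carrier)
    have "(\<lambda>k. q (s k \<ominus> t k) + q (t k \<ominus> u k)) \<longlonglongrightarrow> 0"
      using st by (intro tendsto_add_zero) (auto simp: null_rel_def)
    hence "(\<lambda>k. q (s k \<ominus> u k)) \<longlonglongrightarrow> 0"
      by (rule Lim_null_comparison[rotated])
        (auto simp: q_nonneg q_triangle)
    thus "(s, u) \<in> null_rel A q" using st by (simp add: null_rel_def)
  qed
qed

lemma cls_eq_iff:
  "s \<in> C \<Longrightarrow> t \<in> C \<Longrightarrow> cls s = cls t \<longleftrightarrow> (\<lambda>k. q (s k \<ominus> t k)) \<longlonglongrightarrow> 0"
  by (subst eq_equiv_class_iff[OF equiv_null_rel]) (auto simp: null_rel_def)

lemma cls_self: "s \<in> C \<Longrightarrow> s \<in> cls s"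
  using equiv_null_rel by (rule equiv_class_self)

lemma cls_closed: "s \<in> C \<Longrightarrow> cls s \<in> carrier Cp"
  by (simp add: cstar_completion_def quotientI)

lemma carrier_cls:
  assumes "X \<in> carrier Cp"
  obtains s where "s \<in> C" "X = cls s"
  using assms by (auto simp: cstar_completion_def elim: quotientE)

text \<open>The operations of the completion are unions over all representatives. Once the termwise
  operation respects \<open>null_rel\<close>, all members of the union coincide and it collapses to
  the class of any one representative. Star, sum and product below follow the same pattern.\<close>

lemma completion_smult:
  assumes "s \<in> C"
  shows "c \<odot>\<^bsub>Cp\<^esub> cls s = cls (\<lambda>k. c \<odot> s k)"
proof -
  have "congruent (null_rel A q) (\<lambda>s. cls (\<lambda>k. c \<odot> s k))"
  proof (rule congruentI)
    fix s t assume st: "(s, t) \<in> null_rel A q"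
    hence "(\<lambda>k. cmod c * q (s k \<ominus> t k)) \<longlonglongrightarrow> 0"
      by (intro tendsto_mult_right_zero) (auto simp: null_rel_def)
    moreover have "s \<in> C" "t \<in> C" using st by (auto simp: null_rel_def)
    ultimately show "cls (\<lambda>k. c \<odot> s k) = cls (\<lambda>k. c \<odot> t k)"
      by (simp add: cls_eq_iff smult_cauchy cauchy_carrier q_smult_minus)
  qed
  thus ?thesis using UN_equiv_class[OF equiv_null_rel _ assms]
    by (simp add: cstar_completion_def)
qed

lemma completion_star:
  assumes "s \<in> C"
  shows "star Cp (cls s) = cls (\<lambda>k. star A (s k))"
proof -
  have "congruent (null_rel A q) (\<lambda>s. cls (\<lambda>k. star A (s k)))"
  proof (rule congruentI)
    fix s t assume st: "(s, t) \<in> null_rel A q"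
    hence "s \<in> C" "t \<in> C" by (auto simp: null_rel_def)
    thus "cls (\<lambda>k. star A (s k)) = cls (\<lambda>k. star A (t k))"
      using st by (simp add: cls_eq_iff star_cauchy cauchy_carrier q_star_minus) (simp add: null_rel_def)
  qed
  thus ?thesis using UN_equiv_class[OF equiv_null_rel _ assms]
    by (simp add: cstar_completion_def)
qed

lemma completion_add:
  assumes "s \<in> C" "t \<in> C"
  shows "cls s \<oplus>\<^bsub>Cp\<^esub> cls t = cls (\<lambda>k. s k \<oplus> t k)"
proof -
  have "congruent2 (null_rel A q) (null_rel A q) (\<lambda>s t. cls (\<lambda>k. s k \<oplus> t k))"
  proof (rule congruent2I')
    fix s s' t t' assume st: "(s, s') \<in> null_rel A q" "(t, t') \<in> null_rel A q"
    hence C: "s \<in> C" "s' \<in> C" "t \<in> C" "t' \<in> C" by (auto simp: null_rel_def)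
    have "(\<lambda>k. q (s k \<ominus> s' k) + q (t k \<ominus> t' k)) \<longlonglongrightarrow> 0"
      using st by (intro tendsto_add_zero) (auto simp: null_rel_def)
    hence "(\<lambda>k. q ((s k \<oplus> t k) \<ominus> (s' k \<oplus> t' k))) \<longlonglongrightarrow> 0"
      by (rule Lim_null_comparison[rotated])
        (auto simp: q_nonneg q_add_minus_add cauchy_carrier C)
    thus "cls (\<lambda>k. s k \<oplus> t k) = cls (\<lambda>k. s' k \<oplus> t' k)"
      using C by (simp add: cls_eq_iff add_cauchy)
  qed
  thus ?thesis using UN_equiv_class2[OF equiv_null_rel equiv_null_rel _ assms]
    by (simp add: cstar_completion_def)
qed

lemma completion_mult:
  assumes "s \<in> C" "t \<in> C"
  shows "cls s \<otimes>\<^bsub>Cp\<^esub> cls t = cls (\<lambda>k. s k \<otimes> t k)"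
proof -
  have "congruent2 (null_rel A q) (null_rel A q) (\<lambda>s t. cls (\<lambda>k. s k \<otimes> t k))"
  proof (rule congruent2I')
    fix s s' t t' assume st: "(s, s') \<in> null_rel A q" "(t, t') \<in> null_rel A q"
    hence C: "s \<in> C" "s' \<in> C" "t \<in> C" "t' \<in> C" by (auto simp: null_rel_def)
    have [simp]: "s k \<in> carrier A" "t k \<in> carrier A" "s' k \<in> carrier A" "t' k \<in> carrier A" for k
      using C cauchy_carrier by auto
    obtain K where K: "K > 0" "\<And>k. q (t k) \<le> K" using cauchy_bounded[OF C(3)] by blast
    obtain L where L: "L > 0" "\<And>k. q (s' k) \<le> L" using cauchy_bounded[OF C(2)] by blast
    have le: "q (s k \<otimes> t k \<ominus> s' k \<otimes> t' k) \<le> q (s k \<ominus> s' k) * K + L * q (t k \<ominus> t' k)" for k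
    proof -
      have "q (s k \<ominus> s' k) * q (t k) \<le> q (s k \<ominus> s' k) * K"
        by (rule mult_left_mono[OF K(2)]) (simp add: q_nonneg)
      moreover have "q (s' k) * q (t k \<ominus> t' k) \<le> L * q (t k \<ominus> t' k)"
        by (rule mult_right_mono[OF L(2)]) (simp add: q_nonneg)
      ultimately show ?thesis using q_mult_minus_mult[of "s k" "t k" "s' k" "t' k"] by simp
    qed
    have "(\<lambda>k. q (s k \<ominus> s' k) * K + L * q (t k \<ominus> t' k)) \<longlonglongrightarrow> 0"
      using st by (intro tendsto_add_zero tendsto_mult_left_zero tendsto_mult_right_zero) (auto simp: null_rel_def)
    hence "(\<lambda>k. q (s k \<otimes> t k \<ominus> s' k \<otimes> t' k)) \<longlonglongrightarrow> 0"
      by (rule Lim_null_comparison[rotated])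
        (auto simp: q_nonneg le)
    thus "cls (\<lambda>k. s k \<otimes> t k) = cls (\<lambda>k. s' k \<otimes> t' k)"
      using C by (simp add: cls_eq_iff mult_cauchy)
  qed
  thus ?thesis using UN_equiv_class2[OF equiv_null_rel equiv_null_rel _ assms]
    by (simp add: cstar_completion_def)
qed

lemma completion_zero: "\<zero>\<^bsub>Cp\<^esub> = cls (\<lambda>_. \<zero>)"
  and completion_one: "\<one>\<^bsub>Cp\<^esub> = cls (\<lambda>_. \<one>)"
  by (simp_all add: cstar_completion_def)

lemmas completion_simps = completion_zero completion_one completion_add completion_mult
  completion_smult completion_star

lemmas cauchy_intros = const_cauchy add_cauchy mult_cauchy smult_cauchy star_cauchy

lemma completion_smult_closed: "X \<in> carrier Cp \<Longrightarrow> c \<odot>\<^bsub>Cp\<^esub> X \<in> carrier Cp"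
  by (auto elim!: carrier_cls simp: completion_smult intro!: cls_closed smult_cauchy)

lemma completion_star_closed: "X \<in> carrier Cp \<Longrightarrow> star Cp X \<in> carrier Cp"
  by (auto elim!: carrier_cls simp: completion_star intro!: cls_closed star_cauchy)

lemma completion_ring: "ring Cp"
proof -
  note [simp] = completion_simps cauchy_intros cls_closed cauchy_carrier
  have "abelian_group Cp"
  proof (rule abelian_groupI)
    fix X assume "X \<in> carrier Cp"
    then obtain s where s: "s \<in> C" "X = cls s" by (rule carrier_cls)
    have "cls (\<lambda>k. (-1) \<odot> s k) \<oplus>\<^bsub>Cp\<^esub> X = \<zero>\<^bsub>Cp\<^esub>"
    proof -
      have "(-1) \<odot> s k \<oplus> s k = \<zero>" for k using s by (simp add: uminus_smult l_neg)
      thus ?thesis using completion_add[OF smult_cauchy[OF s(1), of "-1"] s(1)] s(2)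
        by (simp only: completion_zero)
    qed
    moreover have "cls (\<lambda>k. (-1) \<odot> s k) \<in> carrier Cp" using s by simp
    ultimately show "\<exists>Y\<in>carrier Cp. Y \<oplus>\<^bsub>Cp\<^esub> X = \<zero>\<^bsub>Cp\<^esub>" by blast
  next
    fix X Y assume "X \<in> carrier Cp" "Y \<in> carrier Cp"
    then obtain s t where "s \<in> C" "X = cls s" "t \<in> C" "Y = cls t" by (elim carrier_cls) blast
    thus "X \<oplus>\<^bsub>Cp\<^esub> Y \<in> carrier Cp" "X \<oplus>\<^bsub>Cp\<^esub> Y = Y \<oplus>\<^bsub>Cp\<^esub> X" by (simp_all add: a_comm)
  next
    fix X Y Z assume "X \<in> carrier Cp" "Y \<in> carrier Cp" "Z \<in> carrier Cp"
    then obtain s t u where "s \<in> C" "X = cls s" "t \<in> C" "Y = cls t" "u \<in> C" "Z = cls u"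
      by (elim carrier_cls) blast
    thus "X \<oplus>\<^bsub>Cp\<^esub> Y \<oplus>\<^bsub>Cp\<^esub> Z = X \<oplus>\<^bsub>Cp\<^esub> (Y \<oplus>\<^bsub>Cp\<^esub> Z)" by (simp add: a_assoc)
  next
    fix X assume "X \<in> carrier Cp"
    thus "\<zero>\<^bsub>Cp\<^esub> \<oplus>\<^bsub>Cp\<^esub> X = X" by (auto elim!: carrier_cls)
  qed simp
  moreover have "Group.monoid Cp"
  proof (rule monoidI)
    fix X Y assume "X \<in> carrier Cp" "Y \<in> carrier Cp"
    then obtain s t where "s \<in> C" "X = cls s" "t \<in> C" "Y = cls t" by (elim carrier_cls) blast
    thus "X \<otimes>\<^bsub>Cp\<^esub> Y \<in> carrier Cp" by simp
  next
    fix X Y Z assume "X \<in> carrier Cp" "Y \<in> carrier Cp" "Z \<in> carrier Cp"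
    then obtain s t u where "s \<in> C" "X = cls s" "t \<in> C" "Y = cls t" "u \<in> C" "Z = cls u"
      by (elim carrier_cls) blast
    thus "X \<otimes>\<^bsub>Cp\<^esub> Y \<otimes>\<^bsub>Cp\<^esub> Z = X \<otimes>\<^bsub>Cp\<^esub> (Y \<otimes>\<^bsub>Cp\<^esub> Z)" by (simp add: m_assoc)
  next
    fix X assume "X \<in> carrier Cp"
    thus "\<one>\<^bsub>Cp\<^esub> \<otimes>\<^bsub>Cp\<^esub> X = X" "X \<otimes>\<^bsub>Cp\<^esub> \<one>\<^bsub>Cp\<^esub> = X" by (auto elim!: carrier_cls)
  qed simp
  moreover have "(X \<oplus>\<^bsub>Cp\<^esub> Y) \<otimes>\<^bsub>Cp\<^esub> Z = X \<otimes>\<^bsub>Cp\<^esub> Z \<oplus>\<^bsub>Cp\<^esub> Y \<otimes>\<^bsub>Cp\<^esub> Z"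
    "Z \<otimes>\<^bsub>Cp\<^esub> (X \<oplus>\<^bsub>Cp\<^esub> Y) = Z \<otimes>\<^bsub>Cp\<^esub> X \<oplus>\<^bsub>Cp\<^esub> Z \<otimes>\<^bsub>Cp\<^esub> Y"
    if XYZ: "X \<in> carrier Cp" "Y \<in> carrier Cp" "Z \<in> carrier Cp" for X Y Z
  proof -
    obtain s t u where "s \<in> C" "X = cls s" "t \<in> C" "Y = cls t" "u \<in> C" "Z = cls u"
      using XYZ by (elim carrier_cls) blast
    thus "(X \<oplus>\<^bsub>Cp\<^esub> Y) \<otimes>\<^bsub>Cp\<^esub> Z = X \<otimes>\<^bsub>Cp\<^esub> Z \<oplus>\<^bsub>Cp\<^esub> Y \<otimes>\<^bsub>Cp\<^esub> Z"
      "Z \<otimes>\<^bsub>Cp\<^esub> (X \<oplus>\<^bsub>Cp\<^esub> Y) = Z \<otimes>\<^bsub>Cp\<^esub> X \<oplus>\<^bsub>Cp\<^esub> Z \<otimes>\<^bsub>Cp\<^esub> Y"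
      by (simp_all add: l_distr r_distr)
  qed
  ultimately show ?thesis by (intro ringI)
qed

sublocale Cp: ring Cp by (rule completion_ring)

lemma completion_uminus:
  assumes "s \<in> C"
  shows "\<ominus>\<^bsub>Cp\<^esub> cls s = cls (\<lambda>k. \<ominus> s k)"
proof (rule Cp.minus_equality)
  have *: "(\<lambda>k. \<ominus> s k) \<in> C"
    using smult_cauchy[OF assms, of "-1"] assms by (simp add: uminus_smult cauchy_carrier)
  show "cls (\<lambda>k. \<ominus> s k) \<oplus>\<^bsub>Cp\<^esub> cls s = \<zero>\<^bsub>Cp\<^esub>"
    using assms * by (simp add: completion_simps cauchy_carrier l_neg)
  show "cls s \<in> carrier Cp" "cls (\<lambda>k. \<ominus> s k) \<in> carrier Cp" using assms * by (simp_all add: cls_closed)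
qed

lemma completion_minus:
  assumes "s \<in> C" "t \<in> C"
  shows "cls s \<ominus>\<^bsub>Cp\<^esub> cls t = cls (\<lambda>k. s k \<ominus> t k)" "(\<lambda>k. s k \<ominus> t k) \<in> C"
proof -
  have *: "(\<lambda>k. \<ominus> t k) \<in> C"
    using smult_cauchy[OF assms(2), of "-1"] assms by (simp add: uminus_smult cauchy_carrier)
  show "cls s \<ominus>\<^bsub>Cp\<^esub> cls t = cls (\<lambda>k. s k \<ominus> t k)" "(\<lambda>k. s k \<ominus> t k) \<in> C"
    using assms * by (simp_all add: minus_eq Cp.minus_eq completion_uminus completion_add add_cauchy)
qed

text \<open>By \<open>q_diff\<close> the numbers \<open>q (s k)\<close> form a Cauchy sequence whose
  limit is the same for equivalent sequences, so the definite description in \<open>cnorm\<close> is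
  justified.\<close>

lemma completion_cnorm:
  assumes s: "s \<in> C"
  shows "(\<lambda>k. q (s k)) \<longlonglongrightarrow> cnorm Cp (cls s)"
proof -
  have "Cauchy (\<lambda>k. q (s k))"
  proof (rule CauchyI)
    fix e :: real assume "e > 0"
    then obtain N where "\<And>m n. m \<ge> N \<Longrightarrow> n \<ge> N \<Longrightarrow> q (s m \<ominus> s n) < e" using cauchyD[OF s] by blast
    hence "norm (q (s m) - q (s n)) < e" if "m \<ge> N" "n \<ge> N" for m n
      using q_diff[of "s m" "s n"] that cauchy_carrier[OF s] by (metis order_le_less_trans real_norm_def)
    thus "\<exists>N. \<forall>m\<ge>N. \<forall>n\<ge>N. norm (q (s m) - q (s n)) < e" by blast
  qed
  then obtain l where l: "(\<lambda>k. q (s k)) \<longlonglongrightarrow> l"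
    using Cauchy_convergent_iff convergent_def by metis
  have lt: "(\<lambda>k. q (t k)) \<longlonglongrightarrow> l" if "t \<in> cls s" for t
  proof -
    have t: "t \<in> C" "(\<lambda>k. q (s k \<ominus> t k)) \<longlonglongrightarrow> 0" using that by (auto simp: null_rel_def)
    have "\<bar>q (s k) - q (t k)\<bar> \<le> q (s k \<ominus> t k)" for k
      using cauchy_carrier s t by (intro q_diff) auto
    hence "(\<lambda>k. q (s k) - q (t k)) \<longlonglongrightarrow> 0"
      by (intro Lim_null_comparison[OF _ t(2)]) auto
    thus ?thesis using l tendsto_diff[of "\<lambda>k. q (s k)" l sequentially "\<lambda>k. q (s k) - q (t k)" 0] by simp
  qed
  have "(THE l. \<forall>t\<in>cls s. (\<lambda>k. q (t k)) \<longlonglongrightarrow> l) = l"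
    using lt cls_self[OF s] by (intro the_equality) (auto intro: LIMSEQ_unique[OF _ l])
  thus ?thesis using l by (simp add: cstar_completion_def)
qed

end

section \<open>Continuous extension of characters to the completion\<close>

locale bounded_character = seminormed_star_alg +
  fixes \<theta> :: "'a \<Rightarrow> complex"
  assumes char_one: "\<theta> \<one> = 1"
    and char_add: "x \<in> carrier A \<Longrightarrow> y \<in> carrier A \<Longrightarrow> \<theta> (x \<oplus> y) = \<theta> x + \<theta> y"
    and char_mult: "x \<in> carrier A \<Longrightarrow> y \<in> carrier A \<Longrightarrow> \<theta> (x \<otimes> y) = \<theta> x * \<theta> y"
    and char_smult: "x \<in> carrier A \<Longrightarrow> \<theta> (c \<odot> x) = c * \<theta> x"
    and char_star: "x \<in> carrier A \<Longrightarrow> \<theta> (star A x) = cnj (\<theta> x)"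
    and char_bound: "x \<in> carrier A \<Longrightarrow> cmod (\<theta> x) \<le> q x"
begin

lemma char_zero: "\<theta> \<zero> = 0"
  using char_smult[of \<zero> 0] by simp

lemma char_minus: "x \<in> carrier A \<Longrightarrow> y \<in> carrier A \<Longrightarrow> \<theta> (x \<ominus> y) = \<theta> x - \<theta> y"
  by (simp add: minus_eq char_add char_smult flip: uminus_smult)

lemma char_diff_bound: "x \<in> carrier A \<Longrightarrow> y \<in> carrier A \<Longrightarrow> cmod (\<theta> x - \<theta> y) \<le> q (x \<ominus> y)"
  using char_bound[of "x \<ominus> y"] by (simp add: char_minus)

definition ext :: "(nat \<Rightarrow> 'a) set \<Rightarrow> complex" where
  "ext X = (THE l. \<forall>s\<in>X. (\<lambda>k. \<theta> (s k)) \<longlonglongrightarrow> l)"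

lemma ext_lim:
  assumes s: "s \<in> C"
  shows "(\<lambda>k. \<theta> (s k)) \<longlonglongrightarrow> ext (cls s)"
proof -
  have "Cauchy (\<lambda>k. \<theta> (s k))"
  proof (rule CauchyI)
    fix e :: real assume "e > 0"
    then obtain N where "\<And>m n. m \<ge> N \<Longrightarrow> n \<ge> N \<Longrightarrow> q (s m \<ominus> s n) < e" using cauchyD[OF s] by blast
    hence "norm (\<theta> (s m) - \<theta> (s n)) < e" if "m \<ge> N" "n \<ge> N" for m n
      using char_diff_bound[of "s m" "s n"] that cauchy_carrier[OF s] by (metis order_le_less_trans)
    thus "\<exists>N. \<forall>m\<ge>N. \<forall>n\<ge>N. norm (\<theta> (s m) - \<theta> (s n)) < e" by blast
  qed
  then obtain l where l: "(\<lambda>k. \<theta> (s k)) \<longlonglongrightarrow> l"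
    using Cauchy_convergent_iff convergent_def by metis
  have lt: "(\<lambda>k. \<theta> (t k)) \<longlonglongrightarrow> l" if "t \<in> cls s" for t
  proof -
    have t: "t \<in> C" "(\<lambda>k. q (s k \<ominus> t k)) \<longlonglongrightarrow> 0" using that by (auto simp: null_rel_def)
    have "cmod (\<theta> (s k) - \<theta> (t k)) \<le> q (s k \<ominus> t k)" for k
      using cauchy_carrier s t by (intro char_diff_bound) auto
    hence "(\<lambda>k. \<theta> (s k) - \<theta> (t k)) \<longlonglongrightarrow> 0"
      by (intro Lim_null_comparison[OF _ t(2)]) auto
    thus ?thesis using l tendsto_diff[of "\<lambda>k. \<theta> (s k)" l sequentially "\<lambda>k. \<theta> (s k) - \<theta> (t k)" 0] by simp
  qed
  have "ext (cls s) = l"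
    unfolding ext_def using lt cls_self[OF s] by (intro the_equality) (auto intro: LIMSEQ_unique[OF _ l])
  thus ?thesis using l by simp
qed

lemma ext_eqI: "s \<in> C \<Longrightarrow> (\<lambda>k. \<theta> (s k)) \<longlonglongrightarrow> l \<Longrightarrow> ext (cls s) = l"
  using ext_lim LIMSEQ_unique by blast

lemma ext_const: "x \<in> carrier A \<Longrightarrow> ext (cls (\<lambda>_. x)) = \<theta> x"
  by (rule ext_eqI) (simp_all add: const_cauchy)

lemma ext_one: "ext \<one>\<^bsub>Cp\<^esub> = 1" and ext_zero: "ext \<zero>\<^bsub>Cp\<^esub> = 0"
  by (simp_all add: completion_simps ext_const char_one char_zero)

lemma ext_smult: "X \<in> carrier Cp \<Longrightarrow> ext (c \<odot>\<^bsub>Cp\<^esub> X) = c * ext X"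
  by (auto elim!: carrier_cls simp: completion_simps cauchy_carrier char_smult cauchy_intros
      intro!: ext_eqI tendsto_mult ext_lim)

lemma ext_star: "X \<in> carrier Cp \<Longrightarrow> ext (star Cp X) = cnj (ext X)"
  by (auto elim!: carrier_cls simp: completion_simps cauchy_carrier char_star cauchy_intros
      intro!: ext_eqI tendsto_cnj ext_lim)

lemma ext_add: "X \<in> carrier Cp \<Longrightarrow> Y \<in> carrier Cp \<Longrightarrow> ext (X \<oplus>\<^bsub>Cp\<^esub> Y) = ext X + ext Y"
  by (auto elim!: carrier_cls simp: completion_simps cauchy_carrier char_add cauchy_intros
      intro!: ext_eqI tendsto_add ext_lim)

lemma ext_mult: "X \<in> carrier Cp \<Longrightarrow> Y \<in> carrier Cp \<Longrightarrow> ext (X \<otimes>\<^bsub>Cp\<^esub> Y) = ext X * ext Y"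
  by (auto elim!: carrier_cls simp: completion_simps cauchy_carrier char_mult cauchy_intros
      intro!: ext_eqI tendsto_mult ext_lim)

lemma ext_bound:
  assumes "X \<in> carrier Cp"
  shows "cmod (ext X) \<le> cnorm Cp X"
proof -
  obtain s where s: "s \<in> C" "X = cls s" using assms by (rule carrier_cls)
  have "(\<lambda>k. cmod (\<theta> (s k))) \<longlonglongrightarrow> cmod (ext X)" "(\<lambda>k. q (s k)) \<longlonglongrightarrow> cnorm Cp X"
    using s ext_lim completion_cnorm by (auto intro: tendsto_norm)
  thus ?thesis
    by (rule LIMSEQ_le) (use char_bound cauchy_carrier s in blast)
qed

lemma ext_minus: "X \<in> carrier Cp \<Longrightarrow> Y \<in> carrier Cp \<Longrightarrow> ext (X \<ominus>\<^bsub>Cp\<^esub> Y) = ext X - ext Y"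
  by (elim carrier_cls) (auto simp: completion_minus cauchy_carrier char_minus
      intro!: ext_eqI tendsto_diff ext_lim)

end

section \<open>Universal C*-algebras\<close>

lemma (in involutive_monoid) pairing_finsum:
  assumes "finite S" "f \<in> S \<rightarrow> carrier A"
  shows "pairing \<phi> (finsum A f S) = (\<Sum>i\<in>S. pairing \<phi> (f i))"
proof -
  interpret star_alg A by (rule star_alg)
  show ?thesis using assms
  proof (induction S)
    case (insert i S)
    thus ?case by (subst finsum_insert) (auto simp: pairing_plus Pi_def intro!: finsum_closed)
  qed (simp add: pairing_zero)
qed

abbreviation free_star_monoid :: "'g set \<Rightarrow> ('g \<times> bool) list monoid" where
  "free_star_monoid G \<equiv> \<lparr>carrier = lists (G \<times> UNIV), mult = (@), one = []\<rparr>"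

abbreviation adjoint_word :: "('g \<times> bool) list \<Rightarrow> ('g \<times> bool) list" where
  "adjoint_word \<equiv> \<lambda>w. rev (map (apsnd Not) w)"

lemma involutive_free_star_monoid:
  fixes G :: "'g set"
  shows "involutive_monoid (free_star_monoid G) adjoint_word"
proof -
  have "apsnd Not \<circ> apsnd Not = (id :: 'g \<times> bool \<Rightarrow> _)" by auto
  hence "rev (map (apsnd Not) (rev (map (apsnd Not) w))) = w" for w :: "('g \<times> bool) list"
    by (simp add: rev_map)
  thus ?thesis by unfold_locales (auto simp: lists_eq_set)
qed

text \<open>\<open>Sup\<close> has no useful value on an unbounded set of reals, so
  \<open>universal_seminorm\<close> is meaningful only under such a bound. A bound on the generators
  passes to their adjoints by \<open>q_star\<close>, to words by submultiplicativity, and to all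
  elements by linearity, uniformly in \<open>q\<close>.\<close>

locale universal_relations =
  fixes G :: "'g set" and R
  assumes gen_bound: "\<And>q g. cstar_seminorm (free_star_algebra G) q \<Longrightarrow> (\<And>r. r \<in> R \<Longrightarrow> q r = 0) \<Longrightarrow>
    g \<in> G \<Longrightarrow> q (free_gen g) \<le> 1"
begin

abbreviation "F \<equiv> free_star_algebra G"

sublocale involutive_monoid "free_star_monoid G" adjoint_word
  rewrites "star_monoid_algebra (free_star_monoid G) adjoint_word = F"
  by (rule involutive_free_star_monoid) (simp add: free_star_algebra_def)

sublocale F: star_alg F by (rule star_alg)

definition admissible where
  "admissible = {q. cstar_seminorm F q \<and> (\<forall>r\<in>R. q r = 0)}"

abbreviation "norm\<^sub>u \<equiv> universal_seminorm G R"

lemma norm\<^sub>u_eq: "norm\<^sub>u x = (SUP q\<in>admissible. q x)"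
  unfolding universal_seminorm_def admissible_def by (rule arg_cong[of _ _ Sup]) auto

lemma zero_admissible: "(\<lambda>_. 0) \<in> admissible"
  by (simp add: admissible_def cstar_seminorm_def)

lemma gen_closed: "g \<in> G \<Longrightarrow> free_gen g \<in> carrier F"
  unfolding free_gen_def by (intro point_closed) simp

lemma admissible_seminormed: "q \<in> admissible \<Longrightarrow> seminormed_star_alg F q"
  by unfold_locales (simp add: admissible_def)

lemma admissible_point:
  assumes q: "q \<in> admissible" and w: "w \<in> lists (G \<times> UNIV)"
  shows "q (monoid_point w) \<le> 1"
proof -
  interpret seminormed_star_alg F q using q by (rule admissible_seminormed)
  have gen: "q (free_gen g) \<le> 1" if "g \<in> G" for g
    using gen_bound[of q g] that q by (auto simp: admissible_def)
  have letter: "q (monoid_point [a]) \<le> 1" if "a \<in> G \<times> UNIV" for a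
  proof -
    obtain g b where a: "a = (g, b)" "g \<in> G" using \<open>a \<in> G \<times> UNIV\<close> by auto
    have "star F (free_gen g) = monoid_point [(g, True)]"
      unfolding free_gen_def by (subst star_point) (use a in auto)
    hence "q (monoid_point [(g, True)]) = q (free_gen g)" using q_star[OF gen_closed] a by metis
    thus ?thesis using gen[OF a(2)] a by (cases b) (simp_all add: free_gen_def)
  qed
  show ?thesis using w
  proof (induction w)
    case Nil
    \<comment> \<open>The unit is self-adjoint and idempotent, so the C*-identity leaves only the
      values 0 and 1. The value 0 does occur, for the zero seminorm.\<close>
    have "star F \<one>\<^bsub>F\<^esub> = \<one>\<^bsub>F\<^esub>" using star_point[of "[]"] by (simp add: one_eq_point)
    hence "(q \<one>\<^bsub>F\<^esub>)\<^sup>2 = q \<one>\<^bsub>F\<^esub>" using q_cstar[of "\<one>\<^bsub>F\<^esub>"] by simp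
    hence "q \<one>\<^bsub>F\<^esub> = 0 \<or> q \<one>\<^bsub>F\<^esub> = 1" by (simp add: power2_eq_square)
    thus ?case using one_eq_point by auto
  next
    case (Cons a w)
    have "monoid_point (a # w) = monoid_point [a] \<otimes>\<^bsub>F\<^esub> monoid_point w"
      using Cons.hyps by (subst point_mult) auto
    hence "q (monoid_point (a # w)) \<le> q (monoid_point [a]) * q (monoid_point w)"
      using Cons.hyps by (simp add: q_mult)
    also have "\<dots> \<le> 1 * 1"
      using Cons letter by (intro mult_mono q_nonneg) auto
    finally show ?case by simp
  qed
qed

lemma admissible_bounded:
  assumes "x \<in> carrier F"
  shows "\<exists>K. \<forall>q\<in>admissible. q x \<le> K"
  using assms
proof (induction x rule: carrier_induct)
  case zero
  have "q \<zero>\<^bsub>F\<^esub> \<le> 0" if "q \<in> admissible" for q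
    using seminormed_star_alg.q_zero[OF admissible_seminormed[OF that]] by simp
  thus ?case by blast
next
  case (add f g)
  then obtain K L where K: "\<forall>q\<in>admissible. q f \<le> K" "\<forall>q\<in>admissible. q g \<le> L" by blast
  have "q (f \<oplus>\<^bsub>F\<^esub> g) \<le> K + L" if "q \<in> admissible" for q
    using seminormed_star_alg.q_add[OF admissible_seminormed[OF that] add.hyps] K that
    by (meson add_mono order_trans)
  thus ?case by blast
next
  case (smult c f)
  then obtain K where K: "\<forall>q\<in>admissible. q f \<le> K" by blast
  have "q (c \<odot>\<^bsub>F\<^esub> f) \<le> cmod c * K" if "q \<in> admissible" for q
    using seminormed_star_alg.q_smult[OF admissible_seminormed[OF that] smult.hyps] K that
    by (simp add: mult_left_mono)
  thus ?case by blast
next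
  case (point w)
  thus ?case using admissible_point by (intro exI[of _ 1]) simp
qed

lemma norm\<^sub>u_upper: "q \<in> admissible \<Longrightarrow> x \<in> carrier F \<Longrightarrow> q x \<le> norm\<^sub>u x"
  unfolding norm\<^sub>u_eq using admissible_bounded[of x] by (intro cSUP_upper) (auto simp: bdd_above_def)

lemma norm\<^sub>u_least: "(\<And>q. q \<in> admissible \<Longrightarrow> q x \<le> K) \<Longrightarrow> norm\<^sub>u x \<le> K"
  unfolding norm\<^sub>u_eq using zero_admissible by (intro cSUP_least) auto

lemma norm\<^sub>u_nonneg: "x \<in> carrier F \<Longrightarrow> 0 \<le> norm\<^sub>u x"
  using norm\<^sub>u_upper[OF zero_admissible] by simp

lemma norm\<^sub>u_relation: "r \<in> R \<Longrightarrow> r \<in> carrier F \<Longrightarrow> norm\<^sub>u r = 0"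
  by (intro antisym norm\<^sub>u_least norm\<^sub>u_nonneg) (auto simp: admissible_def)

text \<open>The axioms pass to the pointwise supremum. For the two equations, the lower bounds come
  from solving for \<open>q x\<close>: dividing by \<open>cmod c\<close>, and taking a square root
  in the C*-identity.\<close>

lemma norm\<^sub>u_seminorm: "cstar_seminorm F norm\<^sub>u"
  unfolding cstar_seminorm_def
proof (intro conjI ballI allI)
  note sn = admissible_seminormed
  fix x assume x: "x \<in> carrier F"
  show nonneg: "0 \<le> norm\<^sub>u x" using x by (rule norm\<^sub>u_nonneg)
  show "norm\<^sub>u (c \<odot>\<^bsub>F\<^esub> x) = cmod c * norm\<^sub>u x" for c
  proof (rule antisym)
    show "norm\<^sub>u (c \<odot>\<^bsub>F\<^esub> x) \<le> cmod c * norm\<^sub>u x"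
      using x by (intro norm\<^sub>u_least)
        (simp add: seminormed_star_alg.q_smult[OF sn] mult_left_mono norm\<^sub>u_upper)
    show "cmod c * norm\<^sub>u x \<le> norm\<^sub>u (c \<odot>\<^bsub>F\<^esub> x)"
    proof (cases "c = 0")
      case True
      thus ?thesis using norm\<^sub>u_nonneg[of "c \<odot>\<^bsub>F\<^esub> x"] x by simp
    next
      case False
      have "norm\<^sub>u x \<le> norm\<^sub>u (c \<odot>\<^bsub>F\<^esub> x) / cmod c"
      proof (rule norm\<^sub>u_least)
        fix q assume q: "q \<in> admissible"
        have "cmod c * q x \<le> norm\<^sub>u (c \<odot>\<^bsub>F\<^esub> x)"
          using norm\<^sub>u_upper[OF q, of "c \<odot>\<^bsub>F\<^esub> x"] x
          by (simp add: seminormed_star_alg.q_smult[OF sn[OF q]])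
        thus "q x \<le> norm\<^sub>u (c \<odot>\<^bsub>F\<^esub> x) / cmod c" using False by (simp add: field_simps)
      qed
      thus ?thesis using False by (simp add: field_simps)
    qed
  qed
  show "norm\<^sub>u (star F x \<otimes>\<^bsub>F\<^esub> x) = (norm\<^sub>u x)\<^sup>2"
  proof (rule antisym)
    show "norm\<^sub>u (star F x \<otimes>\<^bsub>F\<^esub> x) \<le> (norm\<^sub>u x)\<^sup>2"
      using x by (intro norm\<^sub>u_least)
        (simp add: seminormed_star_alg.q_cstar[OF sn] seminormed_star_alg.q_nonneg[OF sn]
          norm\<^sub>u_upper power_mono)
    have "norm\<^sub>u x \<le> sqrt (norm\<^sub>u (star F x \<otimes>\<^bsub>F\<^esub> x))"
    proof (rule norm\<^sub>u_least)
      fix q assume q: "q \<in> admissible"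
      have "(q x)\<^sup>2 \<le> norm\<^sub>u (star F x \<otimes>\<^bsub>F\<^esub> x)"
        using norm\<^sub>u_upper[OF q, of "star F x \<otimes>\<^bsub>F\<^esub> x"] x
        by (simp add: seminormed_star_alg.q_cstar[OF sn[OF q]])
      thus "q x \<le> sqrt (norm\<^sub>u (star F x \<otimes>\<^bsub>F\<^esub> x))" by (rule real_le_rsqrt)
    qed
    thus "(norm\<^sub>u x)\<^sup>2 \<le> norm\<^sub>u (star F x \<otimes>\<^bsub>F\<^esub> x)"
      using nonneg x norm\<^sub>u_nonneg[of "star F x \<otimes>\<^bsub>F\<^esub> x"]
        power_mono[of "norm\<^sub>u x" "sqrt (norm\<^sub>u (star F x \<otimes>\<^bsub>F\<^esub> x))" 2] by simp
  qed
  fix y assume y: "y \<in> carrier F"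
  show "norm\<^sub>u (x \<oplus>\<^bsub>F\<^esub> y) \<le> norm\<^sub>u x + norm\<^sub>u y"
  proof (rule norm\<^sub>u_least)
    fix q assume q: "q \<in> admissible"
    show "q (x \<oplus>\<^bsub>F\<^esub> y) \<le> norm\<^sub>u x + norm\<^sub>u y"
      using seminormed_star_alg.q_add[OF sn[OF q] x y] norm\<^sub>u_upper[OF q x] norm\<^sub>u_upper[OF q y]
      by linarith
  qed
  show "norm\<^sub>u (x \<otimes>\<^bsub>F\<^esub> y) \<le> norm\<^sub>u x * norm\<^sub>u y"
  proof (rule norm\<^sub>u_least)
    fix q assume q: "q \<in> admissible"
    have "q (x \<otimes>\<^bsub>F\<^esub> y) \<le> q x * q y" using seminormed_star_alg.q_mult[OF sn[OF q] x y] .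
    also have "\<dots> \<le> norm\<^sub>u x * norm\<^sub>u y"
      using x y by (intro mult_mono norm\<^sub>u_upper[OF q] nonneg seminormed_star_alg.q_nonneg[OF sn[OF q]])
    finally show "q (x \<otimes>\<^bsub>F\<^esub> y) \<le> norm\<^sub>u x * norm\<^sub>u y" .
  qed
qed

sublocale U: seminormed_star_alg F norm\<^sub>u
  by unfold_locales (rule norm\<^sub>u_seminorm)

abbreviation "emb x \<equiv> U.cls (\<lambda>_. x)"

lemma universal_cstar_eq: "universal_cstar G R = U.Cp"
  by (simp add: universal_cstar_def)

lemma universal_gen_eq: "universal_gen G R g = emb (free_gen g)"
  by (simp add: universal_gen_def completion_embed_def)

end

locale magic_algebra =
  fixes V :: "'v set"
  assumes finite_V: "finite V"
begin

abbreviation "F\<^sub>V \<equiv> free_star_algebra (V \<times> V)"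
abbreviation "x\<^sub>V \<equiv> (\<lambda>i j. free_gen (i, j) :: (('v \<times> 'v) \<times> bool) list \<Rightarrow> complex)"

text \<open>As far as \<open>q\<close> can see, a generator \<open>u\<close> is self-adjoint and
  idempotent. So \<open>(q u)\<^sup>2 = q (star F u \<otimes> u) = q (u \<otimes> u) = q u\<close>,
  and \<open>q u\<close> is 0 or 1.\<close>

lemma magic_bound:
  assumes q: "cstar_seminorm F\<^sub>V q" and R: "\<And>r. r \<in> magic_relations V \<Longrightarrow> q r = 0" and g: "g \<in> V \<times> V"
  shows "q (free_gen g) \<le> 1"
proof -
  interpret I: involutive_monoid "free_star_monoid (V \<times> V)" adjoint_word
    rewrites "star_monoid_algebra (free_star_monoid (V \<times> V)) adjoint_word = F\<^sub>V"
    by (rule involutive_free_star_monoid) (simp add: free_star_algebra_def)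
  interpret star_alg F\<^sub>V by (rule I.star_alg)
  interpret seminormed_star_alg F\<^sub>V q by unfold_locales (rule q)
  obtain i j where ij: "g = (i, j)" "i \<in> V" "j \<in> V" using g by auto
  let ?u = "free_gen g :: (('v \<times> 'v) \<times> bool) list \<Rightarrow> complex"
  have u [simp]: "?u \<in> carrier F\<^sub>V" unfolding free_gen_def using g by (intro I.point_closed) simp
  have "star F\<^sub>V ?u \<ominus>\<^bsub>F\<^sub>V\<^esub> ?u \<in> magic_relations V" "(?u \<otimes>\<^bsub>F\<^sub>V\<^esub> ?u) \<ominus>\<^bsub>F\<^sub>V\<^esub> ?u \<in> magic_relations V"
    unfolding magic_relations_def Let_def ij(1) using ij(2,3) by blast+
  hence 1: "q (star F\<^sub>V ?u \<ominus>\<^bsub>F\<^sub>V\<^esub> ?u) = 0" "q ((?u \<otimes>\<^bsub>F\<^sub>V\<^esub> ?u) \<ominus>\<^bsub>F\<^sub>V\<^esub> ?u) = 0" using R by auto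
  have "(star F\<^sub>V ?u \<otimes>\<^bsub>F\<^sub>V\<^esub> ?u) \<ominus>\<^bsub>F\<^sub>V\<^esub> (?u \<otimes>\<^bsub>F\<^sub>V\<^esub> ?u) = (star F\<^sub>V ?u \<ominus>\<^bsub>F\<^sub>V\<^esub> ?u) \<otimes>\<^bsub>F\<^sub>V\<^esub> ?u"
    using u star_closed[OF u] by (intro minus_mult_distrib)
  hence "q ((star F\<^sub>V ?u \<otimes>\<^bsub>F\<^sub>V\<^esub> ?u) \<ominus>\<^bsub>F\<^sub>V\<^esub> (?u \<otimes>\<^bsub>F\<^sub>V\<^esub> ?u)) \<le> 0"
    using q_mult[of "star F\<^sub>V ?u \<ominus>\<^bsub>F\<^sub>V\<^esub> ?u" ?u] 1(1) by simp
  hence "q (star F\<^sub>V ?u \<otimes>\<^bsub>F\<^sub>V\<^esub> ?u) = q (?u \<otimes>\<^bsub>F\<^sub>V\<^esub> ?u)"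
    using q_diff[of "star F\<^sub>V ?u \<otimes>\<^bsub>F\<^sub>V\<^esub> ?u" "?u \<otimes>\<^bsub>F\<^sub>V\<^esub> ?u"] by simp
  moreover have "q (?u \<otimes>\<^bsub>F\<^sub>V\<^esub> ?u) = q ?u"
    using q_diff[of "?u \<otimes>\<^bsub>F\<^sub>V\<^esub> ?u" ?u] 1(2) by simp
  ultimately have "(q ?u)\<^sup>2 = q ?u" using q_cstar[of ?u] by simp
  hence "q ?u = 0 \<or> q ?u = 1" by (simp add: power2_eq_square)
  thus ?thesis by auto
qed

sublocale universal_relations "V \<times> V" "magic_relations V"
  by unfold_locales (rule magic_bound)

lemma x_closed [simp]: "i \<in> V \<Longrightarrow> j \<in> V \<Longrightarrow> x\<^sub>V i j \<in> carrier F\<^sub>V"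
  by (rule gen_closed) simp

lemma magic_relations_carrier: "magic_relations V \<subseteq> carrier F\<^sub>V"
  unfolding magic_relations_def Let_def
  by (auto intro!: F.minus_closed F.star_closed F.m_closed F.finsum_closed)

lemma perm_cstar_eq: "perm_cstar V = U.Cp"
  by (simp add: perm_cstar_def universal_cstar_eq)

lemma perm_gen_eq: "perm_gen V i j = emb (x\<^sub>V i j)"
  by (simp add: perm_gen_def universal_gen_eq)

end

section \<open>Matrix models of magic unitaries\<close>

definition adj :: "complex^'n^'n \<Rightarrow> complex^'n^'n" where
  "adj M = (\<chi> i j. cnj (M $ j $ i))"

abbreviation opnorm :: "complex^'n^'n \<Rightarrow> real" where
  "opnorm M \<equiv> onorm ((*v) M)"

lemma adj_adj [simp]: "adj (adj M) = M"
  by (simp add: adj_def vec_eq_iff)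

lemma adj_mult: "adj (M ** N) = adj N ** adj M"
  by (simp add: adj_def matrix_matrix_mult_def vec_eq_iff mult.commute)

lemma bounded_linear_matrix: "bounded_linear ((*v) (M :: complex^'n^'n))"
proof -
  have "linear ((*v) M)"
    by (rule linearI) (simp_all add: matrix_vector_mult_def vec_eq_iff sum.distrib algebra_simps scaleR_sum_right)
  thus ?thesis by (simp add: linear_conv_bounded_linear)
qed

text \<open>The inner product of \<open>complex^'n\<close> is real, namely the real part of the
  Hermitian one; this is the real part of the usual adjoint identity. It matches
  \<open>onorm\<close>, which treats matrices as real-linear maps.\<close>

lemma inner_adj: "(M *v \<xi>) \<bullet> \<eta> = \<xi> \<bullet> (adj M *v \<eta>)"
proof -
  have "(M *v \<xi>) \<bullet> \<eta> = (\<Sum>i\<in>UNIV. \<Sum>j\<in>UNIV. Re (M $ i $ j * \<xi> $ j * cnj (\<eta> $ i)))"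
    by (simp add: inner_vec_def matrix_vector_mult_def inner_complex_def sum_distrib_right flip: sum.distrib)
  also have "\<dots> = (\<Sum>j\<in>UNIV. \<Sum>i\<in>UNIV. Re (M $ i $ j * \<xi> $ j * cnj (\<eta> $ i)))"
    by (rule sum.swap)
  also have "\<dots> = \<xi> \<bullet> (adj M *v \<eta>)"
    by (simp add: inner_vec_def matrix_vector_mult_def inner_complex_def adj_def sum_distrib_left
        algebra_simps flip: sum.distrib)
  finally show ?thesis .
qed

lemma opnorm_nonneg: "0 \<le> opnorm M"
  by (rule onorm_pos_le[OF bounded_linear_matrix])

lemma opnorm_mult: "opnorm (M ** N) \<le> opnorm M * opnorm N"
  using onorm_compose[OF bounded_linear_matrix[of M] bounded_linear_matrix[of N]]
  by (simp add: o_def matrix_vector_mul_assoc)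

lemma opnorm_add: "opnorm (M + N) \<le> opnorm M + opnorm N"
proof -
  have "(*v) (M + N) = (\<lambda>\<xi>. M *v \<xi> + N *v \<xi>)"
    by (rule ext) (rule matrix_vector_mult_add_rdistrib)
  thus ?thesis
    using onorm_triangle[OF bounded_linear_matrix[of M] bounded_linear_matrix[of N]] by simp
qed

lemma opnorm_scale: "opnorm (\<chi> i j. c * M $ i $ j) = cmod c * opnorm M"
proof -
  have "norm ((\<chi> i j. c * M $ i $ j) *v \<xi>) = norm (cmod c *\<^sub>R (M *v \<xi>))" for \<xi>
  proof -
    have "(\<chi> i j. c * M $ i $ j) *v \<xi> = (\<chi> i. c * (M *v \<xi>) $ i)"
      by (simp add: matrix_vector_mult_def vec_eq_iff sum_distrib_left mult.assoc)
    thus ?thesis by (simp add: norm_vec_def norm_mult L2_set_right_distrib)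
  qed
  hence "opnorm (\<chi> i j. c * M $ i $ j) = onorm (\<lambda>\<xi>. cmod c *\<^sub>R (M *v \<xi>))"
    unfolding onorm_def by simp
  thus ?thesis using onorm_scaleR[OF bounded_linear_matrix, of "cmod c" M] by simp
qed

text \<open>The C*-identity for matrices. Cauchy-Schwarz applied to the inner product of \<xi> with
  its image under \<open>adj M ** M\<close> bounds \<open>(opnorm M)\<^sup>2\<close> from above.
  Together with submultiplicativity this yields \<open>opnorm (adj M) = opnorm M\<close>, and the
  reverse inequality follows.\<close>

lemma opnorm_adj_mult: "opnorm (adj M ** M) = (opnorm M)\<^sup>2"
proof -
  have le: "(opnorm M)\<^sup>2 \<le> opnorm (adj M ** M)" for M :: "complex^'n^'n"
  proof -
    have "norm (M *v \<xi>) \<le> sqrt (opnorm (adj M ** M)) * norm \<xi>" for \<xi>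
    proof -
      have "(norm (M *v \<xi>))\<^sup>2 = \<xi> \<bullet> ((adj M ** M) *v \<xi>)"
        unfolding power2_norm_eq_inner inner_adj by (simp add: matrix_vector_mul_assoc)
      also have "\<dots> \<le> norm \<xi> * norm ((adj M ** M) *v \<xi>)"
        by (rule norm_cauchy_schwarz)
      also have "\<dots> \<le> norm \<xi> * (opnorm (adj M ** M) * norm \<xi>)"
        by (intro mult_left_mono onorm[OF bounded_linear_matrix]) simp
      finally have "norm (M *v \<xi>) \<le> sqrt (opnorm (adj M ** M) * (norm \<xi>)\<^sup>2)"
        by (intro real_le_rsqrt) (simp add: power2_eq_square mult_ac)
      thus ?thesis by (simp add: real_sqrt_mult)
    qed
    hence "opnorm M \<le> sqrt (opnorm (adj M ** M))"
      by (intro onorm_le)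
    thus ?thesis
      using opnorm_nonneg[of M] opnorm_nonneg[of "adj M ** M"]
        power_mono[of "opnorm M" "sqrt (opnorm (adj M ** M))" 2] by simp
  qed
  have le': "opnorm M \<le> opnorm (adj M)" for M :: "complex^'n^'n"
  proof (cases "opnorm M = 0")
    case False
    have "opnorm M * opnorm M \<le> opnorm (adj M) * opnorm M"
      using le[of M] opnorm_mult[of "adj M" M] unfolding power2_eq_square by linarith
    thus ?thesis using False opnorm_nonneg[of M] by (intro mult_right_le_imp_le[of "opnorm M" "opnorm M"]) auto
  qed (simp add: opnorm_nonneg)
  have "opnorm (adj M) = opnorm M" using le'[of M] le'[of "adj M"] by simp
  thus ?thesis using le[of M] opnorm_mult[of "adj M" M] by (simp add: power2_eq_square)
qed

lemma opnorm_eq_0: "opnorm M = 0 \<longleftrightarrow> M = 0"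
proof -
  have "M = 0" if "\<And>\<xi>. M *v \<xi> = 0"
  proof -
    have "M $ i $ j = 0" for i j
      using arg_cong[OF that[of "axis j 1"], of "\<lambda>v. v $ i"]
      by (simp add: matrix_vector_mult_def axis_def if_distrib cong: if_cong)
    thus ?thesis by (simp add: vec_eq_iff)
  qed
  thus ?thesis by (auto simp: onorm_eq_0[OF bounded_linear_matrix])
qed

locale magic_matrix = magic_algebra V for V :: "'v set" +
  fixes U :: "'v \<Rightarrow> 'v \<Rightarrow> complex^'n^'n"
  assumes hermitian: "adj (U i j) = U i j"
    and idem: "U i j ** U i j = U i j"
    and row_orth: "j \<noteq> k \<Longrightarrow> U i j ** U i k = 0"
    and col_orth: "i \<noteq> k \<Longrightarrow> U i j ** U k j = 0"
    and row_sum: "i \<in> V \<Longrightarrow> (\<Sum>j\<in>V. U i j) = mat 1"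
    and col_sum: "j \<in> V \<Longrightarrow> (\<Sum>i\<in>V. U i j) = mat 1"
begin

text \<open>The adjoint flag \<open>b\<close> is ignored because \<open>U i j\<close> is
  self-adjoint: a generator and its adjoint are represented by the same matrix.\<close>

fun word_matrix :: "(('v \<times> 'v) \<times> bool) list \<Rightarrow> complex^'n^'n" where
  "word_matrix [] = mat 1"
| "word_matrix (((i, j), b) # w) = U i j ** word_matrix w"

definition mat_rep :: "((('v \<times> 'v) \<times> bool) list \<Rightarrow> complex) \<Rightarrow> complex^'n^'n" where
  "mat_rep x = (\<chi> i j. pairing (\<lambda>w. word_matrix w $ i $ j) x)"

lemma word_matrix_append: "word_matrix (v @ w) = word_matrix v ** word_matrix w"
  by (induction v rule: word_matrix.induct) (simp_all add: matrix_mul_assoc)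

lemma word_matrix_adjoint: "word_matrix (adjoint_word w) = adj (word_matrix w)"
proof (induction w rule: word_matrix.induct)
  case 1
  show ?case by (simp add: adj_def vec_eq_iff mat_def)
next
  case (2 i j b w)
  thus ?case by (simp add: word_matrix_append adj_mult hermitian)
qed

lemma pairing_fun_sum: "finite S \<Longrightarrow> pairing (\<lambda>w. \<Sum>k\<in>S. f k w) x = (\<Sum>k\<in>S. pairing (f k) x)"
  unfolding pairing_def by (subst sum.swap) (simp add: sum_distrib_left)

lemma mat_rep_mult:
  assumes "x \<in> carrier F" "y \<in> carrier F"
  shows "mat_rep (x \<otimes>\<^bsub>F\<^esub> y) = mat_rep x ** mat_rep y"
proof -
  have "pairing (\<lambda>v. \<Sum>k\<in>UNIV. word_matrix w $ i $ k * word_matrix v $ k $ j) y =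
      (\<Sum>k\<in>UNIV. mat_rep y $ k $ j * word_matrix w $ i $ k)" for w i j
    by (simp add: pairing_fun_sum pairing_fun_scale mat_rep_def) (simp add: mult.commute)
  thus ?thesis using assms
    by (simp add: mat_rep_def pairing_mult word_matrix_append vec_eq_iff
        matrix_matrix_mult_def pairing_fun_sum pairing_fun_scale)
      (simp add: mult.commute)
qed

lemma mat_rep_add:
  "x \<in> carrier F \<Longrightarrow> y \<in> carrier F \<Longrightarrow> mat_rep (x \<oplus>\<^bsub>F\<^esub> y) = mat_rep x + mat_rep y"
  by (simp add: mat_rep_def pairing_plus vec_eq_iff)

lemma mat_rep_minus:
  "x \<in> carrier F \<Longrightarrow> y \<in> carrier F \<Longrightarrow> mat_rep (x \<ominus>\<^bsub>F\<^esub> y) = mat_rep x - mat_rep y"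
  by (simp add: mat_rep_def pairing_minus vec_eq_iff)

lemma mat_rep_smult:
  "x \<in> carrier F \<Longrightarrow> mat_rep (c \<odot>\<^bsub>F\<^esub> x) = (\<chi> i j. c * mat_rep x $ i $ j)"
  by (simp add: mat_rep_def pairing_smult vec_eq_iff)

lemma mat_rep_star: "x \<in> carrier F \<Longrightarrow> mat_rep (star F x) = adj (mat_rep x)"
  by (simp add: mat_rep_def pairing_star vec_eq_iff word_matrix_adjoint)
    (simp add: adj_def)

lemma mat_rep_one: "mat_rep \<one>\<^bsub>F\<^esub> = mat 1"
  using pairing_one by (simp add: mat_rep_def vec_eq_iff)

lemma mat_rep_gen: "mat_rep (x\<^sub>V i j) = U i j"
  by (simp add: mat_rep_def free_gen_def)

lemma mat_rep_finsum:
  assumes "finite S" "f \<in> S \<rightarrow> carrier F"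
  shows "mat_rep (finsum F f S) = (\<Sum>k\<in>S. mat_rep (f k))"
  using assms by (simp add: mat_rep_def vec_eq_iff pairing_finsum)

lemma mat_rep_relation:
  assumes "r \<in> magic_relations V"
  shows "mat_rep r = 0"
  using assms unfolding magic_relations_def Let_def
proof (elim UnE CollectE exE conjE)
  fix i j assume "r = star F (x\<^sub>V i j) \<ominus>\<^bsub>F\<^esub> x\<^sub>V i j" "i \<in> V" "j \<in> V"
  thus ?thesis by (simp add: mat_rep_minus mat_rep_star mat_rep_gen hermitian)
next
  fix i j assume "r = (x\<^sub>V i j \<otimes>\<^bsub>F\<^esub> x\<^sub>V i j) \<ominus>\<^bsub>F\<^esub> x\<^sub>V i j" "i \<in> V" "j \<in> V"
  thus ?thesis by (simp add: mat_rep_minus mat_rep_mult mat_rep_gen idem)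
next
  fix i j k assume "r = x\<^sub>V i j \<otimes>\<^bsub>F\<^esub> x\<^sub>V i k" "i \<in> V" "j \<in> V" "k \<in> V" "j \<noteq> k"
  thus ?thesis by (simp add: mat_rep_mult mat_rep_gen row_orth)
next
  fix i j k assume "r = x\<^sub>V i j \<otimes>\<^bsub>F\<^esub> x\<^sub>V k j" "i \<in> V" "j \<in> V" "k \<in> V" "i \<noteq> k"
  thus ?thesis by (simp add: mat_rep_mult mat_rep_gen col_orth)
next
  fix i assume r: "r = (\<Oplus>\<^bsub>F\<^esub>j\<in>V. x\<^sub>V i j) \<ominus>\<^bsub>F\<^esub> \<one>\<^bsub>F\<^esub>" "i \<in> V"
  hence "mat_rep r = (\<Sum>j\<in>V. U i j) - mat 1"
    by (subst r(1), subst mat_rep_minus)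
      (auto simp: mat_rep_finsum finite_V mat_rep_gen mat_rep_one intro!: F.finsum_closed)
  thus ?thesis using row_sum r by simp
next
  fix j assume r: "r = (\<Oplus>\<^bsub>F\<^esub>i\<in>V. x\<^sub>V i j) \<ominus>\<^bsub>F\<^esub> \<one>\<^bsub>F\<^esub>" "j \<in> V"
  hence "mat_rep r = (\<Sum>i\<in>V. U i j) - mat 1"
    by (subst r(1), subst mat_rep_minus)
      (auto simp: mat_rep_finsum finite_V mat_rep_gen mat_rep_one intro!: F.finsum_closed)
  thus ?thesis using col_sum r by simp
qed

text \<open>The operator norm in a matrix model is one of the seminorms in the supremum, so the
  universal norm dominates it. Elements with different matrices therefore stay different in the
  universal algebra.\<close>

lemma mat_rep_admissible: "(\<lambda>x. opnorm (mat_rep x)) \<in> admissible"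
  unfolding admissible_def cstar_seminorm_def
  by (simp add: opnorm_nonneg mat_rep_smult opnorm_scale mat_rep_mult mat_rep_star
      opnorm_adj_mult mat_rep_add opnorm_add opnorm_mult mat_rep_relation opnorm_eq_0)

lemma emb_eq_imp_mat_rep_eq:
  assumes "x \<in> carrier F" "y \<in> carrier F" "emb x = emb y"
  shows "mat_rep x = mat_rep y"
proof -
  have "(\<lambda>_::nat. norm\<^sub>u (x \<ominus>\<^bsub>F\<^esub> y)) \<longlonglongrightarrow> 0"
    using U.cls_eq_iff[of "\<lambda>_. x" "\<lambda>_. y"] assms by (simp add: U.const_cauchy)
  hence "norm\<^sub>u (x \<ominus>\<^bsub>F\<^esub> y) = 0" by (simp add: LIMSEQ_const_iff)
  hence "opnorm (mat_rep (x \<ominus>\<^bsub>F\<^esub> y)) \<le> 0"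
    using norm\<^sub>u_upper[OF mat_rep_admissible, of "x \<ominus>\<^bsub>F\<^esub> y"] assms by simp
  hence "opnorm (mat_rep (x \<ominus>\<^bsub>F\<^esub> y)) = 0" using opnorm_nonneg by (intro antisym)
  thus ?thesis using assms by (simp add: opnorm_eq_0 mat_rep_minus)
qed

lemma perm_cstar_noncommutative:
  assumes "i \<in> V" "j \<in> V" "k \<in> V" "l \<in> V" "U i j ** U k l \<noteq> U k l ** U i j"
  shows "\<exists>x\<in>carrier (perm_cstar V). \<exists>y\<in>carrier (perm_cstar V). x \<otimes>\<^bsub>perm_cstar V\<^esub> y \<noteq> y \<otimes>\<^bsub>perm_cstar V\<^esub> x"
proof (intro bexI)
  have "mat_rep (x\<^sub>V i j \<otimes>\<^bsub>F\<^esub> x\<^sub>V k l) \<noteq> mat_rep (x\<^sub>V k l \<otimes>\<^bsub>F\<^esub> x\<^sub>V i j)"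
    using assms by (simp add: mat_rep_mult mat_rep_gen)
  hence "emb (x\<^sub>V i j \<otimes>\<^bsub>F\<^esub> x\<^sub>V k l) \<noteq> emb (x\<^sub>V k l \<otimes>\<^bsub>F\<^esub> x\<^sub>V i j)"
    using emb_eq_imp_mat_rep_eq[of "x\<^sub>V i j \<otimes>\<^bsub>F\<^esub> x\<^sub>V k l" "x\<^sub>V k l \<otimes>\<^bsub>F\<^esub> x\<^sub>V i j"] assms by auto
  thus "perm_gen V i j \<otimes>\<^bsub>perm_cstar V\<^esub> perm_gen V k l \<noteq> perm_gen V k l \<otimes>\<^bsub>perm_cstar V\<^esub> perm_gen V i j"
    using assms U.completion_mult[of "\<lambda>_. x\<^sub>V i j" "\<lambda>_. x\<^sub>V k l"] U.completion_mult[of "\<lambda>_. x\<^sub>V k l" "\<lambda>_. x\<^sub>V i j"]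
    by (simp only: perm_cstar_eq perm_gen_eq U.const_cauchy x_closed not_False_eq_True)
  show "perm_gen V i j \<in> carrier (perm_cstar V)" "perm_gen V k l \<in> carrier (perm_cstar V)"
    using assms by (simp_all only: perm_cstar_eq perm_gen_eq U.const_cauchy x_closed U.cls_closed)
qed

end

section \<open>A magic unitary of size five with noncommuting entries\<close>

definition coordinate_projection :: "complex^2^2" where
  "coordinate_projection = vector [vector [1, 0], vector [0, 0]]"

text \<open>The projection onto the line spanned by \<open>(1, 1)\<close>. This line is neither
  parallel nor orthogonal to the first axis, so the projection does not commute with
  \<open>coordinate_projection\<close>.\<close>

definition diagonal_projection :: "complex^2^2" where
  "diagonal_projection = vector [vector [1/2, 1/2], vector [1/2, 1/2]]"

text \<open>Block diagonal, with two blocks of size two of the form \<open>P, 1 - P\<close> over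
  \<open>1 - P, P\<close>, one for each projection, and a final 1 that pads the size from four to
  five. Magic relations link only entries of a common row or column, so the two projections are free
  to be unrelated. The value 0 outside \<open>{1..5}\<close> keeps orthogonality valid for all
  indices.\<close>

definition magic5 :: "nat \<Rightarrow> nat \<Rightarrow> complex^2^2" where
  "magic5 i j =
    (if i \<in> {1, 2} \<and> j \<in> {1, 2}
     then if i = j then coordinate_projection else mat 1 - coordinate_projection
     else if i \<in> {3, 4} \<and> j \<in> {3, 4}
     then if i = j then diagonal_projection else mat 1 - diagonal_projection
     else if i = 5 \<and> j = 5 then mat 1 else 0)"

lemma coordinate_projection [simp]:
  "coordinate_projection ** coordinate_projection = coordinate_projection"
  "adj coordinate_projection = coordinate_projection"
  by (simp_all add: coordinate_projection_def matrix_matrix_mult_def vec_eq_iff forall_2 sum_2 adj_def)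

lemma diagonal_projection [simp]:
  "diagonal_projection ** diagonal_projection = diagonal_projection"
  "adj diagonal_projection = diagonal_projection"
  by (simp_all add: diagonal_projection_def matrix_matrix_mult_def vec_eq_iff forall_2 sum_2 adj_def)

lemma complement_projection [simp]:
  fixes P :: "complex^2^2"
  shows "P ** P = P \<Longrightarrow> P ** (mat 1 - P) = 0" "P ** P = P \<Longrightarrow> (mat 1 - P) ** P = 0"
    "P ** P = P \<Longrightarrow> (mat 1 - P) ** (mat 1 - P) = mat 1 - P" "adj P = P \<Longrightarrow> adj (mat 1 - P) = mat 1 - P"
proof -
  have "P ** (mat 1 - P) = P - P ** P" "(mat 1 - P) ** P = P - P ** P"
    "(mat 1 - P) ** (mat 1 - P) = mat 1 - P - P + P ** P"
    by (simp_all add: matrix_matrix_mult_def vec_eq_iff forall_2 sum_2 mat_def algebra_simps)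
  thus "P ** P = P \<Longrightarrow> P ** (mat 1 - P) = 0" "P ** P = P \<Longrightarrow> (mat 1 - P) ** P = 0"
    "P ** P = P \<Longrightarrow> (mat 1 - P) ** (mat 1 - P) = mat 1 - P" by auto
  have "adj (mat 1 - P) = mat 1 - adj P" by (auto simp: adj_def vec_eq_iff mat_def)
  thus "adj P = P \<Longrightarrow> adj (mat 1 - P) = mat 1 - P" by simp
qed

lemma magic5_noncommutative: "magic5 1 1 ** magic5 3 3 \<noteq> magic5 3 3 ** magic5 1 1"
  by (simp add: magic5_def coordinate_projection_def diagonal_projection_def
      matrix_matrix_mult_def vec_eq_iff forall_2 sum_2 vector_2)

lemma magic_matrix5: "magic_matrix {1..5} magic5"
proof
  have V: "{1..5::nat} = {1, 2, 3, 4, 5}" by auto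
  have zero: "adj 0 = (0 :: complex^2^2)" "adj (mat 1) = (mat 1 :: complex^2^2)"
    "0 ** M = 0" "M ** 0 = 0" for M :: "complex^2^2"
    by (auto simp: adj_def vec_eq_iff mat_def matrix_matrix_mult_def)
  note [simp] = zero
  fix i j k :: nat
  show "adj (magic5 i j) = magic5 i j" "magic5 i j ** magic5 i j = magic5 i j"
    by (auto simp: magic5_def)
  show "magic5 i j ** magic5 i k = 0" if "j \<noteq> k"
    using that by (auto simp: magic5_def)
  show "magic5 i j ** magic5 k j = 0" if "i \<noteq> k"
    using that by (auto simp: magic5_def)
  show "(\<Sum>j\<in>{1..5}. magic5 i j) = mat 1" if "i \<in> {1..5}"
    using that unfolding V by (auto simp: magic5_def)
  show "(\<Sum>i\<in>{1..5}. magic5 i j) = mat 1" if "j \<in> {1..5}"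
    using that unfolding V by (auto simp: magic5_def)
qed simp

lemma carrier_matrix_hopf [simp]:
  "carrier (matrix_hopf A V u) = carrier A" "mult (matrix_hopf A V u) = mult A"
  by (simp_all add: matrix_hopf_def cstar_algebra.defs)

lemma A_s_5_noncommutative:
  "\<exists>x\<in>carrier (A_s 5). \<exists>y\<in>carrier (A_s 5). x \<otimes>\<^bsub>A_s 5\<^esub> y \<noteq> y \<otimes>\<^bsub>A_s 5\<^esub> x"
proof -
  interpret magic_matrix "{1..5}" magic5 by (rule magic_matrix5)
  show ?thesis
    using perm_cstar_noncommutative[of 1 1 3 3] magic5_noncommutative by (simp add: A_s_def)
qed

section \<open>Magic unitaries commuting with a Moore graph of degree three\<close>

text \<open>Functions are extensional, so automorphisms that agree on \<open>V\<close> are equal and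
  there are finitely many for finite \<open>V\<close>; surjectivity then follows from
  injectivity.\<close>

definition graph_aut :: "'v set \<Rightarrow> ('v \<Rightarrow> 'v \<Rightarrow> bool) \<Rightarrow> ('v \<Rightarrow> 'v) set" where
  "graph_aut V E = {f \<in> V \<rightarrow>\<^sub>E V. inj_on f V \<and> (\<forall>i\<in>V. \<forall>k\<in>V. E (f i) (f k) = E i k)}"

text \<open>\<open>common_nbr\<close> bounds the diameter by two, \<open>common_nbr_unique\<close>
  excludes four-cycles, and \<open>nbrs\<close> bounds the degree by three. The last is phrased as
  it is applied: three distinct neighbours exhaust the neighbourhood.\<close>

locale moore_graph =
  fixes V :: "'v set" and E :: "'v \<Rightarrow> 'v \<Rightarrow> bool"
  assumes finite_vertices: "finite V"
    and E_sym: "E i j \<Longrightarrow> E j i"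
    and common_nbr: "j \<in> V \<Longrightarrow> l \<in> V \<Longrightarrow> j \<noteq> l \<Longrightarrow> \<not> E j l \<Longrightarrow> \<exists>s\<in>V. E j s \<and> E s l"
    and common_nbr_unique: "j \<in> V \<Longrightarrow> l \<in> V \<Longrightarrow> s \<in> V \<Longrightarrow> t \<in> V \<Longrightarrow> j \<noteq> l \<Longrightarrow>
      E j s \<Longrightarrow> E s l \<Longrightarrow> E j t \<Longrightarrow> E t l \<Longrightarrow> s = t"
    and nbrs: "s \<in> V \<Longrightarrow> j \<in> V \<Longrightarrow> k \<in> V \<Longrightarrow> l \<in> V \<Longrightarrow> x \<in> V \<Longrightarrow>
      E s j \<Longrightarrow> E s k \<Longrightarrow> E s l \<Longrightarrow> E s x \<Longrightarrow> distinct [j, k, l] \<Longrightarrow> x \<in> {j, k, l}"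

text \<open>Commutativity of the entries is a statement about rings, without star or norm. It can
  thus be proved in an algebraic quotient of the free algebra, before anything is completed.\<close>

locale magic_graph_ring = moore_graph V E + ring R
  for V :: "'v set" and E and R :: "('r, 'm) ring_scheme" (structure) +
  fixes a :: "'v \<Rightarrow> 'v \<Rightarrow> 'r"
  assumes entry_closed [simp]: "i \<in> V \<Longrightarrow> j \<in> V \<Longrightarrow> a i j \<in> carrier R"
    and entry_idem: "i \<in> V \<Longrightarrow> j \<in> V \<Longrightarrow> a i j \<otimes> a i j = a i j"
    and row_orth: "i \<in> V \<Longrightarrow> j \<in> V \<Longrightarrow> k \<in> V \<Longrightarrow> j \<noteq> k \<Longrightarrow> a i j \<otimes> a i k = \<zero>"
    and col_orth: "i \<in> V \<Longrightarrow> j \<in> V \<Longrightarrow> k \<in> V \<Longrightarrow> i \<noteq> k \<Longrightarrow> a i j \<otimes> a k j = \<zero>"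
    and row_sum: "i \<in> V \<Longrightarrow> (\<Oplus>j\<in>V. a i j) = \<one>"
    and graph_commute: "i \<in> V \<Longrightarrow> j \<in> V \<Longrightarrow>
      (\<Oplus>k\<in>V. if E i k then a k j else \<zero>) = (\<Oplus>k\<in>V. if E k j then a i k else \<zero>)"
begin

lemma triple_zeroI:
  assumes "x \<in> carrier R" "y \<in> carrier R" "z \<in> carrier R" "x \<otimes> y = \<zero> \<or> y \<otimes> z = \<zero>"
  shows "x \<otimes> y \<otimes> z = \<zero>"
  using assms(4)
proof
  assume "x \<otimes> y = \<zero>"
  thus ?thesis using assms(3) by simp
next
  assume "y \<otimes> z = \<zero>"
  thus ?thesis using assms(1-3) by (simp add: m_assoc)
qed

text \<open>The basic manoeuvre: expand a sum between two factors that annihilate all terms but one.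
  It is applied to row sums, which are \<open>\<one>\<close>, and to the two sides of the graph
  relation.\<close>

lemma finsum_sandwich:
  assumes f: "f \<in> V \<rightarrow> carrier R" and xy: "x \<in> carrier R" "y \<in> carrier R"
    and k: "k \<in> V" and zero: "\<And>k'. k' \<in> V \<Longrightarrow> k' \<noteq> k \<Longrightarrow> x \<otimes> f k' \<otimes> y = \<zero>"
  shows "x \<otimes> finsum R f V \<otimes> y = x \<otimes> f k \<otimes> y"
proof -
  have fc: "f k' \<in> carrier R" if "k' \<in> V" for k' using f that by auto
  have "x \<otimes> finsum R f V \<otimes> y = (\<Oplus>k'\<in>V. x \<otimes> f k' \<otimes> y)"
    using finite_vertices f xy by (subst finsum_rdistr, simp_all add: fc Pi_def)
      (subst finsum_ldistr, simp_all add: fc Pi_def)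
  also have "\<dots> = (\<Oplus>k'\<in>V. if k = k' then x \<otimes> f k' \<otimes> y else \<zero>)"
    using zero xy by (intro finsum_cong') (auto simp: fc)
  also have "\<dots> = x \<otimes> f k \<otimes> y"
    using finite_vertices k xy by (intro finsum_singleton) (auto simp: fc)
  finally show ?thesis .
qed

lemma insert_row:
  assumes "x \<in> carrier R" "y \<in> carrier R" "i \<in> V" "j \<in> V"
    and "\<And>j'. j' \<in> V \<Longrightarrow> j' \<noteq> j \<Longrightarrow> x \<otimes> a i j' \<otimes> y = \<zero>"
  shows "x \<otimes> y = x \<otimes> a i j \<otimes> y"
  using finsum_sandwich[of "a i" x y j] assms by (simp add: row_sum)

text \<open>Put the graph relation at the entry \<open>(i, l)\<close> between \<open>a i j\<close>
  and \<open>a k l\<close>. Column orthogonality leaves only the term \<open>k\<close> on one side,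
  row orthogonality only the term \<open>j\<close> on the other, so the product is multiplied by the
  truth value of \<open>E i k\<close> or, equally, by that of \<open>E j l\<close>.\<close>

lemma adj_zero:
  assumes V: "i \<in> V" "j \<in> V" "k \<in> V" "l \<in> V" and ne: "E i k \<noteq> E j l"
  shows "a i j \<otimes> a k l = \<zero>"
proof -
  have "a i j \<otimes> (\<Oplus>k'\<in>V. if E i k' then a k' l else \<zero>) \<otimes> a k l =
      a i j \<otimes> (if E i k then a k l else \<zero>) \<otimes> a k l"
    by (rule finsum_sandwich) (use V in \<open>auto simp: m_assoc col_orth\<close>)
  also have "\<dots> = (if E i k then a i j \<otimes> a k l else \<zero>)"
    using V by (simp add: m_assoc entry_idem)
  finally have 1: "a i j \<otimes> (\<Oplus>k'\<in>V. if E i k' then a k' l else \<zero>) \<otimes> a k l = \<dots>" .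
  have "a i j \<otimes> (\<Oplus>k'\<in>V. if E k' l then a i k' else \<zero>) \<otimes> a k l =
      a i j \<otimes> (if E j l then a i j else \<zero>) \<otimes> a k l"
    by (rule finsum_sandwich) (use V in \<open>auto simp: row_orth\<close>)
  also have "\<dots> = (if E j l then a i j \<otimes> a k l else \<zero>)"
    using V by (simp add: entry_idem)
  finally have "(if E j l then a i j \<otimes> a k l else \<zero>) = (if E i k then a i j \<otimes> a k l else \<zero>)"
    using 1 graph_commute V by simp
  thus ?thesis using ne by (auto split: if_splits)
qed

text \<open>Both products equal \<open>a i j \<otimes> a k l \<otimes> a i j\<close>: expand
  \<open>\<one>\<close> as the sum of row \<open>i\<close>, at the right end of one and at the left
  end of the other. The second expansion varies the left entry, so the hypothesis ranges over all
  \<open>j\<close>.\<close>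

lemma commute_if_triple_zero:
  assumes V: "i \<in> V" "j \<in> V" "k \<in> V" "l \<in> V"
    and zero: "\<And>j s. j \<in> V \<Longrightarrow> s \<in> V \<Longrightarrow> j \<noteq> s \<Longrightarrow> a i j \<otimes> a k l \<otimes> a i s = \<zero>"
  shows "a i j \<otimes> a k l = a k l \<otimes> a i j"
proof -
  have "a i j \<otimes> a k l \<otimes> \<one> = a i j \<otimes> a k l \<otimes> a i j \<otimes> \<one>"
    by (rule insert_row) (use V zero in auto)
  moreover have "\<one> \<otimes> (a k l \<otimes> a i j) = \<one> \<otimes> a i j \<otimes> (a k l \<otimes> a i j)"
    by (rule insert_row) (use V zero in \<open>auto simp flip: m_assoc\<close>)
  ultimately show ?thesis using V by (simp add: m_assoc)
qed

text \<open>Between \<open>a i j\<close> and \<open>a i s\<close> an entry of row \<open>k\<close>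
  survives only if its column is a common neighbour of \<open>j\<close> and \<open>s\<close>. There
  is at most one, so \<open>a k l\<close> may be replaced by the whole row sum
  \<open>\<one>\<close>, and \<open>a i j \<otimes> a i s\<close> vanishes.\<close>

lemma triple_zero_adjacent:
  assumes V: "i \<in> V" "j \<in> V" "k \<in> V" "l \<in> V" "s \<in> V" and "j \<noteq> s" "E i k"
  shows "a i j \<otimes> a k l \<otimes> a i s = \<zero>"
proof (cases "E j l \<and> E l s")
  case False
  have "E k i" using \<open>E i k\<close> by (rule E_sym)
  hence "a i j \<otimes> a k l = \<zero> \<or> a k l \<otimes> a i s = \<zero>"
    using False assms adj_zero by blast
  thus ?thesis using V by (intro triple_zeroI) simp_all
next
  case True
  have "a i j \<otimes> a i s = a i j \<otimes> a k l \<otimes> a i s"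
  proof (rule insert_row)
    fix l' assume l': "l' \<in> V" "l' \<noteq> l"
    hence "\<not> (E j l' \<and> E l' s)" using common_nbr_unique[of j s l l'] V True \<open>j \<noteq> s\<close> by blast
    hence "a i j \<otimes> a k l' = \<zero> \<or> a k l' \<otimes> a i s = \<zero>"
      using assms adj_zero l' E_sym by blast
    thus "a i j \<otimes> a k l' \<otimes> a i s = \<zero>" using V l' by (intro triple_zeroI) simp_all
  qed (use V in auto)
  thus ?thesis using assms by (simp add: row_orth)
qed

lemma commute_adjacent:
  "i \<in> V \<Longrightarrow> j \<in> V \<Longrightarrow> k \<in> V \<Longrightarrow> l \<in> V \<Longrightarrow> E i k \<Longrightarrow> a i j \<otimes> a k l = a k l \<otimes> a i j"
  by (intro commute_if_triple_zero triple_zero_adjacent)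

text \<open>Let \<open>t\<close> and \<open>m\<close> be the common neighbours of \<open>i, k\<close> and of \<open>j, l\<close>. Then \<open>a t m\<close> can be inserted
  between \<open>a i j\<close> and \<open>a k l\<close>, and it commutes with everything in sight; multiplied by \<open>a t m\<close>, the
  entries indexed by the neighbours of \<open>t\<close> and of \<open>m\<close> form a magic unitary of size three, for
  which commutativity is elementary.\<close>

lemma triple_zero_far:
  assumes V: "i \<in> V" "j \<in> V" "k \<in> V" "l \<in> V" "s \<in> V" and "j \<noteq> s" "i \<noteq> k" "\<not> E i k"
  shows "a i j \<otimes> a k l \<otimes> a i s = \<zero>"
proof (cases "j = l \<or> s = l \<or> E j l \<or> E l s")
  case True
  have "\<not> E k i" using \<open>\<not> E i k\<close> E_sym by blast
  hence "a i j \<otimes> a k l = \<zero> \<or> a k l \<otimes> a i s = \<zero>"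
    using True assms adj_zero col_orth by metis
  thus ?thesis using V by (intro triple_zeroI) simp_all
next
  case False
  obtain t where t: "t \<in> V" "E i t" "E t k" using common_nbr assms by blast
  obtain m where m: "m \<in> V" "E j m" "E m l" using common_nbr[of j l] False V by blast
  note V = V t(1) m(1)
  have tm_ij: "a i j \<otimes> a t m = a t m \<otimes> a i j" using commute_adjacent V t by simp
  have tm_kl: "a t m \<otimes> a k l = a k l \<otimes> a t m" using commute_adjacent V t by simp
  have ijkl: "a i j \<otimes> a k l = a i j \<otimes> a t m \<otimes> a k l"
  proof (rule insert_row)
    fix m' assume m': "m' \<in> V" "m' \<noteq> m"
    hence "\<not> (E j m' \<and> E m' l)" using common_nbr_unique[of j l m m'] V m False by blast
    hence "a i j \<otimes> a t m' = \<zero> \<or> a t m' \<otimes> a k l = \<zero>"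
      using V adj_zero m' t by blast
    thus "a i j \<otimes> a t m' \<otimes> a k l = \<zero>" using V m' by (intro triple_zeroI) simp_all
  qed (use V in auto)
  show ?thesis
  proof (cases "E m s")
    case False
    \<comment> \<open>Here \<open>t\<close> and \<open>i\<close> are adjacent while \<open>m\<close>
      and \<open>s\<close> are not. Moving \<open>a t m\<close> past \<open>a k l\<close> brings it
      next to \<open>a i s\<close>.\<close>
    have "a t m \<otimes> a i s = \<zero>" using adj_zero[of t m i s] V False t E_sym by blast
    hence "a i j \<otimes> (a k l \<otimes> a t m) \<otimes> a i s = \<zero>" using V by (simp add: m_assoc)
    thus ?thesis using ijkl tm_kl V by (simp add: m_assoc)
  next
    case True
    \<comment> \<open>Now \<open>j\<close>, \<open>l\<close>, \<open>s\<close> are three distinct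
      neighbours of \<open>m\<close>, hence all of them. In the expansion along row \<open>k\<close>
      every column but \<open>l\<close> is killed: \<open>j\<close> by \<open>a i j\<close>,
      \<open>s\<close> by \<open>a i s\<close>, and non-neighbours of \<open>m\<close> by
      \<open>a t m\<close>. The unexpanded side contains
      \<open>a i j \<otimes> a i s\<close>.\<close>
    have "a i j \<otimes> a t m \<otimes> a i s = a i j \<otimes> a t m \<otimes> a k l \<otimes> a i s"
    proof (rule insert_row)
      fix x assume x: "x \<in> V" "x \<noteq> l"
      consider "x = j" | "x = s" | "\<not> E m x"
        using nbrs[of m j l s x] x V m True \<open>j \<noteq> s\<close> False E_sym by auto
      thus "a i j \<otimes> a t m \<otimes> a k x \<otimes> a i s = \<zero>"
      proof cases
        case 1
        hence "a i j \<otimes> a k x = \<zero>" using col_orth V assms by simp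
        hence "a t m \<otimes> (a i j \<otimes> a k x) \<otimes> a i s = \<zero>" using V by simp
        thus ?thesis using V x tm_ij by (simp add: m_assoc[symmetric])
      next
        case 2
        hence "a k x \<otimes> a i s = \<zero>" using col_orth V assms by metis
        thus ?thesis using V x by (simp add: m_assoc)
      next
        case 3
        hence "a t m \<otimes> a k x = \<zero>" using adj_zero V x t by simp
        hence "a i j \<otimes> (a t m \<otimes> a k x) \<otimes> a i s = \<zero>" using V by simp
        thus ?thesis using V x by (simp add: m_assoc)
      qed
    qed (use V in auto)
    also have "a i j \<otimes> a t m \<otimes> a i s = a t m \<otimes> (a i j \<otimes> a i s)"
      using V tm_ij by (simp add: m_assoc[symmetric])
    also have "\<dots> = \<zero>" using V row_orth \<open>j \<noteq> s\<close> by simp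
    finally show ?thesis using ijkl by simp
  qed
qed

lemma commute:
  assumes V: "i \<in> V" "j \<in> V" "k \<in> V" "l \<in> V"
  shows "a i j \<otimes> a k l = a k l \<otimes> a i j"
proof (cases "i = k")
  case True
  thus ?thesis using row_orth[of k j l] row_orth[of k l j] V by (cases "j = l") auto
next
  case False
  show ?thesis
  proof (rule commute_if_triple_zero[OF V])
    fix j s assume js: "j \<in> V" "s \<in> V" "j \<noteq> s"
    show "a i j \<otimes> a k l \<otimes> a i s = \<zero>"
      by (cases "E i k") (rule triple_zero_adjacent triple_zero_far; use V js False in simp)+
  qed
qed

section \<open>Products of entries along a map\<close>

definition path_prod :: "'v list \<Rightarrow> ('v \<Rightarrow> 'v) \<Rightarrow> 'r" where
  "path_prod vs f = foldr (\<lambda>i r. a i (f i) \<otimes> r) vs \<one>"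

lemma path_prod_simps [simp]:
  "path_prod [] f = \<one>" "path_prod (i # vs) f = a i (f i) \<otimes> path_prod vs f"
  by (simp_all add: path_prod_def)

lemma path_prod_closed [simp]:
  "set vs \<subseteq> V \<Longrightarrow> f \<in> V \<rightarrow> V \<Longrightarrow> path_prod vs f \<in> carrier R"
  by (induction vs) (auto simp: Pi_iff)

lemma path_prod_commute:
  assumes "set vs \<subseteq> V" "f \<in> V \<rightarrow> V" "k \<in> V" "l \<in> V"
  shows "path_prod vs f \<otimes> a k l = a k l \<otimes> path_prod vs f"
  using assms(1)
proof (induction vs)
  case (Cons i vs)
  have fi: "i \<in> V" "f i \<in> V" using Cons assms by auto
  have "path_prod (i # vs) f \<otimes> a k l = a i (f i) \<otimes> a k l \<otimes> path_prod vs f"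
    using Cons assms fi by (simp add: m_assoc)
  also have "\<dots> = a k l \<otimes> path_prod (i # vs) f"
    using Cons assms fi commute[of i "f i" k l] by (simp add: m_assoc)
  finally show ?case .
qed (use assms in simp)

lemma path_prod_absorb:
  assumes "set vs \<subseteq> V" "f \<in> V \<rightarrow> V" "k \<in> set vs"
  shows "path_prod vs f \<otimes> a k (f k) = path_prod vs f"
  using assms(1,3)
proof (induction vs)
  case (Cons i vs)
  have fi: "i \<in> V" "f i \<in> V" "k \<in> V" "f k \<in> V" using Cons assms by auto
  show ?case
  proof (cases "k \<in> set vs")
    case True
    thus ?thesis using Cons assms fi by (simp add: m_assoc)
  next
    case False
    hence "k = i" using Cons by simp
    thus ?thesis using Cons.prems assms fi path_prod_commute[of vs f i "f i"]
      by (simp add: m_assoc) (simp add: entry_idem flip: m_assoc)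
  qed
qed simp

text \<open>Since the product already contains \<open>a k (f k)\<close>, it can be made to end in
  it, and row orthogonality decides. So every entry acts on the product as a scalar, its value at
  the point \<open>f\<close>.\<close>

lemma path_prod_mult:
  assumes "set vs = V" "f \<in> V \<rightarrow> V" "k \<in> V" "l \<in> V"
  shows "path_prod vs f \<otimes> a k l = (if f k = l then path_prod vs f else \<zero>)"
proof (cases "f k = l")
  case False
  have fk: "f k \<in> V" using assms by auto
  have "path_prod vs f \<otimes> a k l = path_prod vs f \<otimes> (a k (f k) \<otimes> a k l)"
    using path_prod_absorb[of vs f k] assms fk by (simp flip: m_assoc)
  thus ?thesis using False assms fk row_orth[of k "f k" l] by simp
qed (use path_prod_absorb[of vs f k] assms in simp)

lemma path_prod_zero:
  assumes "set vs = V" "f \<in> V \<rightarrow> V" "i \<in> V" "k \<in> V" "a i (f i) \<otimes> a k (f k) = \<zero>"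
  shows "path_prod vs f = \<zero>"
proof -
  have f: "f i \<in> V" "f k \<in> V" using assms by auto
  have "path_prod vs f = path_prod vs f \<otimes> a i (f i) \<otimes> a k (f k)"
    using path_prod_absorb[of vs f i] path_prod_absorb[of vs f k] assms by simp
  thus ?thesis using assms f by (simp add: m_assoc)
qed

text \<open>The product of all row sums is \<open>\<one>\<close> and expands into the path products.
  The induction inserts the row sums one vertex at a time, replacing \<open>y\<close> by
  \<open>a i j \<otimes> y\<close>.\<close>

lemma zero_if_path_prods_zero:
  assumes "y \<in> carrier R" "set vs \<subseteq> V" "distinct vs"
    and "\<And>f. f \<in> V \<rightarrow> V \<Longrightarrow> path_prod vs f \<otimes> y = \<zero>"
  shows "y = \<zero>"
  using assms
proof (induction vs arbitrary: y)
  case Nil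
  from Nil.prems(4)[of id] Nil.prems(1) show ?case by simp
next
  case (Cons i vs)
  have i: "i \<in> V" using Cons by simp
  have "a i j \<otimes> y = \<zero>" if j: "j \<in> V" for j
  proof (rule Cons.IH)
    fix f assume f: "f \<in> V \<rightarrow> V"
    \<comment> \<open>Distinctness keeps \<open>i\<close> out of the tail, so the value of
      \<open>f\<close> at \<open>i\<close> can be chosen freely.\<close>
    have "path_prod vs (f(i := j)) = path_prod vs f"
      using Cons.prems(3) unfolding path_prod_def by (intro foldr_cong) auto
    moreover have "path_prod (i # vs) (f(i := j)) \<otimes> y = \<zero>"
      using f j by (intro Cons.prems(4)) auto
    ultimately show "path_prod vs f \<otimes> (a i j \<otimes> y) = \<zero>"
      using path_prod_commute[of vs f i j] Cons.prems f i j by (simp flip: m_assoc)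
  qed (use Cons.prems i j in auto)
  hence "(\<Oplus>j\<in>V. a i j \<otimes> y) = \<zero>" using i by (simp add: finsum_cong'[of V V "\<lambda>_. \<zero>"])
  moreover have "(\<Oplus>j\<in>V. a i j) \<otimes> y = (\<Oplus>j\<in>V. a i j \<otimes> y)"
    using finite_vertices Cons.prems(1) i by (intro finsum_ldistr) auto
  ultimately show ?case using row_sum[OF i] Cons.prems(1) by simp
qed

lemma path_prod_restrict:
  "set vs \<subseteq> V \<Longrightarrow> path_prod vs (restrict f V) = path_prod vs f"
  unfolding path_prod_def by (intro foldr_cong) auto

text \<open>The path product of any other map vanishes: if two vertices have the same image, by
  column orthogonality, and if adjacency is not preserved, by \<open>adj_zero\<close>.\<close>

lemma zero_by_automorphisms:
  assumes y: "y \<in> carrier R" and vs: "set vs = V" "distinct vs"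
    and zero: "\<And>f. f \<in> graph_aut V E \<Longrightarrow> path_prod vs f \<otimes> y = \<zero>"
  shows "y = \<zero>"
proof (rule zero_if_path_prods_zero[of y vs])
  fix f assume f: "f \<in> V \<rightarrow> V"
  show "path_prod vs f \<otimes> y = \<zero>"
  proof (cases "restrict f V \<in> graph_aut V E")
    case True
    thus ?thesis using zero[OF True] vs by (simp add: path_prod_restrict)
  next
    case False
    have "\<exists>i\<in>V. \<exists>k\<in>V. a i (f i) \<otimes> a k (f k) = \<zero>"
    proof (cases "inj_on f V")
      case True
      have "\<exists>i\<in>V. \<exists>k\<in>V. E (f i) (f k) \<noteq> E i k"
      proof (rule ccontr)
        assume "\<not> (\<exists>i\<in>V. \<exists>k\<in>V. E (f i) (f k) \<noteq> E i k)"
        hence "restrict f V \<in> graph_aut V E"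
          using f True by (auto simp: graph_aut_def inj_on_def)
        thus False using False by blast
      qed
      then obtain i k where "i \<in> V" "k \<in> V" "E i k \<noteq> E (f i) (f k)" by metis
      thus ?thesis using adj_zero[of i "f i" k "f k"] f by blast
    next
      case False
      then obtain i k where "i \<in> V" "k \<in> V" "i \<noteq> k" "f i = f k" by (auto simp: inj_on_def)
      hence "a i (f i) \<otimes> a k (f k) = \<zero>" using col_orth[of i "f i" k] f by (simp add: Pi_iff)
      thus ?thesis using \<open>i \<in> V\<close> \<open>k \<in> V\<close> by blast
    qed
    hence "path_prod vs f = \<zero>" using path_prod_zero[OF vs(1) f] by blast
    thus ?thesis using y by simp
  qed
qed (use y vs in auto)

end

section \<open>The quantum automorphism group of a Moore graph of degree three\<close>

lemma ring_hom_finsum: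
  assumes "ring R" "ring S" "\<theta> \<in> ring_hom R S" "finite X" "f \<in> X \<rightarrow> carrier R"
  shows "\<theta> (finsum R f X) = (\<Oplus>\<^bsub>S\<^esub>i\<in>X. \<theta> (f i))"
proof -
  interpret ring_hom_ring R S \<theta> using assms by (intro ring_hom_ringI2)
  show ?thesis using assms(4,5) by induction (auto simp: Pi_iff)
qed

text \<open>The homomorphism theorem for a finite family of characters: dividing by their exact
  common kernel yields all functions on the family, provided that every function is attained. It is
  applied to the quotient by the graph ideal and to the algebraic tensor product. The representative
  chosen in \<open>k\<close> does not matter, as each \<open>h p\<close> is constant on
  cosets.\<close>

lemma star_quotient_model:
  assumes J: "ideal J F" and fin: "finite X"
    and smult: "\<And>x c. x \<in> carrier F \<Longrightarrow> c \<odot>\<^bsub>F\<^esub> x \<in> carrier F"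
    and star: "\<And>x. x \<in> carrier F \<Longrightarrow> star F x \<in> carrier F"
    and h_zero: "\<And>p. p \<in> X \<Longrightarrow> h p \<zero>\<^bsub>F\<^esub> = 0"
    and h_one: "\<And>p. p \<in> X \<Longrightarrow> h p \<one>\<^bsub>F\<^esub> = 1"
    and h_add: "\<And>p x y. p \<in> X \<Longrightarrow> x \<in> carrier F \<Longrightarrow> y \<in> carrier F \<Longrightarrow> h p (x \<oplus>\<^bsub>F\<^esub> y) = h p x + h p y"
    and h_mult: "\<And>p x y. p \<in> X \<Longrightarrow> x \<in> carrier F \<Longrightarrow> y \<in> carrier F \<Longrightarrow> h p (x \<otimes>\<^bsub>F\<^esub> y) = h p x * h p y"
    and h_smult: "\<And>p x c. p \<in> X \<Longrightarrow> x \<in> carrier F \<Longrightarrow> h p (c \<odot>\<^bsub>F\<^esub> x) = c * h p x"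
    and h_star: "\<And>p x. p \<in> X \<Longrightarrow> x \<in> carrier F \<Longrightarrow> h p (star F x) = cnj (h p x)"
    and ker: "J = {x \<in> carrier F. \<forall>p\<in>X. h p x = 0}"
    and surj: "\<And>\<phi>. \<exists>x\<in>carrier F. \<forall>p\<in>X. h p x = \<phi> p"
  defines "k \<equiv> (\<lambda>p Y. h p (SOME x. x \<in> Y))"
  shows "function_model (star_quotient F J) X k"
    and "\<And>p x. p \<in> X \<Longrightarrow> x \<in> carrier F \<Longrightarrow> k p (J +>\<^bsub>F\<^esub> x) = h p x"
proof -
  interpret ideal J F by fact
  let ?Q = "star_quotient F J"
  have coset_h: "h p y = h p x" if "p \<in> X" "x \<in> carrier F" "y \<in> J +>\<^bsub>F\<^esub> x" for p x y
  proof -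
    obtain z where "z \<in> J" "y = z \<oplus>\<^bsub>F\<^esub> x" using \<open>y \<in> J +>\<^bsub>F\<^esub> x\<close> by (auto simp: a_r_coset_def')
    moreover have "z \<in> carrier F" "h p z = 0" using \<open>z \<in> J\<close> \<open>p \<in> X\<close> ker by blast+
    ultimately show ?thesis using h_add[OF \<open>p \<in> X\<close> _ \<open>x \<in> carrier F\<close>, of z] by simp
  qed
  have coset_self: "x \<in> J +>\<^bsub>F\<^esub> x" if "x \<in> carrier F" for x using that by (rule a_rcos_self)
  have coset_carrier: "y \<in> carrier F" if "x \<in> carrier F" "y \<in> J +>\<^bsub>F\<^esub> x" for x y
    using that a_elemrcos_carrier by blast
  show k: "k p (J +>\<^bsub>F\<^esub> x) = h p x" if "p \<in> X" "x \<in> carrier F" for p x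
    unfolding k_def
    by (rule coset_h[OF that someI[of "\<lambda>y. y \<in> J +>\<^bsub>F\<^esub> x"]]) (rule coset_self[OF that(2)])
  have h_minus: "h p (x \<ominus>\<^bsub>F\<^esub> y) = h p x - h p y" if "p \<in> X" "x \<in> carrier F" "y \<in> carrier F" for p x y
    using h_add[of p "x \<ominus>\<^bsub>F\<^esub> y" y] that by (simp add: minus_eq a_assoc l_neg)
  have coset_eq: "J +>\<^bsub>F\<^esub> x = J +>\<^bsub>F\<^esub> y"
    if "x \<in> carrier F" "y \<in> carrier F" "\<And>p. p \<in> X \<Longrightarrow> h p x = h p y" for x y
  proof -
    have "x \<ominus>\<^bsub>F\<^esub> y \<in> J" unfolding ker using that by (simp add: h_minus)
    hence "x \<in> J +>\<^bsub>F\<^esub> y" using a_rcos_module_minus[OF ring_axioms that(2,1)] by simp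
    thus ?thesis using that(2) by (rule a_repr_independence'[symmetric])
  qed
  have car: "carrier ?Q = {J +>\<^bsub>F\<^esub> x | x. x \<in> carrier F}"
    by (auto simp: star_quotient_def FactRing_def A_RCOSETS_def' a_r_coset_def')
  have ops: "\<one>\<^bsub>?Q\<^esub> = J +>\<^bsub>F\<^esub> \<one>\<^bsub>F\<^esub>" "\<zero>\<^bsub>?Q\<^esub> = J +>\<^bsub>F\<^esub> \<zero>\<^bsub>F\<^esub>"
    "\<And>x y. x \<in> carrier F \<Longrightarrow> y \<in> carrier F \<Longrightarrow> (J +>\<^bsub>F\<^esub> x) \<oplus>\<^bsub>?Q\<^esub> (J +>\<^bsub>F\<^esub> y) = J +>\<^bsub>F\<^esub> (x \<oplus>\<^bsub>F\<^esub> y)"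
    "\<And>x y. x \<in> carrier F \<Longrightarrow> y \<in> carrier F \<Longrightarrow> (J +>\<^bsub>F\<^esub> x) \<otimes>\<^bsub>?Q\<^esub> (J +>\<^bsub>F\<^esub> y) = J +>\<^bsub>F\<^esub> (x \<otimes>\<^bsub>F\<^esub> y)"
    using a_subset by (auto simp: star_quotient_def FactRing_def rcoset_mult_add a_rcos_sum)
  have sm: "c \<odot>\<^bsub>?Q\<^esub> (J +>\<^bsub>F\<^esub> x) = J +>\<^bsub>F\<^esub> (c \<odot>\<^bsub>F\<^esub> x)" if "x \<in> carrier F" for c x
  proof -
    have *: "J +>\<^bsub>F\<^esub> (c \<odot>\<^bsub>F\<^esub> y) = J +>\<^bsub>F\<^esub> (c \<odot>\<^bsub>F\<^esub> x)" if "y \<in> J +>\<^bsub>F\<^esub> x" for y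
      using that \<open>x \<in> carrier F\<close> coset_carrier coset_h by (intro coset_eq smult) (auto simp: h_smult)
    have "c \<odot>\<^bsub>?Q\<^esub> (J +>\<^bsub>F\<^esub> x) = (\<Union>y\<in>J +>\<^bsub>F\<^esub> x. J +>\<^bsub>F\<^esub> (c \<odot>\<^bsub>F\<^esub> y))"
      by (simp add: star_quotient_def)
    thus ?thesis by (rule trans) (intro UN_constant_eq[OF coset_self[OF that]] ballI *)
  qed
  have st: "star ?Q (J +>\<^bsub>F\<^esub> x) = J +>\<^bsub>F\<^esub> (star F x)" if "x \<in> carrier F" for x
  proof -
    have *: "J +>\<^bsub>F\<^esub> (star F y) = J +>\<^bsub>F\<^esub> (star F x)" if "y \<in> J +>\<^bsub>F\<^esub> x" for y
      using that \<open>x \<in> carrier F\<close> coset_carrier coset_h by (intro coset_eq star) (auto simp: h_star)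
    have "star ?Q (J +>\<^bsub>F\<^esub> x) = (\<Union>y\<in>J +>\<^bsub>F\<^esub> x. J +>\<^bsub>F\<^esub> (star F y))"
      by (simp add: star_quotient_def)
    thus ?thesis by (rule trans) (intro UN_constant_eq[OF coset_self[OF that]] ballI *)
  qed
  show "function_model ?Q X k"
  proof
    fix \<phi> show "\<exists>x\<in>carrier ?Q. \<forall>p\<in>X. k p x = \<phi> p"
    proof -
      obtain x where "x \<in> carrier F" "\<forall>p\<in>X. h p x = \<phi> p" using surj by blast
      thus ?thesis unfolding car using k by (intro bexI[of _ "J +>\<^bsub>F\<^esub> x"]) auto
    qed
  next
    fix x y assume "x \<in> carrier ?Q" "y \<in> carrier ?Q" "\<And>p. p \<in> X \<Longrightarrow> k p x = k p y"
    then obtain x' y' where xy: "x' \<in> carrier F" "y' \<in> carrier F" "x = J +>\<^bsub>F\<^esub> x'" "y = J +>\<^bsub>F\<^esub> y'"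
      unfolding car by blast
    hence "h p x' = h p y'" if "p \<in> X" for p
      using \<open>\<And>p. p \<in> X \<Longrightarrow> k p x = k p y\<close>[OF that] k that by simp
    thus "x = y" unfolding xy(3,4) by (rule coset_eq[OF xy(1,2)])
  qed (use fin in \<open>auto simp: car ops sm st k h_zero h_one h_add h_mult h_smult h_star smult star
      intro: m_closed a_closed smult star zero_closed one_closed\<close>)
qed

text \<open>Bound \<open>q (t k \<ominus> s m)\<close> through \<open>s k\<close> and let
  \<open>m\<close> tend to infinity. This produces approximations by constant sequences, that is, by
  images of elements of the uncompleted algebra.\<close>

lemma (in seminormed_star_alg) approx_tendsto:
  assumes s: "s \<in> C" and t: "\<And>k. t k \<in> carrier A" and lim: "(\<lambda>k. q (t k \<ominus> s k)) \<longlonglongrightarrow> 0"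
  shows "(\<lambda>k. cnorm Cp (cls (\<lambda>_. t k) \<ominus>\<^bsub>Cp\<^esub> cls s)) \<longlonglongrightarrow> 0"
proof (rule LIMSEQ_I)
  fix e :: real assume e: "e > 0"
  have sc: "s k \<in> carrier A" for k using s by (rule cauchy_carrier)
  obtain N1 where N1: "\<And>m n. m \<ge> N1 \<Longrightarrow> n \<ge> N1 \<Longrightarrow> q (s m \<ominus> s n) < e / 3"
    using cauchyD[OF s, of "e / 3"] e by auto
  obtain N2 where N2: "\<And>k. k \<ge> N2 \<Longrightarrow> \<bar>q (t k \<ominus> s k)\<bar> < e / 3"
    using LIMSEQ_D[OF lim, of "e / 3"] e by auto
  have "norm (cnorm Cp (cls (\<lambda>_. t k) \<ominus>\<^bsub>Cp\<^esub> cls s) - 0) < e" if k: "k \<ge> max N1 N2" for k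
  proof -
    have lim: "(\<lambda>m. q (t k \<ominus> s m)) \<longlonglongrightarrow> cnorm Cp (cls (\<lambda>_. t k) \<ominus>\<^bsub>Cp\<^esub> cls s)"
      using completion_minus[OF const_cauchy[OF t] s] completion_cnorm by metis
    have "q (t k \<ominus> s m) \<le> 2 * (e / 3)" if "m \<ge> N1" for m
      using q_triangle[OF t[of k] sc[of k] sc[of m]] N1[of k m] N2[of k] k that by simp
    hence "cnorm Cp (cls (\<lambda>_. t k) \<ominus>\<^bsub>Cp\<^esub> cls s) \<le> 2 * (e / 3)"
      by (intro LIMSEQ_le_const2[OF lim]) auto
    moreover have "0 \<le> cnorm Cp (cls (\<lambda>_. t k) \<ominus>\<^bsub>Cp\<^esub> cls s)"
      using t sc by (intro LIMSEQ_le_const[OF lim]) (auto intro!: q_nonneg)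
    ultimately show ?thesis using e by simp
  qed
  thus "\<exists>N. \<forall>k\<ge>N. norm (cnorm Cp (cls (\<lambda>_. t k) \<ominus>\<^bsub>Cp\<^esub> cls s) - 0) < e" by blast
qed

lemma (in seminormed_star_alg) q_finsum:
  assumes "finite S" "f \<in> S \<rightarrow> carrier A"
  shows "q (finsum A f S) \<le> (\<Sum>i\<in>S. q (f i))"
  using assms
proof induction
  case (insert i S)
  have "q (f i \<oplus> finsum A f S) \<le> q (f i) + q (finsum A f S)"
    using insert.prems by (intro q_add finsum_closed) auto
  also have "\<dots> \<le> q (f i) + (\<Sum>i\<in>S. q (f i))" using insert by simp
  finally show ?case using insert by (simp add: Pi_iff)
qed simp

lemma (in seminormed_star_alg) emb_ring_hom: "(\<lambda>x. cls (\<lambda>_. x)) \<in> ring_hom A Cp"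
  by (rule ring_hom_memI) (simp_all add: completion_simps const_cauchy cls_closed)

text \<open>The multiplicative function on words that takes the generator \<open>(i, j)\<close> to 1
  or 0 according to \<open>f i = j\<close>. These values are real, so the adjoint flag is
  ignored.\<close>

definition eval_word :: "('v \<Rightarrow> 'v) \<Rightarrow> (('v \<times> 'v) \<times> bool) list \<Rightarrow> complex" where
  "eval_word f w = of_bool (\<forall>p\<in>set w. f (fst (fst p)) = snd (fst p))"

lemma eval_word_simps [simp]:
  "eval_word f [] = 1" "eval_word f (v @ w) = eval_word f v * eval_word f w"
  "eval_word f (((i, j), b) # w) = of_bool (f i = j) * eval_word f w"
  "eval_word f (rev w) = eval_word f w" "eval_word f (map (apsnd g) w) = eval_word f w"
  "cnj (eval_word f w) = eval_word f w"
  by (auto simp: eval_word_def)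

section \<open>Graph automorphisms as characters of the universal algebra\<close>

locale moore_graph_algebra = moore_graph V E for V :: "'v set" and E
begin

sublocale magic_algebra V by unfold_locales (rule finite_vertices)

abbreviation "Aut \<equiv> graph_aut V E"

definition point_eval :: "('v \<Rightarrow> 'v) \<Rightarrow> ((('v \<times> 'v) \<times> bool) list \<Rightarrow> complex) \<Rightarrow> complex" where
  "point_eval f x = pairing (eval_word f) x"

lemma point_eval_simps:
  "point_eval f \<one>\<^bsub>F\<^esub> = 1" "point_eval f \<zero>\<^bsub>F\<^esub> = 0"
  "x \<in> carrier F \<Longrightarrow> y \<in> carrier F \<Longrightarrow> point_eval f (x \<oplus>\<^bsub>F\<^esub> y) = point_eval f x + point_eval f y"
  "x \<in> carrier F \<Longrightarrow> y \<in> carrier F \<Longrightarrow> point_eval f (x \<ominus>\<^bsub>F\<^esub> y) = point_eval f x - point_eval f y"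
  "x \<in> carrier F \<Longrightarrow> y \<in> carrier F \<Longrightarrow> point_eval f (x \<otimes>\<^bsub>F\<^esub> y) = point_eval f x * point_eval f y"
  "x \<in> carrier F \<Longrightarrow> point_eval f (c \<odot>\<^bsub>F\<^esub> x) = c * point_eval f x"
  "x \<in> carrier F \<Longrightarrow> point_eval f (star F x) = cnj (point_eval f x)"
proof -
  show "point_eval f (x \<otimes>\<^bsub>F\<^esub> y) = point_eval f x * point_eval f y" if "x \<in> carrier F" "y \<in> carrier F"
    unfolding point_eval_def using that by (intro pairing_mult_character) simp_all
qed (simp_all add: point_eval_def pairing_plus pairing_minus pairing_smult pairing_star pairing_zero pairing_one)

lemma point_eval_gen: "point_eval f (x\<^sub>V i j) = of_bool (f i = j)"
  by (simp add: point_eval_def free_gen_def)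

lemma point_eval_finsum:
  "finite S \<Longrightarrow> g \<in> S \<rightarrow> carrier F \<Longrightarrow> point_eval f (finsum F g S) = (\<Sum>k\<in>S. point_eval f (g k))"
  unfolding point_eval_def by (rule pairing_finsum)

lemma finite_Aut: "finite Aut"
  by (rule finite_subset[of _ "V \<rightarrow>\<^sub>E V"]) (auto simp: graph_aut_def intro: finite_PiE finite_vertices)

lemma Aut_bij: "f \<in> Aut \<Longrightarrow> bij_betw f V V"
  using endo_inj_surj[OF finite_vertices, of f] by (auto simp: graph_aut_def bij_betw_def PiE_iff)

lemma Aut_closed: "f \<in> Aut \<Longrightarrow> i \<in> V \<Longrightarrow> f i \<in> V"
  by (auto simp: graph_aut_def)

text \<open>The column sums are where surjectivity of automorphisms enters.\<close>

lemma Aut_count: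
  assumes "f \<in> Aut" "j \<in> V"
  shows "(\<Sum>i\<in>V. of_bool (f i = j)) = (1 :: complex)"
proof -
  have "(\<Sum>i\<in>V. of_bool (f i = j)) = (\<Sum>i\<in>V. of_bool (i = j) :: complex)"
    by (rule sum.reindex_bij_betw[OF Aut_bij[OF assms(1)]])
  thus ?thesis using assms finite_vertices by (simp add: of_bool_def)
qed

lemma point_eval_relation:
  assumes "r \<in> magic_relations V" and f: "f \<in> Aut"
  shows "point_eval f r = 0"
  using assms(1) unfolding magic_relations_def Let_def
proof (elim UnE CollectE exE conjE)
  fix i j assume "r = star F (x\<^sub>V i j) \<ominus>\<^bsub>F\<^esub> x\<^sub>V i j" "i \<in> V" "j \<in> V"
  thus ?thesis by (simp add: point_eval_simps point_eval_gen)
next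
  fix i j assume "r = (x\<^sub>V i j \<otimes>\<^bsub>F\<^esub> x\<^sub>V i j) \<ominus>\<^bsub>F\<^esub> x\<^sub>V i j" "i \<in> V" "j \<in> V"
  thus ?thesis by (simp add: point_eval_simps point_eval_gen)
next
  fix i j k assume "r = x\<^sub>V i j \<otimes>\<^bsub>F\<^esub> x\<^sub>V i k" "i \<in> V" "j \<in> V" "k \<in> V" "j \<noteq> k"
  thus ?thesis by (simp add: point_eval_simps point_eval_gen)
next
  fix i j k assume "r = x\<^sub>V i j \<otimes>\<^bsub>F\<^esub> x\<^sub>V k j" "i \<in> V" "j \<in> V" "k \<in> V" "i \<noteq> k"
  moreover from this have "\<not> (f i = j \<and> f k = j)" using f by (auto simp: graph_aut_def inj_on_def)
  ultimately show ?thesis by (auto simp: point_eval_simps point_eval_gen)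
next
  fix i assume r: "r = (\<Oplus>\<^bsub>F\<^esub>j\<in>V. x\<^sub>V i j) \<ominus>\<^bsub>F\<^esub> \<one>\<^bsub>F\<^esub>" "i \<in> V"
  hence "point_eval f r = (\<Sum>j\<in>V. of_bool (f i = j)) - 1"
    by (subst r(1), subst point_eval_simps)
      (auto simp: point_eval_finsum finite_V point_eval_gen point_eval_simps intro!: F.finsum_closed)
  thus ?thesis using r f Aut_closed finite_V by (simp add: of_bool_def)
next
  fix j assume r: "r = (\<Oplus>\<^bsub>F\<^esub>i\<in>V. x\<^sub>V i j) \<ominus>\<^bsub>F\<^esub> \<one>\<^bsub>F\<^esub>" "j \<in> V"
  hence "point_eval f r = (\<Sum>i\<in>V. of_bool (f i = j)) - 1"
    by (subst r(1), subst point_eval_simps)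
      (auto simp: point_eval_finsum finite_V point_eval_gen point_eval_simps intro!: F.finsum_closed)
  thus ?thesis using r f Aut_count by simp
qed

text \<open>The modulus of a character is a C*-seminorm. Being admissible, it is dominated by the
  universal norm, so the evaluation extends to the completion.\<close>

lemma point_eval_admissible: "f \<in> Aut \<Longrightarrow> (\<lambda>x. cmod (point_eval f x)) \<in> admissible"
  unfolding admissible_def cstar_seminorm_def
  by (simp add: point_eval_relation point_eval_simps norm_mult norm_triangle_ineq power2_eq_square)

lemma point_eval_character: "f \<in> Aut \<Longrightarrow> bounded_character F norm\<^sub>u (point_eval f)"
  by unfold_locales (auto simp: point_eval_simps intro!: norm\<^sub>u_upper[OF point_eval_admissible])

definition ev :: "('v \<Rightarrow> 'v) \<Rightarrow> ('v \<times> 'v) universal \<Rightarrow> complex" where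
  "ev f = bounded_character.ext (point_eval f)"

lemma ev_simps:
  assumes "f \<in> Aut"
  shows "ev f \<one>\<^bsub>U.Cp\<^esub> = 1" "ev f \<zero>\<^bsub>U.Cp\<^esub> = 0"
    "\<And>x y. x \<in> carrier U.Cp \<Longrightarrow> y \<in> carrier U.Cp \<Longrightarrow> ev f (x \<oplus>\<^bsub>U.Cp\<^esub> y) = ev f x + ev f y"
    "\<And>x y. x \<in> carrier U.Cp \<Longrightarrow> y \<in> carrier U.Cp \<Longrightarrow> ev f (x \<ominus>\<^bsub>U.Cp\<^esub> y) = ev f x - ev f y"
    "\<And>x y. x \<in> carrier U.Cp \<Longrightarrow> y \<in> carrier U.Cp \<Longrightarrow> ev f (x \<otimes>\<^bsub>U.Cp\<^esub> y) = ev f x * ev f y"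
    "\<And>x c. x \<in> carrier U.Cp \<Longrightarrow> ev f (c \<odot>\<^bsub>U.Cp\<^esub> x) = c * ev f x"
    "\<And>x. x \<in> carrier U.Cp \<Longrightarrow> ev f (star U.Cp x) = cnj (ev f x)"
    "\<And>x. x \<in> carrier U.Cp \<Longrightarrow> cmod (ev f x) \<le> cnorm U.Cp x"
    "\<And>x. x \<in> carrier F \<Longrightarrow> ev f (emb x) = point_eval f x"
proof -
  interpret bounded_character F "norm\<^sub>u" "point_eval f" using assms by (rule point_eval_character)
  show "ev f \<one>\<^bsub>U.Cp\<^esub> = 1" "ev f \<zero>\<^bsub>U.Cp\<^esub> = 0"
    "\<And>x y. x \<in> carrier U.Cp \<Longrightarrow> y \<in> carrier U.Cp \<Longrightarrow> ev f (x \<oplus>\<^bsub>U.Cp\<^esub> y) = ev f x + ev f y"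
    "\<And>x y. x \<in> carrier U.Cp \<Longrightarrow> y \<in> carrier U.Cp \<Longrightarrow> ev f (x \<ominus>\<^bsub>U.Cp\<^esub> y) = ev f x - ev f y"
    "\<And>x y. x \<in> carrier U.Cp \<Longrightarrow> y \<in> carrier U.Cp \<Longrightarrow> ev f (x \<otimes>\<^bsub>U.Cp\<^esub> y) = ev f x * ev f y"
    "\<And>x c. x \<in> carrier U.Cp \<Longrightarrow> ev f (c \<odot>\<^bsub>U.Cp\<^esub> x) = c * ev f x"
    "\<And>x. x \<in> carrier U.Cp \<Longrightarrow> ev f (star U.Cp x) = cnj (ev f x)"
    "\<And>x. x \<in> carrier U.Cp \<Longrightarrow> cmod (ev f x) \<le> cnorm U.Cp x"
    "\<And>x. x \<in> carrier F \<Longrightarrow> ev f (emb x) = point_eval f x"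
    unfolding ev_def
    by (simp_all only: ext_one ext_zero ext_add ext_minus ext_mult ext_smult ext_star ext_bound ext_const)
qed

lemma ev_lim:
  assumes "f \<in> Aut" "s \<in> U.C"
  shows "(\<lambda>k. point_eval f (s k)) \<longlonglongrightarrow> ev f (U.cls s)"
proof -
  interpret bounded_character F "norm\<^sub>u" "point_eval f" using assms(1) by (rule point_eval_character)
  show ?thesis unfolding ev_def using assms(2) by (rule ext_lim)
qed

text \<open>\<open>graph_relations\<close> lives in the completed algebra; these are lifts of its
  elements to the free algebra.\<close>

definition defect :: "'v \<Rightarrow> 'v \<Rightarrow> (('v \<times> 'v) \<times> bool) list \<Rightarrow> complex" where
  "defect i j = (\<Oplus>\<^bsub>F\<^esub>k\<in>V. adjacency_matrix E i k \<odot>\<^bsub>F\<^esub> x\<^sub>V k j) \<ominus>\<^bsub>F\<^esub>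
    (\<Oplus>\<^bsub>F\<^esub>k\<in>V. adjacency_matrix E k j \<odot>\<^bsub>F\<^esub> x\<^sub>V i k)"

lemma defect_closed: "i \<in> V \<Longrightarrow> j \<in> V \<Longrightarrow> defect i j \<in> carrier F"
  unfolding defect_def by (intro F.minus_closed F.finsum_closed) auto

lemma emb_closed: "x \<in> carrier F \<Longrightarrow> emb x \<in> carrier U.Cp"
  by (intro U.cls_closed U.const_cauchy)

lemma emb_minus: "x \<in> carrier F \<Longrightarrow> y \<in> carrier F \<Longrightarrow> emb (x \<ominus>\<^bsub>F\<^esub> y) = emb x \<ominus>\<^bsub>U.Cp\<^esub> emb y"
  by (simp add: U.completion_minus U.const_cauchy)

lemma emb_smult: "x \<in> carrier F \<Longrightarrow> emb (c \<odot>\<^bsub>F\<^esub> x) = c \<odot>\<^bsub>U.Cp\<^esub> emb x"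
  by (simp add: U.completion_smult U.const_cauchy)

lemma emb_finsum:
  "finite S \<Longrightarrow> g \<in> S \<rightarrow> carrier F \<Longrightarrow> emb (finsum F g S) = (\<Oplus>\<^bsub>U.Cp\<^esub>k\<in>S. emb (g k))"
  by (rule ring_hom_finsum[OF F.ring_axioms U.completion_ring U.emb_ring_hom])

lemma emb_weighted_sum:
  assumes y: "\<And>k. k \<in> V \<Longrightarrow> y k \<in> carrier F"
  shows "emb (\<Oplus>\<^bsub>F\<^esub>k\<in>V. c k \<odot>\<^bsub>F\<^esub> y k) = (\<Oplus>\<^bsub>U.Cp\<^esub>k\<in>V. c k \<odot>\<^bsub>U.Cp\<^esub> emb (y k))"
proof -
  have "emb (\<Oplus>\<^bsub>F\<^esub>k\<in>V. c k \<odot>\<^bsub>F\<^esub> y k) = (\<Oplus>\<^bsub>U.Cp\<^esub>k\<in>V. emb (c k \<odot>\<^bsub>F\<^esub> y k))"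
    by (rule emb_finsum) (use y finite_V in auto)
  also have "\<dots> = (\<Oplus>\<^bsub>U.Cp\<^esub>k\<in>V. c k \<odot>\<^bsub>U.Cp\<^esub> emb (y k))"
    by (rule U.Cp.finsum_cong'[OF refl]) (simp_all only: Pi_I y emb_smult emb_closed U.completion_smult_closed)
  finally show ?thesis .
qed

lemma graph_relations_eq: "graph_relations V E = {emb (defect i j) | i j. i \<in> V \<and> j \<in> V}"
proof -
  have key: "emb (defect i j) = (\<Oplus>\<^bsub>U.Cp\<^esub>k\<in>V. adjacency_matrix E i k \<odot>\<^bsub>U.Cp\<^esub> emb (x\<^sub>V k j)) \<ominus>\<^bsub>U.Cp\<^esub>
      (\<Oplus>\<^bsub>U.Cp\<^esub>k\<in>V. adjacency_matrix E k j \<odot>\<^bsub>U.Cp\<^esub> emb (x\<^sub>V i k))" if ij: "i \<in> V" "j \<in> V" for i j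
  proof -
    have "(\<Oplus>\<^bsub>F\<^esub>k\<in>V. adjacency_matrix E i k \<odot>\<^bsub>F\<^esub> x\<^sub>V k j) \<in> carrier F"
      "(\<Oplus>\<^bsub>F\<^esub>k\<in>V. adjacency_matrix E k j \<odot>\<^bsub>F\<^esub> x\<^sub>V i k) \<in> carrier F"
      using ij by (auto intro!: F.finsum_closed)
    thus ?thesis unfolding defect_def using ij by (simp only: emb_minus emb_weighted_sum x_closed)
  qed
  show ?thesis unfolding graph_relations_def Let_def perm_cstar_eq perm_gen_eq
    by (intro Collect_cong ex_cong1 rev_conj_cong refl) (simp only: key)
qed

text \<open>Both sums equal \<open>adjacency_matrix E (f i) j\<close>, the first after reindexing
  along the bijection \<open>f\<close>.\<close>

lemma point_eval_defect:
  assumes f: "f \<in> Aut" and ij: "i \<in> V" "j \<in> V"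
  shows "point_eval f (defect i j) = 0"
proof -
  have "point_eval f (defect i j) =
      (\<Sum>k\<in>V. adjacency_matrix E i k * of_bool (f k = j)) - (\<Sum>k\<in>V. adjacency_matrix E k j * of_bool (f i = k))"
    unfolding defect_def using ij
    by (subst point_eval_simps)
      (auto simp: point_eval_finsum finite_V point_eval_gen point_eval_simps intro!: F.finsum_closed)
  also have "(\<Sum>k\<in>V. adjacency_matrix E i k * of_bool (f k = j)) =
      (\<Sum>k\<in>V. adjacency_matrix E (f i) (f k) * of_bool (f k = j))"
    using f ij by (intro sum.cong) (auto simp: adjacency_matrix_def graph_aut_def)
  also have "\<dots> = (\<Sum>k\<in>V. adjacency_matrix E (f i) k * of_bool (k = j))"
    by (rule sum.reindex_bij_betw[OF Aut_bij[OF f]])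
  also have "\<dots> = adjacency_matrix E (f i) j" using ij finite_V by (simp add: of_bool_def if_distrib cong: if_cong)
  also have "(\<Sum>k\<in>V. adjacency_matrix E k j * of_bool (f i = k)) = adjacency_matrix E (f i) j"
    using ij f Aut_closed finite_V by (simp add: of_bool_def if_distrib cong: if_cong)
  finally show ?thesis by simp
qed

end

section \<open>The closed ideal of the graph relations as a common kernel\<close>

context moore_graph_algebra
begin

abbreviation "I \<equiv> graph_ideal V E"

abbreviation "ker_ev \<equiv> {x \<in> carrier U.Cp. \<forall>f\<in>Aut. ev f x = 0}"

lemma ev_uminus:
  assumes "f \<in> Aut" "x \<in> carrier U.Cp"
  shows "ev f (\<ominus>\<^bsub>U.Cp\<^esub> x) = - ev f x"
  using ev_simps(4)[OF assms(1) U.Cp.zero_closed assms(2)] assms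
  by (simp add: U.Cp.minus_eq ev_simps(2))

lemma ker_ev_ideal: "ideal ker_ev U.Cp"
proof (rule idealI[OF U.completion_ring])
  show "subgroup ker_ev (add_monoid U.Cp)"
    by (rule U.Cp.add.subgroupI)
      (auto simp: ev_simps ev_uminus a_inv_def[symmetric] intro!: exI[of _ "\<zero>\<^bsub>U.Cp\<^esub>"])
qed (auto simp: ev_simps)

text \<open>Each \<open>ev f\<close> is contractive and vanishes on \<open>s k\<close>, so
  \<open>cmod (ev f x)\<close> is at most the distance from \<open>s k\<close> to
  \<open>x\<close>.\<close>

lemma ker_ev_closed: "norm_closed U.Cp ker_ev"
  unfolding norm_closed_def
proof (intro allI impI, elim conjE)
  fix s x
  assume s: "\<forall>k. s k \<in> ker_ev" and x: "x \<in> carrier U.Cp"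
    and lim: "(\<lambda>k. cnorm U.Cp (s (k::nat) \<ominus>\<^bsub>U.Cp\<^esub> x)) \<longlonglongrightarrow> 0"
  have "ev f x = 0" if f: "f \<in> Aut" for f
  proof -
    have "cmod (ev f x) \<le> cnorm U.Cp (s k \<ominus>\<^bsub>U.Cp\<^esub> x)" for k
      using ev_simps(8)[OF f, of "s k \<ominus>\<^bsub>U.Cp\<^esub> x"] s x f by (simp add: ev_simps(4))
    hence "cmod (ev f x) \<le> 0" by (intro LIMSEQ_le_const[OF lim]) auto
    thus ?thesis by simp
  qed
  thus "x \<in> ker_ev" using x by simp
qed

lemma graph_relations_ker: "graph_relations V E \<subseteq> ker_ev"
  by (auto simp: graph_relations_eq emb_closed defect_closed ev_simps point_eval_defect)

lemma I_eq: "I = \<Inter>{I. ideal I U.Cp \<and> norm_closed U.Cp I \<and> graph_relations V E \<subseteq> I}"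
  by (simp only: graph_ideal_def closed_ideal_gen_def perm_cstar_eq)

lemma I_subset_ker: "I \<subseteq> ker_ev"
  unfolding I_eq using ker_ev_ideal ker_ev_closed graph_relations_ker by blast

lemma I_ideal: "ideal I U.Cp"
  unfolding I_eq using ker_ev_ideal ker_ev_closed graph_relations_ker
  by (intro U.Cp.i_Intersect) blast+

lemma I_relations: "graph_relations V E \<subseteq> I"
  unfolding I_eq by blast

lemma I_closed:
  assumes "\<And>k. s k \<in> I" "(\<lambda>k. cnorm U.Cp (s (k::nat) \<ominus>\<^bsub>U.Cp\<^esub> x)) \<longlonglongrightarrow> 0" "x \<in> carrier U.Cp"
  shows "x \<in> I"
  unfolding I_eq
proof (intro InterI, elim CollectE conjE)
  fix K assume K: "ideal K U.Cp" "norm_closed U.Cp K" "graph_relations V E \<subseteq> K"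
  hence "s k \<in> K" for k using assms(1)[of k] unfolding I_eq by blast
  thus "x \<in> K" using K(2) assms(2,3) unfolding norm_closed_def by blast
qed

text \<open>Induction over words is available only in the free algebra, so the ideal is pulled back
  and the algebraic argument takes place in the quotient there.\<close>

definition pre_ideal :: "((('v \<times> 'v) \<times> bool) list \<Rightarrow> complex) set" where
  "pre_ideal = {x \<in> carrier F. emb x \<in> I}"

lemma pre_ideal: "ideal pre_ideal F"
proof -
  interpret ring_hom_ring F U.Cp "\<lambda>x. emb x"
    by (intro ring_hom_ringI2 F.ring_axioms U.completion_ring U.emb_ring_hom)
  show ?thesis unfolding pre_ideal_def by (rule ideal_vimage[OF I_ideal])
qed

text \<open>The magic relations have universal norm zero and so vanish already in the
  completion.\<close>

lemma magic_relations_pre_ideal: "r \<in> magic_relations V \<Longrightarrow> r \<in> pre_ideal"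
proof -
  assume r: "r \<in> magic_relations V"
  hence rF: "r \<in> carrier F" using magic_relations_carrier by blast
  have "emb r = emb \<zero>\<^bsub>F\<^esub>"
    using norm\<^sub>u_relation[OF r rF] rF
    by (subst U.cls_eq_iff) (simp_all add: U.const_cauchy F.minus_eq)
  hence "emb r = \<zero>\<^bsub>U.Cp\<^esub>" by (simp only: U.completion_zero)
  thus ?thesis using rF additive_subgroup.zero_closed[OF ideal.axioms(1)[OF I_ideal]]
    by (simp add: pre_ideal_def)
qed

lemma defect_pre_ideal: "i \<in> V \<Longrightarrow> j \<in> V \<Longrightarrow> defect i j \<in> pre_ideal"
  using I_relations defect_closed by (auto simp: pre_ideal_def graph_relations_eq)

abbreviation "R \<equiv> F Quot pre_ideal"

abbreviation "cl x \<equiv> pre_ideal +>\<^bsub>F\<^esub> x"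

lemma cl_hom: "(\<lambda>x. cl x) \<in> ring_hom F R"
  using ideal.rcos_ring_hom[OF pre_ideal] .

lemma R_ring: "ring R"
  using ideal.quotient_is_ring[OF pre_ideal] .

lemmas cl_eq_iff = F.coset_eq_iff[OF pre_ideal]

lemmas cl_smult_cong = F.coset_smult_cong[OF pre_ideal]

lemma cl_simps:
  "x \<in> carrier F \<Longrightarrow> cl x \<in> carrier R"
  "x \<in> carrier F \<Longrightarrow> y \<in> carrier F \<Longrightarrow> cl (x \<oplus>\<^bsub>F\<^esub> y) = cl x \<oplus>\<^bsub>R\<^esub> cl y"
  "x \<in> carrier F \<Longrightarrow> y \<in> carrier F \<Longrightarrow> cl (x \<otimes>\<^bsub>F\<^esub> y) = cl x \<otimes>\<^bsub>R\<^esub> cl y"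
  "cl \<one>\<^bsub>F\<^esub> = \<one>\<^bsub>R\<^esub>" "cl \<zero>\<^bsub>F\<^esub> = \<zero>\<^bsub>R\<^esub>"
  by (rule ring_hom_closed[OF cl_hom] ring_hom_add[OF cl_hom] ring_hom_mult[OF cl_hom]
    ring_hom_one[OF cl_hom] ring_hom_zero[OF cl_hom F.ring_axioms R_ring]; assumption)+

lemma cl_zero_iff: "x \<in> carrier F \<Longrightarrow> cl x = \<zero>\<^bsub>R\<^esub> \<longleftrightarrow> x \<in> pre_ideal"
  using cl_eq_iff[of x "\<zero>\<^bsub>F\<^esub>"] by (simp add: cl_simps F.minus_eq)

lemma cl_finsum:
  "finite S \<Longrightarrow> g \<in> S \<rightarrow> carrier F \<Longrightarrow> cl (finsum F g S) = (\<Oplus>\<^bsub>R\<^esub>k\<in>S. cl (g k))"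
  by (rule ring_hom_finsum[OF F.ring_axioms R_ring cl_hom])

lemma magic_relation_intros:
  "i \<in> V \<Longrightarrow> j \<in> V \<Longrightarrow> star F (x\<^sub>V i j) \<ominus>\<^bsub>F\<^esub> x\<^sub>V i j \<in> magic_relations V"
  "i \<in> V \<Longrightarrow> j \<in> V \<Longrightarrow> (x\<^sub>V i j \<otimes>\<^bsub>F\<^esub> x\<^sub>V i j) \<ominus>\<^bsub>F\<^esub> x\<^sub>V i j \<in> magic_relations V"
  "i \<in> V \<Longrightarrow> j \<in> V \<Longrightarrow> k \<in> V \<Longrightarrow> j \<noteq> k \<Longrightarrow> x\<^sub>V i j \<otimes>\<^bsub>F\<^esub> x\<^sub>V i k \<in> magic_relations V"
  "i \<in> V \<Longrightarrow> j \<in> V \<Longrightarrow> k \<in> V \<Longrightarrow> i \<noteq> k \<Longrightarrow> x\<^sub>V i j \<otimes>\<^bsub>F\<^esub> x\<^sub>V k j \<in> magic_relations V"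
  "i \<in> V \<Longrightarrow> (\<Oplus>\<^bsub>F\<^esub>j\<in>V. x\<^sub>V i j) \<ominus>\<^bsub>F\<^esub> \<one>\<^bsub>F\<^esub> \<in> magic_relations V"
  unfolding magic_relations_def Let_def by blast+

lemma cl_star_gen: "i \<in> V \<Longrightarrow> j \<in> V \<Longrightarrow> cl (star F (x\<^sub>V i j)) = cl (x\<^sub>V i j)"
  by (subst cl_eq_iff) (simp_all add: magic_relations_pre_ideal magic_relation_intros)

sublocale R: magic_graph_ring V E R "\<lambda>i j. cl (x\<^sub>V i j)"
proof (intro magic_graph_ring.intro magic_graph_ring_axioms.intro R_ring moore_graph_axioms)
  fix i j assume ij: "i \<in> V" "j \<in> V"
  show "cl (x\<^sub>V i j) \<in> carrier R" using ij by (simp add: cl_simps)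
  have "cl (x\<^sub>V i j \<otimes>\<^bsub>F\<^esub> x\<^sub>V i j) = cl (x\<^sub>V i j)"
    using ij by (subst cl_eq_iff) (simp_all add: magic_relations_pre_ideal magic_relation_intros)
  thus "cl (x\<^sub>V i j) \<otimes>\<^bsub>R\<^esub> cl (x\<^sub>V i j) = cl (x\<^sub>V i j)" using ij by (simp add: cl_simps)
  have cm: "cl (adjacency_matrix E k l \<odot>\<^bsub>F\<^esub> x\<^sub>V m n) = (if E k l then cl (x\<^sub>V m n) else \<zero>\<^bsub>R\<^esub>)"
    if "m \<in> V" "n \<in> V" for k l m n
    using that by (simp add: adjacency_matrix_def cl_simps)
  let ?s = "\<Oplus>\<^bsub>F\<^esub>k\<in>V. adjacency_matrix E i k \<odot>\<^bsub>F\<^esub> x\<^sub>V k j"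
    and ?t = "\<Oplus>\<^bsub>F\<^esub>k\<in>V. adjacency_matrix E k j \<odot>\<^bsub>F\<^esub> x\<^sub>V i k"
  have st: "?s \<in> carrier F" "?t \<in> carrier F" using ij by (auto intro!: F.finsum_closed)
  have "cl ?s = cl ?t"
    using defect_pre_ideal[OF ij] st by (subst cl_eq_iff) (simp_all only: defect_def)
  moreover have "cl ?s = (\<Oplus>\<^bsub>R\<^esub>k\<in>V. cl (adjacency_matrix E i k \<odot>\<^bsub>F\<^esub> x\<^sub>V k j))"
    by (rule cl_finsum) (use ij finite_V in auto)
  moreover have "\<dots> = (\<Oplus>\<^bsub>R\<^esub>k\<in>V. if E i k then cl (x\<^sub>V k j) else \<zero>\<^bsub>R\<^esub>)"
    by (rule abelian_monoid.finsum_cong')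
      (use ij in \<open>auto simp: cm cl_simps ring.ring_simprules(2)[OF R_ring]
        intro: abelian_group.axioms(1) ring.axioms(1) R_ring\<close>)
  moreover have "cl ?t = (\<Oplus>\<^bsub>R\<^esub>k\<in>V. cl (adjacency_matrix E k j \<odot>\<^bsub>F\<^esub> x\<^sub>V i k))"
    by (rule cl_finsum) (use ij finite_V in auto)
  moreover have "\<dots> = (\<Oplus>\<^bsub>R\<^esub>k\<in>V. if E k j then cl (x\<^sub>V i k) else \<zero>\<^bsub>R\<^esub>)"
    by (rule abelian_monoid.finsum_cong')
      (use ij in \<open>auto simp: cm cl_simps ring.ring_simprules(2)[OF R_ring]
        intro: abelian_group.axioms(1) ring.axioms(1) R_ring\<close>)
  ultimately show "(\<Oplus>\<^bsub>R\<^esub>k\<in>V. if E i k then cl (x\<^sub>V k j) else \<zero>\<^bsub>R\<^esub>) =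
      (\<Oplus>\<^bsub>R\<^esub>k\<in>V. if E k j then cl (x\<^sub>V i k) else \<zero>\<^bsub>R\<^esub>)" by (simp only:)
next
  fix i j k assume V: "i \<in> V" "j \<in> V" "k \<in> V"
  show "cl (x\<^sub>V i j) \<otimes>\<^bsub>R\<^esub> cl (x\<^sub>V i k) = \<zero>\<^bsub>R\<^esub>" if "j \<noteq> k"
  proof -
    have "cl (x\<^sub>V i j \<otimes>\<^bsub>F\<^esub> x\<^sub>V i k) = \<zero>\<^bsub>R\<^esub>"
      using V that by (subst cl_zero_iff) (simp_all add: magic_relations_pre_ideal magic_relation_intros)
    thus ?thesis using V by (simp add: cl_simps)
  qed
  show "cl (x\<^sub>V i j) \<otimes>\<^bsub>R\<^esub> cl (x\<^sub>V k j) = \<zero>\<^bsub>R\<^esub>" if "i \<noteq> k"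
  proof -
    have "cl (x\<^sub>V i j \<otimes>\<^bsub>F\<^esub> x\<^sub>V k j) = \<zero>\<^bsub>R\<^esub>"
      using V that by (subst cl_zero_iff) (simp_all add: magic_relations_pre_ideal magic_relation_intros)
    thus ?thesis using V by (simp add: cl_simps)
  qed
next
  fix i assume i: "i \<in> V"
  have "(\<Oplus>\<^bsub>F\<^esub>j\<in>V. x\<^sub>V i j) \<in> carrier F" using i by (auto intro!: F.finsum_closed)
  hence "cl (\<Oplus>\<^bsub>F\<^esub>j\<in>V. x\<^sub>V i j) = cl \<one>\<^bsub>F\<^esub>"
    using i by (subst cl_eq_iff) (simp_all add: magic_relations_pre_ideal magic_relation_intros)
  moreover have "cl (\<Oplus>\<^bsub>F\<^esub>j\<in>V. x\<^sub>V i j) = (\<Oplus>\<^bsub>R\<^esub>j\<in>V. cl (x\<^sub>V i j))"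
    by (rule cl_finsum) (use i finite_V in auto)
  ultimately show "(\<Oplus>\<^bsub>R\<^esub>j\<in>V. cl (x\<^sub>V i j)) = \<one>\<^bsub>R\<^esub>" by (simp only: cl_simps)
qed

text \<open>The word along the graph of the function \<open>f\<close>, that is, along the pairs
  \<open>(i, f i)\<close>; it lifts \<open>path_prod\<close> to the free algebra.\<close>

definition graph_word :: "'v list \<Rightarrow> ('v \<Rightarrow> 'v) \<Rightarrow> (('v \<times> 'v) \<times> bool) list" where
  "graph_word vs f = map (\<lambda>i. ((i, f i), False)) vs"

lemma graph_word_carrier: "set vs \<subseteq> V \<Longrightarrow> f \<in> V \<rightarrow> V \<Longrightarrow> graph_word vs f \<in> lists ((V \<times> V) \<times> UNIV)"
  by (auto simp: graph_word_def Pi_iff subset_iff)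

lemma cl_graph_word:
  assumes "set vs \<subseteq> V" "f \<in> V \<rightarrow> V"
  shows "cl (monoid_point (graph_word vs f)) = R.path_prod vs f"
  using assms(1)
proof (induction vs)
  case Nil
  show ?case using one_eq_point by (simp add: graph_word_def flip: cl_simps(4))
next
  case (Cons i vs)
  have "monoid_point (graph_word (i # vs) f) = x\<^sub>V i (f i) \<otimes>\<^bsub>F\<^esub> monoid_point (graph_word vs f)"
    unfolding free_gen_def using Cons.prems assms(2) graph_word_carrier[of vs f]
    by (subst point_mult) (auto simp: graph_word_def Pi_iff)
  thus ?case using Cons assms(2) graph_word_carrier[of vs f]
    by (auto simp: cl_simps Pi_iff)
qed

lemma cl_letter:
  assumes "p \<in> V \<times> V"
  shows "cl (monoid_point [(p, b)]) = cl (x\<^sub>V (fst p) (snd p))"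
proof (cases b)
  case True
  have "star F (x\<^sub>V (fst p) (snd p)) = monoid_point [(p, b)]"
    unfolding free_gen_def by (subst star_point) (use assms True in auto)
  thus ?thesis using cl_star_gen[of "fst p" "snd p"] assms by auto
qed (simp add: free_gen_def)

text \<open>Modulo the relations, \<open>monoid_point (graph_word vs f)\<close> is the minimal projection of the point \<open>f\<close>.\<close>

lemma cl_graph_word_mult:
  assumes vs: "set vs = V" and f: "f \<in> V \<rightarrow> V" and x: "x \<in> carrier F"
  defines "p \<equiv> monoid_point (graph_word vs f)"
  shows "cl (p \<otimes>\<^bsub>F\<^esub> x) = cl (point_eval f x \<odot>\<^bsub>F\<^esub> p)"
proof -
  have p [simp]: "p \<in> carrier F"
    unfolding p_def using graph_word_carrier[of vs f] vs f by (intro point_closed) simp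
  show ?thesis using x
  proof (induction x rule: carrier_induct)
    case zero
    show ?case by (simp add: point_eval_simps)
  next
    case (add x y)
    have "cl (p \<otimes>\<^bsub>F\<^esub> (x \<oplus>\<^bsub>F\<^esub> y)) = cl (p \<otimes>\<^bsub>F\<^esub> x) \<oplus>\<^bsub>R\<^esub> cl (p \<otimes>\<^bsub>F\<^esub> y)"
      using add.hyps by (simp add: F.r_distr cl_simps)
    also have "\<dots> = cl (point_eval f (x \<oplus>\<^bsub>F\<^esub> y) \<odot>\<^bsub>F\<^esub> p)"
      using add by (simp only: point_eval_simps F.add_smult p cl_simps F.smult_closed)
    finally show ?case .
  next
    case (smult c x)
    have "cl (p \<otimes>\<^bsub>F\<^esub> (c \<odot>\<^bsub>F\<^esub> x)) = cl (c \<odot>\<^bsub>F\<^esub> (p \<otimes>\<^bsub>F\<^esub> x))"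
      using smult.hyps by (simp only: F.mult_smult p)
    also have "\<dots> = cl (c \<odot>\<^bsub>F\<^esub> (point_eval f x \<odot>\<^bsub>F\<^esub> p))"
      using smult by (intro cl_smult_cong) simp_all
    also have "\<dots> = cl (point_eval f (c \<odot>\<^bsub>F\<^esub> x) \<odot>\<^bsub>F\<^esub> p)"
      using smult.hyps by (simp only: point_eval_simps F.smult_smult p)
    finally show ?case .
  next
    case (point w)
    hence w: "w \<in> lists ((V \<times> V) \<times> UNIV)" by simp
    thus ?case
    \<comment> \<open>Letters are split off at the right, because \<open>p\<close> stands at the
      left and has to pass through the earlier letters before it meets the last one.\<close>
    proof (induction w rule: rev_induct)
      case Nil
      have "monoid_point [] = \<one>\<^bsub>F\<^esub>" using one_eq_point by simp
      thus ?case by (simp add: point_eval_simps)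
    next
      case (snoc q w)
      obtain k l b where q: "q = ((k, l), b)" "k \<in> V" "l \<in> V" using snoc.prems by (cases q) auto
      have wF [simp]: "monoid_point w \<in> carrier F" using snoc.prems by (intro point_closed) auto
      have qF [simp]: "monoid_point [q] \<in> carrier F" using snoc.prems by (intro point_closed) auto
      have wq: "monoid_point (w @ [q]) = monoid_point w \<otimes>\<^bsub>F\<^esub> monoid_point [q]"
        using snoc.prems by (subst point_mult) auto
      have ev: "point_eval f (monoid_point [q]) = of_bool (f k = l)"
        by (simp add: point_eval_def q)
      have pq: "cl (p \<otimes>\<^bsub>F\<^esub> monoid_point [q]) = cl (of_bool (f k = l) \<odot>\<^bsub>F\<^esub> p)"
      proof -
        have "cl (p \<otimes>\<^bsub>F\<^esub> monoid_point [q]) = R.path_prod vs f \<otimes>\<^bsub>R\<^esub> cl (x\<^sub>V k l)"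
          using cl_letter[of "(k, l)" b] cl_graph_word[of vs f] vs f q
          by (simp add: cl_simps) (simp add: p_def)
        also have "\<dots> = cl (of_bool (f k = l) \<odot>\<^bsub>F\<^esub> p)"
          using R.path_prod_mult[OF vs f q(2,3)] cl_graph_word[of vs f] vs f
          by (auto simp: cl_simps) (simp_all add: p_def)
        finally show ?thesis .
      qed
      let ?c = "point_eval f (monoid_point w)"
      have "cl (p \<otimes>\<^bsub>F\<^esub> monoid_point (w @ [q])) = cl (p \<otimes>\<^bsub>F\<^esub> monoid_point w) \<otimes>\<^bsub>R\<^esub> cl (monoid_point [q])"
        unfolding wq by (simp add: cl_simps flip: F.m_assoc)
      also have "cl (p \<otimes>\<^bsub>F\<^esub> monoid_point w) = cl (?c \<odot>\<^bsub>F\<^esub> p)"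
        using snoc by simp
      also have "cl (?c \<odot>\<^bsub>F\<^esub> p) \<otimes>\<^bsub>R\<^esub> cl (monoid_point [q]) = cl (?c \<odot>\<^bsub>F\<^esub> (p \<otimes>\<^bsub>F\<^esub> monoid_point [q]))"
        by (simp add: F.smult_mult flip: cl_simps)
      also have "\<dots> = cl (?c \<odot>\<^bsub>F\<^esub> (of_bool (f k = l) \<odot>\<^bsub>F\<^esub> p))"
        by (intro cl_smult_cong pq) simp_all
      also have "\<dots> = cl (point_eval f (monoid_point (w @ [q])) \<odot>\<^bsub>F\<^esub> p)"
        unfolding wq by (simp add: point_eval_simps ev F.smult_smult)
      finally show ?case .
    qed
  qed
qed

text \<open>A Nullstellensatz for the dense subalgebra: multiplying \<open>x\<close> by the minimal
  projection of \<open>f\<close> gives its value at \<open>f\<close> times that projection, which is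
  zero for every automorphism.\<close>

lemma emb_in_ideal:
  assumes x: "x \<in> carrier F" and zero: "\<And>f. f \<in> Aut \<Longrightarrow> point_eval f x = 0"
  shows "emb x \<in> I"
proof -
  obtain vs where vs: "set vs = V" "distinct vs" using finite_distinct_list[OF finite_V] by blast
  have "cl x = \<zero>\<^bsub>R\<^esub>"
  proof (rule R.zero_by_automorphisms[OF _ vs])
    fix f assume f: "f \<in> Aut"
    hence fV: "f \<in> V \<rightarrow> V" by (auto simp: graph_aut_def)
    have p: "monoid_point (graph_word vs f) \<in> carrier F"
      using graph_word_carrier[of vs f] vs fV by (intro point_closed) simp
    have "R.path_prod vs f \<otimes>\<^bsub>R\<^esub> cl x = cl (monoid_point (graph_word vs f) \<otimes>\<^bsub>F\<^esub> x)"
      using cl_graph_word[of vs f] vs fV p x by (simp add: cl_simps)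
    thus "R.path_prod vs f \<otimes>\<^bsub>R\<^esub> cl x = \<zero>\<^bsub>R\<^esub>"
      using cl_graph_word_mult[OF vs(1) fV x] zero[OF f] p by (simp add: cl_simps)
  qed (use x in \<open>simp add: cl_simps\<close>)
  thus ?thesis using x by (simp add: cl_zero_iff) (simp add: pre_ideal_def)
qed

text \<open>Lagrange interpolation: the word along \<open>f\<close> has the value 1 at
  \<open>f\<close> and 0 at all other automorphisms. Words have norm at most 1, hence the norm bound
  below. The list of vertices may contain repetitions, since the values 0 and 1 are
  idempotent.\<close>

definition interpolate :: "(('v \<Rightarrow> 'v) \<Rightarrow> complex) \<Rightarrow> (('v \<times> 'v) \<times> bool) list \<Rightarrow> complex" where
  "interpolate \<phi> = (\<Oplus>\<^bsub>F\<^esub>f\<in>Aut. \<phi> f \<odot>\<^bsub>F\<^esub>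
    monoid_point (graph_word (SOME vs. set vs = V) f))"

lemma interpolate:
  shows "interpolate \<phi> \<in> carrier F"
    and "f \<in> Aut \<Longrightarrow> point_eval f (interpolate \<phi>) = \<phi> f"
    and "norm\<^sub>u (interpolate \<phi>) \<le> (\<Sum>f\<in>Aut. cmod (\<phi> f))"
proof -
  let ?vs = "SOME vs. set vs = V"
  have vs: "set ?vs = V" using finite_list[OF finite_V] by (rule someI_ex)
  have w: "graph_word ?vs f \<in> lists ((V \<times> V) \<times> UNIV)" if "f \<in> Aut" for f
    using that vs by (intro graph_word_carrier) (auto simp: graph_aut_def)
  hence p: "monoid_point (graph_word ?vs f) \<in> carrier F" if "f \<in> Aut" for f
    using that by (intro point_closed) simp
  show "interpolate \<phi> \<in> carrier F"
    unfolding interpolate_def using p by (intro F.finsum_closed) auto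
  show "point_eval f (interpolate \<phi>) = \<phi> f" if f: "f \<in> Aut"
  proof -
    have "point_eval f (monoid_point (graph_word ?vs g)) = of_bool (g = f)" if g: "g \<in> Aut" for g
    proof -
      have "g \<in> V \<rightarrow>\<^sub>E V" "f \<in> V \<rightarrow>\<^sub>E V" using f g by (auto simp: graph_aut_def)
      hence "(\<forall>i\<in>V. f i = g i) \<longleftrightarrow> g = f" using PiE_ext[of g V "\<lambda>_. V" f] by metis
      thus ?thesis by (simp add: point_eval_def eval_word_def graph_word_def vs)
    qed
    hence "(\<Sum>g\<in>Aut. \<phi> g * point_eval f (monoid_point (graph_word ?vs g))) =
        (\<Sum>g\<in>Aut. \<phi> g * of_bool (g = f))" by (intro sum.cong) simp_all
    also have "\<dots> = \<phi> f" using finite_Aut f by (simp add: of_bool_def if_distrib cong: if_cong)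
    finally show ?thesis unfolding interpolate_def using p finite_Aut
      by (subst point_eval_finsum) (auto simp: point_eval_simps)
  qed
  have "norm\<^sub>u (interpolate \<phi>) \<le> (\<Sum>f\<in>Aut. norm\<^sub>u (\<phi> f \<odot>\<^bsub>F\<^esub> monoid_point (graph_word ?vs f)))"
    unfolding interpolate_def using p finite_Aut by (intro U.q_finsum) auto
  also have "\<dots> \<le> (\<Sum>f\<in>Aut. cmod (\<phi> f))"
  proof (rule sum_mono)
    fix f assume f: "f \<in> Aut"
    have "norm\<^sub>u (monoid_point (graph_word ?vs f)) \<le> 1"
      using admissible_point[OF _ w[OF f]] by (rule norm\<^sub>u_least)
    thus "norm\<^sub>u (\<phi> f \<odot>\<^bsub>F\<^esub> monoid_point (graph_word ?vs f)) \<le> cmod (\<phi> f)"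
      using p[OF f] by (simp add: U.q_smult mult_left_le)
  qed
  finally show "norm\<^sub>u (interpolate \<phi>) \<le> (\<Sum>f\<in>Aut. cmod (\<phi> f))" .
qed

text \<open>The elements \<open>interpolate \<phi>\<close> span a finite-dimensional complement of the ideal, so the
  statement passes from the dense subalgebra to its completion.\<close>

lemma ker_subset_I: "ker_ev \<subseteq> I"
proof
  fix X assume X: "X \<in> ker_ev"
  then obtain s where s: "s \<in> U.C" "X = U.cls s" by (auto elim: U.carrier_cls)
  have sF: "s k \<in> carrier F" for k using s(1) by (rule U.cauchy_carrier)
  \<comment> \<open>\<open>d k\<close> has the same values as \<open>s k\<close>, so the difference
    lies in the ideal. These values tend to those of \<open>X\<close>, which are zero, so
    \<open>d k\<close> tends to zero in norm and the differences still approximate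
    \<open>X\<close>.\<close>
  define d where "d k = interpolate (\<lambda>f. point_eval f (s k))" for k
  have dF: "d k \<in> carrier F" for k unfolding d_def by (rule interpolate)
  have "emb (s k \<ominus>\<^bsub>F\<^esub> d k) \<in> I" for k
    using sF dF by (intro emb_in_ideal) (simp_all add: point_eval_simps, simp add: d_def interpolate)
  moreover have "(\<lambda>k. cnorm U.Cp (emb (s k \<ominus>\<^bsub>F\<^esub> d k) \<ominus>\<^bsub>U.Cp\<^esub> X)) \<longlonglongrightarrow> 0"
    unfolding s(2)
  proof (rule U.approx_tendsto[OF s(1)])
    show "s k \<ominus>\<^bsub>F\<^esub> d k \<in> carrier F" for k using sF dF by simp
    have "(\<lambda>k. point_eval f (s k)) \<longlonglongrightarrow> 0" if "f \<in> Aut" for f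
      using ev_lim[OF that s(1)] X that s(2) by simp
    hence lim: "(\<lambda>k. \<Sum>f\<in>Aut. cmod (point_eval f (s k))) \<longlonglongrightarrow> 0"
      by (intro tendsto_null_sum tendsto_norm_zero)
    have "norm\<^sub>u ((s k \<ominus>\<^bsub>F\<^esub> d k) \<ominus>\<^bsub>F\<^esub> s k) = norm\<^sub>u (d k)" for k
    proof -
      have "(s k \<ominus>\<^bsub>F\<^esub> d k) \<ominus>\<^bsub>F\<^esub> s k = \<ominus>\<^bsub>F\<^esub> d k"
        using sF dF by (rule F.minus_minus_self)
      thus ?thesis using dF by (simp add: U.q_uminus)
    qed
    moreover have "norm\<^sub>u (d k) \<le> (\<Sum>f\<in>Aut. cmod (point_eval f (s k)))" for k
      unfolding d_def by (rule interpolate)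
    ultimately show "(\<lambda>k. norm\<^sub>u ((s k \<ominus>\<^bsub>F\<^esub> d k) \<ominus>\<^bsub>F\<^esub> s k)) \<longlonglongrightarrow> 0"
      using dF by (intro Lim_null_comparison[OF _ lim]) (simp add: U.q_nonneg)
  qed
  moreover have "X \<in> carrier U.Cp" using X by simp
  ultimately show "X \<in> I" by (rule I_closed)
qed

lemma I_eq_ker: "I = ker_ev"
  using I_subset_ker ker_subset_I by blast

definition aut_eval :: "('v \<Rightarrow> 'v) \<Rightarrow> ('v \<times> 'v) universal set \<Rightarrow> complex" where
  "aut_eval = (\<lambda>f Y. ev f (SOME x. x \<in> Y))"

lemma quotient_model:
  "function_model (star_quotient U.Cp I) Aut aut_eval"
  "f \<in> Aut \<Longrightarrow> x \<in> carrier U.Cp \<Longrightarrow> aut_eval f (I +>\<^bsub>U.Cp\<^esub> x) = ev f x"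
proof -
  have surj: "\<exists>x\<in>carrier U.Cp. \<forall>f\<in>Aut. ev f x = \<phi> f" for \<phi>
    using interpolate[where \<phi> = \<phi>] by (intro bexI[of _ "emb (interpolate \<phi>)"]) (auto simp: ev_simps emb_closed)
  note * = star_quotient_model[where h = ev, OF I_ideal finite_Aut U.completion_smult_closed
      U.completion_star_closed ev_simps(2,1,3,5,6,7) I_eq_ker surj]
  show "function_model (star_quotient U.Cp I) Aut aut_eval"
    "f \<in> Aut \<Longrightarrow> x \<in> carrier U.Cp \<Longrightarrow> aut_eval f (I +>\<^bsub>U.Cp\<^esub> x) = ev f x"
    unfolding aut_eval_def by (rule *(1); assumption) (rule *(2); assumption)
qed

end

section \<open>Tensor products of function algebras\<close>

context function_model
begin

text \<open>The inserted 0 gives \<open>Max\<close> a value when there are no points.\<close>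

definition sup_norm :: "'b \<Rightarrow> real" where
  "sup_norm x = Max (insert 0 ((\<lambda>p. cmod (h p x)) ` X))"

lemma sup_norm_le: "0 \<le> K \<Longrightarrow> (\<And>p. p \<in> X \<Longrightarrow> cmod (h p x) \<le> K) \<Longrightarrow> sup_norm x \<le> K"
  unfolding sup_norm_def using finite_points by (subst Max_le_iff) auto

lemma sup_norm_ge: "p \<in> X \<Longrightarrow> cmod (h p x) \<le> sup_norm x"
  unfolding sup_norm_def using finite_points by (intro Max_ge) auto

lemma sup_norm_nonneg: "0 \<le> sup_norm x"
  unfolding sup_norm_def using finite_points by (intro Max_ge) auto

lemma sup_norm: "cstar_norm B sup_norm"
  unfolding cstar_norm_def cstar_seminorm_def
proof (intro conjI ballI allI impI)
  fix x assume x: "x \<in> carrier B"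
  show "0 \<le> sup_norm x" by (rule sup_norm_nonneg)
  show "sup_norm (c \<odot> x) = cmod c * sup_norm x" for c
  proof (rule antisym)
    show "sup_norm (c \<odot> x) \<le> cmod c * sup_norm x"
      using x by (intro sup_norm_le) (simp_all add: ev_simps norm_mult mult_left_mono sup_norm_ge sup_norm_nonneg)
    show "cmod c * sup_norm x \<le> sup_norm (c \<odot> x)"
    proof (cases "c = 0")
      case False
      have "sup_norm x \<le> sup_norm (c \<odot> x) / cmod c"
      proof (rule sup_norm_le)
        fix p assume "p \<in> X"
        thus "cmod (h p x) \<le> sup_norm (c \<odot> x) / cmod c"
          using sup_norm_ge[of p "c \<odot> x"] x False by (simp add: ev_simps norm_mult field_simps)
      qed (simp add: sup_norm_nonneg)
      thus ?thesis using False by (simp add: field_simps)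
    qed (simp add: sup_norm_nonneg)
  qed
  show "sup_norm (star B x \<otimes> x) = (sup_norm x)\<^sup>2"
  proof (rule antisym)
    show "sup_norm (star B x \<otimes> x) \<le> (sup_norm x)\<^sup>2"
      using x by (intro sup_norm_le)
        (simp_all add: ev_simps norm_mult power2_eq_square mult_mono sup_norm_ge sup_norm_nonneg)
    have "sup_norm x \<le> sqrt (sup_norm (star B x \<otimes> x))"
    proof (rule sup_norm_le)
      fix p assume "p \<in> X"
      thus "cmod (h p x) \<le> sqrt (sup_norm (star B x \<otimes> x))"
        using sup_norm_ge[of p "star B x \<otimes> x"] x
        by (intro real_le_rsqrt) (simp add: ev_simps norm_mult power2_eq_square)
    qed (simp add: sup_norm_nonneg)
    thus "(sup_norm x)\<^sup>2 \<le> sup_norm (star B x \<otimes> x)"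
      using power_mono[of "sup_norm x" "sqrt (sup_norm (star B x \<otimes> x))" 2]
      by (simp add: sup_norm_nonneg)
  qed
  show "x = \<zero>" if "sup_norm x = 0"
    using x sup_norm_ge[of _ x] that by (intro ev_eqI) (simp_all add: ev_simps)
  fix y assume y: "y \<in> carrier B"
  show "sup_norm (x \<oplus> y) \<le> sup_norm x + sup_norm y"
  proof (rule sup_norm_le)
    fix p assume p: "p \<in> X"
    have "cmod (h p x + h p y) \<le> cmod (h p x) + cmod (h p y)" by (rule norm_triangle_ineq)
    thus "cmod (h p (x \<oplus> y)) \<le> sup_norm x + sup_norm y"
      using sup_norm_ge[OF p, of x] sup_norm_ge[OF p, of y] x y p by (simp add: ev_simps)
  qed (simp add: sup_norm_nonneg)
  show "sup_norm (x \<otimes> y) \<le> sup_norm x * sup_norm y"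
    using x y by (intro sup_norm_le)
      (simp_all add: ev_simps norm_mult mult_mono sup_norm_ge sup_norm_nonneg)
qed

text \<open>Multiplying \<open>x\<close> by the indicator of \<open>p\<close> scales this indicator
  by \<open>h p x\<close>. Its norm is positive because \<open>q\<close> is definite, and can be
  cancelled from the submultiplicativity estimate.\<close>

lemma sup_norm_least:
  assumes q: "cstar_norm B q" and x: "x \<in> carrier B"
  shows "sup_norm x \<le> q x"
proof (rule sup_norm_le)
  interpret seminormed_star_alg B q using q by unfold_locales (simp add: cstar_norm_def)
  show "0 \<le> q x" using x by (rule q_nonneg)
  fix p assume p: "p \<in> X"
  let ?e = "indicator_elt {p}"
  have "?e \<noteq> \<zero>" using ev_zero[OF p] indicator_elt(2)[OF p, of "{p}"] by auto
  hence "q ?e \<noteq> 0" using q unfolding cstar_norm_def by auto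
  hence e: "q ?e > 0" using q_nonneg[of ?e] by simp
  have "cmod (h p x) * q ?e = q (?e \<otimes> x)" using p x by (simp add: mult_indicator q_smult)
  also have "\<dots> \<le> q ?e * q x" using x by (intro q_mult) simp_all
  finally show "cmod (h p x) \<le> q x" using e by (simp add: mult.commute)
qed

text \<open>A finite-dimensional algebra is already complete: if two Cauchy sequences have the same
  limit at each point, the sum of the pointwise differences tends to zero and bounds
  \<open>q\<close>. Agreement of \<open>q\<close> with \<open>sup_norm\<close> is asked on the
  carrier only, where \<open>min_tensor_norm\<close> is controlled.\<close>

lemma completion_model:
  assumes q: "\<And>x. x \<in> carrier B \<Longrightarrow> q x = sup_norm x"
  defines "k \<equiv> (\<lambda>p. bounded_character.ext (h p))"
  shows "function_model (cstar_completion B q) X k"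
    and "\<And>x. x \<in> carrier B \<Longrightarrow> completion_embed B q x \<in> carrier (cstar_completion B q)"
    and "\<And>p x. p \<in> X \<Longrightarrow> x \<in> carrier B \<Longrightarrow> k p (completion_embed B q x) = h p x"
proof -
  have "cstar_seminorm B q"
    using sup_norm unfolding cstar_norm_def cstar_seminorm_def by (simp add: q)
  then interpret C: seminormed_star_alg B q by unfold_locales
  have char: "bounded_character B q (h p)" if p: "p \<in> X" for p
    using p by unfold_locales (simp_all add: ev_simps q sup_norm_ge)
  show emb: "completion_embed B q x \<in> carrier C.Cp" if "x \<in> carrier B" for x
    using that by (simp add: completion_embed_def C.cls_closed C.const_cauchy)
  show k_emb: "k p (completion_embed B q x) = h p x" if "p \<in> X" "x \<in> carrier B" for p x
    using bounded_character.ext_const[OF char] that by (simp add: k_def completion_embed_def)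
  show "function_model C.Cp X k"
  proof
    fix \<phi> show "\<exists>x\<in>carrier C.Cp. \<forall>p\<in>X. k p x = \<phi> p"
      using emb k_emb elt by (intro bexI[of _ "completion_embed B q (elt \<phi>)"]) auto
  next
    fix Y Z assume "Y \<in> carrier C.Cp" "Z \<in> carrier C.Cp" and eq: "\<And>p. p \<in> X \<Longrightarrow> k p Y = k p Z"
    then obtain s t where st: "s \<in> C.C" "Y = C.cls s" "t \<in> C.C" "Z = C.cls t" by (elim C.carrier_cls) blast
    have B: "s n \<in> carrier B" "t n \<in> carrier B" for n using st C.cauchy_carrier by auto
    have "(\<lambda>n. h p (s n) - h p (t n)) \<longlonglongrightarrow> k p Y - k p Z" if "p \<in> X" for p
      using bounded_character.ext_lim[OF char[OF that]] st
      by (intro tendsto_diff) (simp_all add: k_def)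
    hence "(\<lambda>n. h p (s n) - h p (t n)) \<longlonglongrightarrow> 0" if "p \<in> X" for p using that eq by simp
    hence lim: "(\<lambda>n. \<Sum>p\<in>X. cmod (h p (s n) - h p (t n))) \<longlonglongrightarrow> 0"
      by (intro tendsto_null_sum tendsto_norm_zero)
    have "q (s n \<ominus> t n) \<le> (\<Sum>p\<in>X. cmod (h p (s n) - h p (t n)))" for n
    proof -
      have "sup_norm (s n \<ominus> t n) \<le> (\<Sum>p\<in>X. cmod (h p (s n \<ominus> t n)))"
        using finite_points by (intro sup_norm_le sum_nonneg member_le_sum) auto
      thus ?thesis using B bounded_character.char_minus[OF char] by (simp add: q)
    qed
    hence "(\<lambda>n. q (s n \<ominus> t n)) \<longlonglongrightarrow> 0"
      using B by (intro Lim_null_comparison[OF _ lim]) (simp add: C.q_nonneg)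
    thus "Y = Z" using st by (simp only: C.cls_eq_iff)
  qed (auto simp: k_def finite_points bounded_character.ext_one[OF char] bounded_character.ext_zero[OF char]
      bounded_character.ext_add[OF char] bounded_character.ext_mult[OF char]
      bounded_character.ext_smult[OF char] bounded_character.ext_star[OF char]
      C.completion_smult_closed C.completion_star_closed)
qed

end

section \<open>Algebraic and spatial tensor products as functions on pairs\<close>

context function_models
begin

abbreviation "P \<equiv> pair_algebra B D"
abbreviation "K \<equiv> bilinear_ideal B D"
abbreviation "pt a b \<equiv> monoid_point (a, b)"

lemma involutive_pair: "involutive_monoid (B \<times>\<times> D) (map_prod (star B) (star D))"
proof (intro involutive_monoid.intro involutive_monoid_axioms.intro)
  show "Group.monoid (B \<times>\<times> D)" by (intro DirProd_monoid B.monoid_axioms D.monoid_axioms)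
qed (auto simp: DirProd_def B.star_mult D.star_mult)

sublocale P: involutive_monoid "B \<times>\<times> D" "map_prod (star B) (star D)"
  rewrites "star_monoid_algebra (B \<times>\<times> D) (map_prod (star B) (star D)) = P"
  by (rule involutive_pair) (simp add: pair_algebra_def)

sublocale P: star_alg P by (rule P.star_alg)

lemma pt_closed [simp]: "a \<in> carrier B \<Longrightarrow> b \<in> carrier D \<Longrightarrow> pt a b \<in> carrier P"
  by (intro P.point_closed) (simp add: DirProd_def)

lemma pt_mult:
  assumes "a \<in> carrier B" "a' \<in> carrier B" "b \<in> carrier D" "b' \<in> carrier D"
  shows "pt a b \<otimes>\<^bsub>P\<^esub> pt a' b' = pt (a \<otimes>\<^bsub>B\<^esub> a') (b \<otimes>\<^bsub>D\<^esub> b')"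
  using P.point_mult[of "(a, b)" "(a', b')"] assms by (simp add: DirProd_def)

definition pair_eval :: "'p \<times> 'q \<Rightarrow> ('b \<times> 'd \<Rightarrow> complex) \<Rightarrow> complex" where
  "pair_eval w = pairing (\<lambda>(a, b). h (fst w) a * k (snd w) b)"

lemma pair_eval_simps:
  assumes w: "w \<in> X \<times> Y"
  shows "pair_eval w \<zero>\<^bsub>P\<^esub> = 0" "pair_eval w \<one>\<^bsub>P\<^esub> = 1"
    "\<And>x y. x \<in> carrier P \<Longrightarrow> y \<in> carrier P \<Longrightarrow> pair_eval w (x \<oplus>\<^bsub>P\<^esub> y) = pair_eval w x + pair_eval w y"
    "\<And>x y. x \<in> carrier P \<Longrightarrow> y \<in> carrier P \<Longrightarrow> pair_eval w (x \<ominus>\<^bsub>P\<^esub> y) = pair_eval w x - pair_eval w y"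
    "\<And>x y. x \<in> carrier P \<Longrightarrow> y \<in> carrier P \<Longrightarrow> pair_eval w (x \<otimes>\<^bsub>P\<^esub> y) = pair_eval w x * pair_eval w y"
    "\<And>x c. x \<in> carrier P \<Longrightarrow> pair_eval w (c \<odot>\<^bsub>P\<^esub> x) = c * pair_eval w x"
    "\<And>x. x \<in> carrier P \<Longrightarrow> pair_eval w (star P x) = cnj (pair_eval w x)"
    "\<And>a b. pair_eval w (pt a b) = h (fst w) a * k (snd w) b"
proof -
  have w': "fst w \<in> X" "snd w \<in> Y" using w by auto
  show "pair_eval w (x \<otimes>\<^bsub>P\<^esub> y) = pair_eval w x * pair_eval w y"
    if "x \<in> carrier P" "y \<in> carrier P" for x y
    unfolding pair_eval_def using that
    by (intro P.pairing_mult_character) (auto simp: DirProd_def B.ev_simps D.ev_simps w')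
  show "pair_eval w (star P x) = cnj (pair_eval w x)" if "x \<in> carrier P" for x
    unfolding pair_eval_def using that
    by (intro P.pairing_star_character) (auto simp: DirProd_def B.ev_simps D.ev_simps w')
  show "pair_eval w \<one>\<^bsub>P\<^esub> = 1"
    unfolding pair_eval_def P.pairing_one by (simp add: DirProd_def B.ev_simps D.ev_simps w')
qed (simp_all add: pair_eval_def P.pairing_zero P.pairing_plus P.pairing_minus P.pairing_smult)

lemma bilinear_relation_intros:
  "a \<in> carrier B \<Longrightarrow> a' \<in> carrier B \<Longrightarrow> b \<in> carrier D \<Longrightarrow>
    pt (a \<oplus>\<^bsub>B\<^esub> a') b \<ominus>\<^bsub>P\<^esub> (pt a b \<oplus>\<^bsub>P\<^esub> pt a' b) \<in> bilinear_relations B D"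
  "a \<in> carrier B \<Longrightarrow> b \<in> carrier D \<Longrightarrow> b' \<in> carrier D \<Longrightarrow>
    pt a (b \<oplus>\<^bsub>D\<^esub> b') \<ominus>\<^bsub>P\<^esub> (pt a b \<oplus>\<^bsub>P\<^esub> pt a b') \<in> bilinear_relations B D"
  "a \<in> carrier B \<Longrightarrow> b \<in> carrier D \<Longrightarrow>
    pt (c \<odot>\<^bsub>B\<^esub> a) b \<ominus>\<^bsub>P\<^esub> (c \<odot>\<^bsub>P\<^esub> pt a b) \<in> bilinear_relations B D"
  "a \<in> carrier B \<Longrightarrow> b \<in> carrier D \<Longrightarrow>
    pt a (c \<odot>\<^bsub>D\<^esub> b) \<ominus>\<^bsub>P\<^esub> (c \<odot>\<^bsub>P\<^esub> pt a b) \<in> bilinear_relations B D"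
  unfolding bilinear_relations_def Let_def by blast+

abbreviation "ker_pair \<equiv> {x \<in> carrier P. \<forall>w\<in>X \<times> Y. pair_eval w x = 0}"

lemma bilinear_relations_ker: "bilinear_relations B D \<subseteq> ker_pair"
proof
  fix r assume "r \<in> bilinear_relations B D"
  thus "r \<in> ker_pair" unfolding bilinear_relations_def Let_def
  proof (elim UnE CollectE exE conjE)
    fix a a' b assume "r = pt (a \<oplus>\<^bsub>B\<^esub> a') b \<ominus>\<^bsub>P\<^esub> (pt a b \<oplus>\<^bsub>P\<^esub> pt a' b)"
      "a \<in> carrier B" "a' \<in> carrier B" "b \<in> carrier D"
    thus ?thesis by (auto simp: pair_eval_simps B.ev_simps algebra_simps)
  next
    fix a b b' assume "r = pt a (b \<oplus>\<^bsub>D\<^esub> b') \<ominus>\<^bsub>P\<^esub> (pt a b \<oplus>\<^bsub>P\<^esub> pt a b')"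
      "a \<in> carrier B" "b \<in> carrier D" "b' \<in> carrier D"
    thus ?thesis by (auto simp: pair_eval_simps D.ev_simps algebra_simps)
  next
    fix c a b assume "r = pt (c \<odot>\<^bsub>B\<^esub> a) b \<ominus>\<^bsub>P\<^esub> (c \<odot>\<^bsub>P\<^esub> pt a b)" "a \<in> carrier B" "b \<in> carrier D"
    thus ?thesis by (auto simp: pair_eval_simps B.ev_simps)
  next
    fix c a b assume "r = pt a (c \<odot>\<^bsub>D\<^esub> b) \<ominus>\<^bsub>P\<^esub> (c \<odot>\<^bsub>P\<^esub> pt a b)" "a \<in> carrier B" "b \<in> carrier D"
    thus ?thesis by (auto simp: pair_eval_simps D.ev_simps)
  qed
qed

lemma ker_pair_ideal: "ideal ker_pair P"
proof (rule idealI[OF P.ring_axioms])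
  have "pair_eval w (\<ominus>\<^bsub>P\<^esub> x) = - pair_eval w x" if "w \<in> X \<times> Y" "x \<in> carrier P" for w x
    using that pair_eval_simps(6)[of w x "-1"] by (simp add: P.uminus_smult)
  thus "subgroup ker_pair (add_monoid P)"
    by (intro P.add.subgroupI)
      (auto simp: pair_eval_simps a_inv_def[symmetric] intro!: exI[of _ "\<zero>\<^bsub>P\<^esub>"])
qed (auto simp: pair_eval_simps)

lemma K_ideal: "ideal K P"
  unfolding bilinear_ideal_def using bilinear_relations_ker by (intro P.genideal_ideal) blast

lemma K_subset_ker: "K \<subseteq> ker_pair"
  unfolding bilinear_ideal_def by (rule P.genideal_minimal[OF ker_pair_ideal bilinear_relations_ker])

lemma K_relations: "bilinear_relations B D \<subseteq> K"
  unfolding bilinear_ideal_def using bilinear_relations_ker by (intro P.genideal_self) blast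

sublocale K: ideal K P by (rule K_ideal)

abbreviation "tcl x \<equiv> K +>\<^bsub>P\<^esub> x"

lemma cl_pt:
  "a \<in> carrier B \<Longrightarrow> a' \<in> carrier B \<Longrightarrow> b \<in> carrier D \<Longrightarrow>
    tcl (pt (a \<oplus>\<^bsub>B\<^esub> a') b) = tcl (pt a b \<oplus>\<^bsub>P\<^esub> pt a' b)"
  "a \<in> carrier B \<Longrightarrow> b \<in> carrier D \<Longrightarrow> b' \<in> carrier D \<Longrightarrow>
    tcl (pt a (b \<oplus>\<^bsub>D\<^esub> b')) = tcl (pt a b \<oplus>\<^bsub>P\<^esub> pt a b')"
  "a \<in> carrier B \<Longrightarrow> b \<in> carrier D \<Longrightarrow> tcl (pt (c \<odot>\<^bsub>B\<^esub> a) b) = tcl (c \<odot>\<^bsub>P\<^esub> pt a b)"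
  "a \<in> carrier B \<Longrightarrow> b \<in> carrier D \<Longrightarrow> tcl (pt a (c \<odot>\<^bsub>D\<^esub> b)) = tcl (c \<odot>\<^bsub>P\<^esub> pt a b)"
  using bilinear_relation_intros K_relations
  by (subst P.coset_eq_iff[OF K_ideal]; simp add: subset_iff)+

lemma mult_cl_cong:
  assumes "x \<in> carrier P" "y \<in> carrier P" "z \<in> carrier P" "tcl x = tcl y"
  shows "x \<otimes>\<^bsub>P\<^esub> z \<in> K \<longleftrightarrow> y \<otimes>\<^bsub>P\<^esub> z \<in> K"
proof -
  have "x \<ominus>\<^bsub>P\<^esub> y \<in> K" using assms P.coset_eq_iff[OF K_ideal] by blast
  hence "(x \<otimes>\<^bsub>P\<^esub> z) \<ominus>\<^bsub>P\<^esub> (y \<otimes>\<^bsub>P\<^esub> z) \<in> K"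
    using assms K.I_r_closed by (simp add: P.minus_mult_distrib)
  hence "tcl (x \<otimes>\<^bsub>P\<^esub> z) = tcl (y \<otimes>\<^bsub>P\<^esub> z)" using assms by (simp add: P.coset_eq_iff[OF K_ideal])
  moreover have "u \<in> K \<longleftrightarrow> tcl u = tcl \<zero>\<^bsub>P\<^esub>" if "u \<in> carrier P" for u
    using that by (simp add: P.coset_eq_iff[OF K_ideal] P.minus_eq)
  ultimately show ?thesis using assms by simp
qed

abbreviation "unit_pt p q \<equiv> pt (B.indicator_elt {p}) (D.indicator_elt {q})"

text \<open>Modulo bilinearity, the tensor of two point indicators is the minimal projection of the
  pair \<open>(p, q)\<close>: multiplication by \<open>x\<close> scales it by the value of
  \<open>x\<close> there.\<close>

lemma unit_pt_mult:
  assumes p: "p \<in> X" and q: "q \<in> Y" and x: "x \<in> carrier P"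
  shows "tcl (unit_pt p q \<otimes>\<^bsub>P\<^esub> x) = tcl (pair_eval (p, q) x \<odot>\<^bsub>P\<^esub> unit_pt p q)"
proof -
  let ?e = "unit_pt p q"
  have w: "(p, q) \<in> X \<times> Y" using p q by simp
  show ?thesis using x
  proof (induction x rule: P.carrier_induct)
    case zero
    show ?case using w by (simp add: pair_eval_simps)
  next
    case (add x y)
    have "tcl (?e \<otimes>\<^bsub>P\<^esub> (x \<oplus>\<^bsub>P\<^esub> y)) = tcl (?e \<otimes>\<^bsub>P\<^esub> x) <+>\<^bsub>P\<^esub> tcl (?e \<otimes>\<^bsub>P\<^esub> y)"
      using add.hyps by (simp add: P.r_distr K.a_rcos_sum)
    also have "\<dots> = tcl (pair_eval (p, q) x \<odot>\<^bsub>P\<^esub> ?e) <+>\<^bsub>P\<^esub> tcl (pair_eval (p, q) y \<odot>\<^bsub>P\<^esub> ?e)"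
      using add by (simp only:)
    also have "\<dots> = tcl (pair_eval (p, q) (x \<oplus>\<^bsub>P\<^esub> y) \<odot>\<^bsub>P\<^esub> ?e)"
      using add.hyps w by (simp add: pair_eval_simps P.add_smult K.a_rcos_sum)
    finally show ?case .
  next
    case (smult c x)
    have "tcl (?e \<otimes>\<^bsub>P\<^esub> (c \<odot>\<^bsub>P\<^esub> x)) = tcl (c \<odot>\<^bsub>P\<^esub> (?e \<otimes>\<^bsub>P\<^esub> x))"
      using smult.hyps by (simp add: P.mult_smult)
    also have "\<dots> = tcl (c \<odot>\<^bsub>P\<^esub> (pair_eval (p, q) x \<odot>\<^bsub>P\<^esub> ?e))"
      using smult by (intro P.coset_smult_cong[OF K_ideal]) simp_all
    also have "\<dots> = tcl (pair_eval (p, q) (c \<odot>\<^bsub>P\<^esub> x) \<odot>\<^bsub>P\<^esub> ?e)"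
      using smult.hyps w by (simp add: pair_eval_simps P.smult_smult)
    finally show ?case .
  next
    case (point z)
    then obtain a b where z: "z = (a, b)" "a \<in> carrier B" "b \<in> carrier D" by (auto simp: DirProd_def)
    have "?e \<otimes>\<^bsub>P\<^esub> pt a b = pt (h p a \<odot>\<^bsub>B\<^esub> B.indicator_elt {p}) (k q b \<odot>\<^bsub>D\<^esub> D.indicator_elt {q})"
      using z p q by (simp add: pt_mult B.mult_indicator D.mult_indicator)
    hence "tcl (?e \<otimes>\<^bsub>P\<^esub> pt a b) = tcl (h p a \<odot>\<^bsub>P\<^esub> pt (B.indicator_elt {p}) (k q b \<odot>\<^bsub>D\<^esub> D.indicator_elt {q}))"
      by (simp only: cl_pt(3) B.indicator_elt(1) D.indicator_elt(1) D.smult_closed)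
    also have "\<dots> = tcl (h p a \<odot>\<^bsub>P\<^esub> (k q b \<odot>\<^bsub>P\<^esub> ?e))"
      by (intro P.coset_smult_cong[OF K_ideal] cl_pt) simp_all
    also have "\<dots> = tcl (pair_eval (p, q) (pt a b) \<odot>\<^bsub>P\<^esub> ?e)"
      using w by (simp add: pair_eval_simps P.smult_smult)
    finally show ?case by (simp only: z)
  qed
qed

text \<open>An \<open>x\<close> that vanishes at all pairs is annihilated modulo \<open>K\<close> by
  every \<open>unit_pt p q\<close>. Their sum is the unit modulo \<open>K\<close>; it is assembled
  in two stages by \<open>one_by_points\<close>, in the left factor for fixed \<open>q\<close> and
  then in the right factor.\<close>

lemma ker_subset_K: "ker_pair \<subseteq> K"
proof
  fix x assume "x \<in> ker_pair"
  hence x: "x \<in> carrier P" and zero: "\<And>p q. p \<in> X \<Longrightarrow> q \<in> Y \<Longrightarrow> pair_eval (p, q) x = 0" by auto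
  \<comment> \<open>In \<open>P\<close> the point with first component zero is a basis vector like
    any other; it becomes zero only modulo \<open>K\<close>.\<close>
  have zero_pt: "pt \<zero>\<^bsub>B\<^esub> b \<otimes>\<^bsub>P\<^esub> x \<in> K" if "b \<in> carrier D" for b
  proof -
    have "tcl (pt \<zero>\<^bsub>B\<^esub> b) = tcl \<zero>\<^bsub>P\<^esub>" using cl_pt(3)[of "\<zero>\<^bsub>B\<^esub>" b 0] that by simp
    thus ?thesis using mult_cl_cong[of "pt \<zero>\<^bsub>B\<^esub> b" "\<zero>\<^bsub>P\<^esub>" x] x that by simp
  qed
  have pt_zero: "pt a \<zero>\<^bsub>D\<^esub> \<otimes>\<^bsub>P\<^esub> x \<in> K" if "a \<in> carrier B" for a
  proof -
    have "tcl (pt a \<zero>\<^bsub>D\<^esub>) = tcl \<zero>\<^bsub>P\<^esub>" using cl_pt(4)[of a "\<zero>\<^bsub>D\<^esub>" 0] that by simp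
    thus ?thesis using mult_cl_cong[of "pt a \<zero>\<^bsub>D\<^esub>" "\<zero>\<^bsub>P\<^esub>" x] x that by simp
  qed
  have "pt \<one>\<^bsub>B\<^esub> (D.indicator_elt {q}) \<otimes>\<^bsub>P\<^esub> x \<in> K" if q: "q \<in> Y" for q
  proof (rule B.one_by_points[where Q = "\<lambda>a. pt a (D.indicator_elt {q}) \<otimes>\<^bsub>P\<^esub> x \<in> K"])
    fix p assume p: "p \<in> X"
    have "tcl (unit_pt p q \<otimes>\<^bsub>P\<^esub> x) = tcl \<zero>\<^bsub>P\<^esub>"
      using unit_pt_mult[OF p q x] zero[OF p q] by simp
    thus "unit_pt p q \<otimes>\<^bsub>P\<^esub> x \<in> K" using x by (simp add: P.coset_eq_iff[OF K_ideal] P.minus_eq)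
  next
    let ?e = "D.indicator_elt {q}"
    fix a b assume ab: "a \<in> carrier B" "b \<in> carrier B" "pt a ?e \<otimes>\<^bsub>P\<^esub> x \<in> K" "pt b ?e \<otimes>\<^bsub>P\<^esub> x \<in> K"
    have "(pt a ?e \<oplus>\<^bsub>P\<^esub> pt b ?e) \<otimes>\<^bsub>P\<^esub> x \<in> K"
      using ab x by (subst P.l_distr) simp_all
    thus "pt (a \<oplus>\<^bsub>B\<^esub> b) ?e \<otimes>\<^bsub>P\<^esub> x \<in> K"
      using ab x by (subst mult_cl_cong[OF _ _ x cl_pt(1)]) simp_all
  qed (simp add: zero_pt)
  hence "pt \<one>\<^bsub>B\<^esub> \<one>\<^bsub>D\<^esub> \<otimes>\<^bsub>P\<^esub> x \<in> K"
  proof (intro D.one_by_points[where Q = "\<lambda>b. pt \<one>\<^bsub>B\<^esub> b \<otimes>\<^bsub>P\<^esub> x \<in> K"])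
    fix a b assume ab: "a \<in> carrier D" "b \<in> carrier D" "pt \<one>\<^bsub>B\<^esub> a \<otimes>\<^bsub>P\<^esub> x \<in> K" "pt \<one>\<^bsub>B\<^esub> b \<otimes>\<^bsub>P\<^esub> x \<in> K"
    have "(pt \<one>\<^bsub>B\<^esub> a \<oplus>\<^bsub>P\<^esub> pt \<one>\<^bsub>B\<^esub> b) \<otimes>\<^bsub>P\<^esub> x \<in> K"
      using ab x by (subst P.l_distr) simp_all
    thus "pt \<one>\<^bsub>B\<^esub> (a \<oplus>\<^bsub>D\<^esub> b) \<otimes>\<^bsub>P\<^esub> x \<in> K"
      using ab x by (subst mult_cl_cong[OF _ _ x cl_pt(2)]) simp_all
  qed (simp_all add: pt_zero)
  moreover have "pt \<one>\<^bsub>B\<^esub> \<one>\<^bsub>D\<^esub> = \<one>\<^bsub>P\<^esub>" using P.one_eq_point by (simp add: DirProd_def)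
  ultimately show "x \<in> K" using x by simp
qed

lemma alg_tensor_model:
  fixes E defines "E \<equiv> (\<lambda>w Z. pair_eval w (SOME x. x \<in> Z))"
  shows "function_model (alg_tensor B D) (X \<times> Y) E"
    and "\<And>w x. w \<in> X \<times> Y \<Longrightarrow> x \<in> carrier P \<Longrightarrow> E w (tcl x) = pair_eval w x"
proof -
  have surj: "\<exists>x\<in>carrier P. \<forall>w\<in>X \<times> Y. pair_eval w x = \<phi> w" for \<phi>
  proof
    let ?f = "\<lambda>w. \<phi> w \<odot>\<^bsub>P\<^esub> unit_pt (fst w) (snd w)"
    show "finsum P ?f (X \<times> Y) \<in> carrier P" by (intro P.finsum_closed) auto
    show "\<forall>w\<in>X \<times> Y. pair_eval w (finsum P ?f (X \<times> Y)) = \<phi> w"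
    proof
      fix w assume w: "w \<in> X \<times> Y"
      have "pair_eval w (finsum P ?f (X \<times> Y)) = (\<Sum>v\<in>X \<times> Y. pair_eval w (?f v))"
        unfolding pair_eval_def by (rule P.pairing_finsum) (auto simp: B.finite_points D.finite_points)
      also have "\<dots> = (\<Sum>v\<in>X \<times> Y. \<phi> v * of_bool (w = v))"
        using w by (intro sum.cong) (auto simp: pair_eval_simps prod_eq_iff)
      also have "\<dots> = \<phi> w"
        using w B.finite_points D.finite_points by (simp add: of_bool_def if_distrib cong: if_cong)
      finally show "pair_eval w (finsum P ?f (X \<times> Y)) = \<phi> w" .
    qed
  qed
  have K_eq: "K = ker_pair" using K_subset_ker ker_subset_K by blast
  have fin: "finite (X \<times> Y)" using B.finite_points D.finite_points by simp
  note * = star_quotient_model[where h = pair_eval, OF K_ideal fin P.smult_closed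
      P.star_closed pair_eval_simps(1,2,3,5,6,7) K_eq surj]
  show "function_model (alg_tensor B D) (X \<times> Y) E"
    unfolding alg_tensor_def E_def by (rule *(1); assumption)
  show "E w (tcl x) = pair_eval w x" if "w \<in> X \<times> Y" "x \<in> carrier P" for w x
    unfolding E_def by (rule *(2); (assumption | rule that))
qed

text \<open>The algebraic tensor product is an algebra of functions on pairs, so the infimum
  defining \<open>min_tensor_norm\<close> is attained by the supremum norm, and completing adds
  nothing.\<close>

lemma cstar_tensor_model:
  "\<exists>T. function_model (cstar_tensor B D) (X \<times> Y) T \<and>
    (\<forall>a\<in>carrier B. \<forall>b\<in>carrier D. pure_tensor B D a b \<in> carrier (cstar_tensor B D) \<and>
      (\<forall>w\<in>X \<times> Y. T w (pure_tensor B D a b) = h (fst w) a * k (snd w) b))"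
proof -
  interpret E: function_model "alg_tensor B D" "X \<times> Y" "\<lambda>w Z. pair_eval w (SOME x. x \<in> Z)"
    by (rule alg_tensor_model(1))
  have min: "min_tensor_norm B D x = E.sup_norm x" if "x \<in> carrier (alg_tensor B D)" for x
    unfolding min_tensor_norm_def
    using E.sup_norm E.sup_norm_least that by (intro cInf_eq_minimum) auto
  let ?N = "min_tensor_norm B D"
  let ?T = "\<lambda>w. bounded_character.ext (\<lambda>Z. pair_eval w (SOME x. x \<in> Z))"
  note C = E.completion_model[of ?N, OF min]
  have tcl: "tcl (pt a b) \<in> carrier (alg_tensor B D)" if "a \<in> carrier B" "b \<in> carrier D" for a b
    using that K.a_subset unfolding alg_tensor_def star_quotient_def FactRing_def
    by (simp add: P.a_rcosetsI)
  show ?thesis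
  proof (intro exI[of _ ?T] conjI ballI)
    show "function_model (cstar_tensor B D) (X \<times> Y) ?T"
      unfolding cstar_tensor_def by (rule C(1))
    fix a b assume ab: "a \<in> carrier B" "b \<in> carrier D"
    show "pure_tensor B D a b \<in> carrier (cstar_tensor B D)"
      unfolding cstar_tensor_def pure_tensor_def by (rule C(2)[OF _ tcl[OF ab]])
    fix w assume w: "w \<in> X \<times> Y"
    show "?T w (pure_tensor B D a b) = h (fst w) a * k (snd w) b"
      unfolding pure_tensor_def using C(3)[OF _ w tcl[OF ab]] alg_tensor_model(2)[OF w] ab w
      by (simp add: pair_eval_simps)
  qed
qed

end

section \<open>Representations of the quantum automorphism group\<close>

text \<open>A model refers to the fields of a *-algebra only, so it transfers along record
  extensions such as \<open>cstar_quotient\<close> and \<open>matrix_hopf\<close>.\<close>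

lemma function_model_cong:
  assumes "function_model B X h"
    "carrier B' = carrier B" "mult B' = mult B" "one B' = one B" "zero B' = zero B"
    "add B' = add B" "smult B' = smult B" "star B' = star B"
  shows "function_model B' X h"
  using assms unfolding function_model_def by simp

lemma matrix_hopf_simps [simp]:
  "one (matrix_hopf A V u) = one A" "zero (matrix_hopf A V u) = zero A"
  "add (matrix_hopf A V u) = add A" "smult (matrix_hopf A V u) = smult A"
  "star (matrix_hopf A V u) = star A"
  by (simp_all add: matrix_hopf_def cstar_algebra.defs)

lemma cstar_quotient_simps:
  "carrier (cstar_quotient A I) = carrier (star_quotient A I)"
  "mult (cstar_quotient A I) = mult (star_quotient A I)" "one (cstar_quotient A I) = one (star_quotient A I)"
  "zero (cstar_quotient A I) = zero (star_quotient A I)" "add (cstar_quotient A I) = add (star_quotient A I)"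
  "smult (cstar_quotient A I) = smult (star_quotient A I)" "star (cstar_quotient A I) = star (star_quotient A I)"
  by (simp_all add: cstar_quotient_def star_algebra.defs)

lemma pair_algebra_cong:
  assumes "carrier A' = carrier A" "mult A' = mult A" "one A' = one A" "star A' = star A"
  shows "pair_algebra A' A' = pair_algebra A A"
  using assms by (simp add: pair_algebra_def DirProd_def)

text \<open>\<open>matrix_hopf\<close> defines the comultiplication with the tensor square of the
  underlying algebra, whereas \<open>representation\<close> forms that of the Hopf record. No layer
  of the construction sees the added fields.\<close>

lemma tensor_matrix_hopf:
  "cstar_tensor (matrix_hopf A V u) (matrix_hopf A V u) = cstar_tensor A A"
  "pure_tensor (matrix_hopf A V u) (matrix_hopf A V u) = pure_tensor A A"
proof -
  let ?H = "matrix_hopf A V u"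
  have P: "pair_algebra ?H ?H = pair_algebra A A" by (rule pair_algebra_cong) simp_all
  have "bilinear_relations ?H ?H = bilinear_relations A A"
    unfolding bilinear_relations_def P by simp
  hence K: "bilinear_ideal ?H ?H = bilinear_ideal A A" unfolding bilinear_ideal_def P by simp
  have E: "alg_tensor ?H ?H = alg_tensor A A" unfolding alg_tensor_def P K ..
  have N: "min_tensor_norm ?H ?H = min_tensor_norm A A" unfolding min_tensor_norm_def E ..
  show "cstar_tensor ?H ?H = cstar_tensor A A" unfolding cstar_tensor_def E N ..
  show "pure_tensor ?H ?H = pure_tensor A A"
    by (intro ext) (simp only: pure_tensor_def E N K P)
qed

context moore_graph_algebra
begin

abbreviation "Q \<equiv> cstar_quotient U.Cp I"
abbreviation "u i j \<equiv> I +>\<^bsub>U.Cp\<^esub> emb (x\<^sub>V i j)"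

lemma A_graph_eq: "A_graph V E = matrix_hopf Q V (\<lambda>i j. u i j)"
  unfolding A_graph_def perm_cstar_eq perm_gen_eq ..

lemma Q_model: "function_model Q Aut aut_eval"
  by (rule function_model_cong[OF quotient_model(1)]) (simp_all add: cstar_quotient_simps)

lemma A_graph_model: "function_model (A_graph V E) Aut aut_eval"
  unfolding A_graph_eq by (rule function_model_cong[OF Q_model]) simp_all

lemma u_closed: "i \<in> V \<Longrightarrow> j \<in> V \<Longrightarrow> u i j \<in> carrier Q"
  using U.Cp.a_rcosetsI[OF additive_subgroup.a_subset[OF ideal.axioms(1)[OF I_ideal]]] emb_closed
  by (simp add: cstar_quotient_simps star_quotient_def FactRing_def)

lemma aut_eval_u: "f \<in> Aut \<Longrightarrow> i \<in> V \<Longrightarrow> j \<in> V \<Longrightarrow> aut_eval f (u i j) = of_bool (f i = j)"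
  by (simp add: quotient_model(2) emb_closed ev_simps point_eval_gen)

lemma aut_eqI:
  assumes "f \<in> Aut" "g \<in> Aut"
    and eq: "\<And>i j. i \<in> V \<Longrightarrow> j \<in> V \<Longrightarrow> aut_eval f (u i j) = aut_eval g (u i j)"
  shows "f = g"
proof (rule PiE_ext)
  show "f \<in> V \<rightarrow>\<^sub>E V" "g \<in> V \<rightarrow>\<^sub>E V" using assms by (auto simp: graph_aut_def)
  fix i assume i: "i \<in> V"
  thus "f i = g i" using eq[of i "f i"] assms(1,2) Aut_closed by (simp add: aut_eval_u)
qed

lemma Aut_inj: "f \<in> Aut \<Longrightarrow> inj_on f V"
  and Aut_adj: "f \<in> Aut \<Longrightarrow> i \<in> V \<Longrightarrow> k \<in> V \<Longrightarrow> E (f i) (f k) = E i k"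
  by (simp_all add: graph_aut_def)

lemma compose_Aut:
  assumes "f \<in> Aut" "g \<in> Aut"
  shows "compose V f g \<in> Aut"
proof -
  have "inj_on (compose V f g) V"
    by (rule inj_onI) (use assms Aut_closed in \<open>simp add: compose_eq inj_on_eq_iff[OF Aut_inj]\<close>)
  thus ?thesis unfolding graph_aut_def
    using assms by (simp add: compose_eq Aut_closed Aut_adj PiE_iff extensional_def compose_def)
qed

lemma id_Aut: "restrict id V \<in> Aut"
  unfolding graph_aut_def by (simp add: inj_on_def)

lemma counit_eq:
  assumes "a \<in> carrier Q"
  shows "counit (A_graph V E) a = aut_eval (restrict id V) a"
proof -
  interpret function_models Q Aut aut_eval complex_star_algebra "{()}" "\<lambda>_ c. c"
    by (intro function_models.intro Q_model function_model_complex)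
  have "counit (A_graph V E) = pullback (\<lambda>_. restrict id V)"
    unfolding A_graph_eq matrix_hopf_def hopf_cstar.defs cstar_algebra.defs hopf_cstar.simps
  proof (rule the_star_hom_eq_pullback)
    show "f = g" if "f \<in> Aut" "g \<in> Aut"
      "\<And>i j. i \<in> V \<Longrightarrow> j \<in> V \<Longrightarrow> aut_eval f (u i j) = aut_eval g (u i j)" for f g
      using that by (rule aut_eqI)
  qed (simp_all add: u_closed aut_eval_u id_Aut complex_star_algebra_def)
  thus ?thesis using pullback(2)[OF assms, of "()"] by simp
qed

text \<open>At a pair \<open>(f, g)\<close> the sum over \<open>k\<close> counts the
  \<open>k\<close> with \<open>f i = k\<close> and \<open>g k = j\<close>, which is the truth value
  of \<open>g (f i) = j\<close>. So the first tensor factor is the map that is applied first, which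
  explains the order in \<open>compose\<close>.\<close>

lemma comult_model:
  "\<exists>T. function_model (cstar_tensor Q Q) (Aut \<times> Aut) T \<and>
    (\<forall>a\<in>carrier Q. \<forall>b\<in>carrier Q. pure_tensor Q Q a b \<in> carrier (cstar_tensor Q Q) \<and>
      (\<forall>w\<in>Aut \<times> Aut. T w (pure_tensor Q Q a b) = aut_eval (fst w) a * aut_eval (snd w) b)) \<and>
    (\<forall>a\<in>carrier Q. comult (A_graph V E) a \<in> carrier (cstar_tensor Q Q) \<and>
      (\<forall>w\<in>Aut \<times> Aut. T w (comult (A_graph V E) a) = aut_eval (compose V (snd w) (fst w)) a))"
proof -
  interpret Q2: function_models Q Aut aut_eval Q Aut aut_eval
    by (intro function_models.intro Q_model)
  obtain T where T: "function_model (cstar_tensor Q Q) (Aut \<times> Aut) T"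
    and pure: "\<And>a b. a \<in> carrier Q \<Longrightarrow> b \<in> carrier Q \<Longrightarrow> pure_tensor Q Q a b \<in> carrier (cstar_tensor Q Q)"
      "\<And>a b w. a \<in> carrier Q \<Longrightarrow> b \<in> carrier Q \<Longrightarrow> w \<in> Aut \<times> Aut \<Longrightarrow>
        T w (pure_tensor Q Q a b) = aut_eval (fst w) a * aut_eval (snd w) b"
    using Q2.cstar_tensor_model by blast
  interpret function_models Q Aut aut_eval "cstar_tensor Q Q" "Aut \<times> Aut" T
    by (intro function_models.intro Q_model T)
  let ?\<tau> = "\<lambda>w. compose V (snd w) (fst w)"
  have "comult (A_graph V E) = pullback ?\<tau>"
    unfolding A_graph_eq matrix_hopf_def hopf_cstar.defs cstar_algebra.defs hopf_cstar.simps
  proof (rule the_star_hom_eq_pullback)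
    show "u i j \<in> carrier Q" if "i \<in> V" "j \<in> V" for i j using that by (rule u_closed)
    show "f = g" if "f \<in> Aut" "g \<in> Aut"
      "\<And>i j. i \<in> V \<Longrightarrow> j \<in> V \<Longrightarrow> aut_eval f (u i j) = aut_eval g (u i j)" for f g
      using that by (rule aut_eqI)
    show "?\<tau> \<in> Aut \<times> Aut \<rightarrow> Aut" by (auto intro: compose_Aut)
    fix i j assume ij: "i \<in> V" "j \<in> V"
    have summands: "(\<lambda>k. pure_tensor Q Q (u i k) (u k j)) \<in> V \<rightarrow> carrier (cstar_tensor Q Q)"
      using ij by (auto intro: pure u_closed)
    show "(\<Oplus>\<^bsub>cstar_tensor Q Q\<^esub>k\<in>V. pure_tensor Q Q (u i k) (u k j)) \<in> carrier (cstar_tensor Q Q)"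
      using summands by (rule D.finsum_closed)
    fix w assume w: "w \<in> Aut \<times> Aut"
    hence fw: "fst w \<in> Aut" "snd w \<in> Aut" by auto
    have "T w (\<Oplus>\<^bsub>cstar_tensor Q Q\<^esub>k\<in>V. pure_tensor Q Q (u i k) (u k j)) =
        (\<Sum>k\<in>V. of_bool (fst w i = k) * of_bool (snd w k = j))"
      using summands w fw ij finite_V
      by (subst D.ev_finsum) (simp_all add: pure u_closed aut_eval_u)
    also have "\<dots> = (\<Sum>k\<in>V. if fst w i = k then of_bool (snd w k = j) else 0)"
      by (intro sum.cong) auto
    also have "\<dots> = of_bool (snd w (fst w i) = j)"
      using Aut_closed[OF fw(1) ij(1)] finite_V by simp
    also have "\<dots> = aut_eval (?\<tau> w) (u i j)"
      using ij fw compose_Aut by (simp add: aut_eval_u compose_def)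
    finally show "T w (\<Oplus>\<^bsub>cstar_tensor Q Q\<^esub>k\<in>V. pure_tensor Q Q (u i k) (u k j)) = aut_eval (?\<tau> w) (u i j)" .
  qed
  hence "a \<in> carrier Q \<Longrightarrow> comult (A_graph V E) a \<in> carrier (cstar_tensor Q Q)"
    "a \<in> carrier Q \<Longrightarrow> w \<in> Aut \<times> Aut \<Longrightarrow> T w (comult (A_graph V E) a) = aut_eval (?\<tau> w) a" for a w
    using pullback by simp_all
  thus ?thesis by (intro exI[of _ T] conjI ballI T pure)
qed

text \<open>All identities in the definition are checked at points, and \<open>\<rho> i j\<close> is
  the function that represents the entry \<open>v i j\<close>. By the order in the comultiplication,
  \<rho> turns \<open>g\<close> after \<open>f\<close> into the matrix of \<open>f\<close> times
  that of \<open>g\<close>.\<close>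

lemma irreducible_representation_of_matrices:
  fixes \<rho> :: "nat \<Rightarrow> nat \<Rightarrow> ('v \<Rightarrow> 'v) \<Rightarrow> complex"
  assumes mult: "\<And>f g i j. f \<in> Aut \<Longrightarrow> g \<in> Aut \<Longrightarrow> i \<in> {1..n} \<Longrightarrow> j \<in> {1..n} \<Longrightarrow>
      \<rho> i j (compose V g f) = (\<Sum>l\<in>{1..n}. \<rho> i l f * \<rho> l j g)"
    and one: "\<And>i j. i \<in> {1..n} \<Longrightarrow> j \<in> {1..n} \<Longrightarrow> \<rho> i j (restrict id V) = of_bool (i = j)"
    and schur: "\<And>T. (\<And>f i j. f \<in> Aut \<Longrightarrow> i \<in> {1..n} \<Longrightarrow> j \<in> {1..n} \<Longrightarrow>
        (\<Sum>l\<in>{1..n}. T i l * \<rho> l j f) = (\<Sum>l\<in>{1..n}. T l j * \<rho> i l f)) \<Longrightarrow>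
      \<exists>c. \<forall>i\<in>{1..n}. \<forall>j\<in>{1..n}. T i j = c * of_bool (i = j)"
  shows "\<exists>v. irreducible_representation (A_graph V E) n v"
proof -
  interpret A: function_model "A_graph V E" Aut aut_eval by (rule A_graph_model)
  have AQ: "carrier (A_graph V E) = carrier Q" unfolding A_graph_eq by simp
  define v where "v i j = A.elt (\<rho> i j)" for i j
  have v: "v i j \<in> carrier (A_graph V E)" "f \<in> Aut \<Longrightarrow> aut_eval f (v i j) = \<rho> i j f" for i j f
    by (simp_all add: v_def A.elt)
  obtain T where T: "function_model (cstar_tensor Q Q) (Aut \<times> Aut) T"
    and pure: "\<And>a b. a \<in> carrier Q \<Longrightarrow> b \<in> carrier Q \<Longrightarrow> pure_tensor Q Q a b \<in> carrier (cstar_tensor Q Q)"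
      "\<And>a b w. a \<in> carrier Q \<Longrightarrow> b \<in> carrier Q \<Longrightarrow> w \<in> Aut \<times> Aut \<Longrightarrow>
        T w (pure_tensor Q Q a b) = aut_eval (fst w) a * aut_eval (snd w) b"
    and comult: "\<And>a. a \<in> carrier Q \<Longrightarrow> comult (A_graph V E) a \<in> carrier (cstar_tensor Q Q)"
      "\<And>a w. a \<in> carrier Q \<Longrightarrow> w \<in> Aut \<times> Aut \<Longrightarrow>
        T w (comult (A_graph V E) a) = aut_eval (compose V (snd w) (fst w)) a"
    using comult_model by blast
  interpret T: function_model "cstar_tensor Q Q" "Aut \<times> Aut" T by (rule T)
  have vQ: "v i j \<in> carrier Q" for i j using v(1) AQ by simp
  have tensor: "cstar_tensor (A_graph V E) (A_graph V E) = cstar_tensor Q Q"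
    "pure_tensor (A_graph V E) (A_graph V E) = pure_tensor Q Q"
    unfolding A_graph_eq by (rule tensor_matrix_hopf)+
  have "comult (A_graph V E) (v i j) = (\<Oplus>\<^bsub>cstar_tensor Q Q\<^esub>l\<in>{1..n}. pure_tensor Q Q (v i l) (v l j))"
    if ij: "i \<in> {1..n}" "j \<in> {1..n}" for i j
  proof (rule T.ev_eqI)
    have summands: "(\<lambda>l. pure_tensor Q Q (v i l) (v l j)) \<in> {1..n} \<rightarrow> carrier (cstar_tensor Q Q)"
      by (auto intro: pure vQ)
    thus "(\<Oplus>\<^bsub>cstar_tensor Q Q\<^esub>l\<in>{1..n}. pure_tensor Q Q (v i l) (v l j)) \<in> carrier (cstar_tensor Q Q)"
      by (rule T.finsum_closed)
    show "comult (A_graph V E) (v i j) \<in> carrier (cstar_tensor Q Q)" by (intro comult vQ)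
    fix w assume w: "w \<in> Aut \<times> Aut"
    hence fw: "fst w \<in> Aut" "snd w \<in> Aut" by auto
    have "T w (comult (A_graph V E) (v i j)) = \<rho> i j (compose V (snd w) (fst w))"
      using w fw by (simp add: comult vQ v compose_Aut)
    also have "\<dots> = (\<Sum>l\<in>{1..n}. \<rho> i l (fst w) * \<rho> l j (snd w))" using mult fw ij by simp
    also have "\<dots> = T w (\<Oplus>\<^bsub>cstar_tensor Q Q\<^esub>l\<in>{1..n}. pure_tensor Q Q (v i l) (v l j))"
      using summands w fw by (subst T.ev_finsum) (simp_all add: pure vQ v)
    finally show "T w (comult (A_graph V E) (v i j)) =
        T w (\<Oplus>\<^bsub>cstar_tensor Q Q\<^esub>l\<in>{1..n}. pure_tensor Q Q (v i l) (v l j))" .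
  qed
  moreover have "counit (A_graph V E) (v i j) = of_bool (i = j)" if "i \<in> {1..n}" "j \<in> {1..n}" for i j
    using that by (simp add: counit_eq vQ v id_Aut one)
  ultimately have "representation (A_graph V E) n v"
    unfolding representation_def tensor using v(1) by blast
  moreover have "\<exists>c. \<forall>i\<in>{1..n}. \<forall>j\<in>{1..n}. S i j = c * of_bool (i = j)"
    if S: "\<forall>i\<in>{1..n}. \<forall>j\<in>{1..n}. (\<Oplus>\<^bsub>A_graph V E\<^esub>l\<in>{1..n}. S i l \<odot>\<^bsub>A_graph V E\<^esub> v l j) =
      (\<Oplus>\<^bsub>A_graph V E\<^esub>l\<in>{1..n}. S l j \<odot>\<^bsub>A_graph V E\<^esub> v i l)" for S :: "nat \<Rightarrow> nat \<Rightarrow> complex"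
  proof (rule schur)
    fix f i j assume f: "f \<in> Aut" and ij: "i \<in> {1..n}" "j \<in> {1..n}"
    have ev: "aut_eval f (\<Oplus>\<^bsub>A_graph V E\<^esub>l\<in>{1..n}. c l \<odot>\<^bsub>A_graph V E\<^esub> w l) = (\<Sum>l\<in>{1..n}. c l * aut_eval f (w l))"
      if "\<And>l. w l \<in> carrier (A_graph V E)" for c w
      using f that by (subst A.ev_finsum) (simp_all add: A.ev_smult)
    show "(\<Sum>l\<in>{1..n}. S i l * \<rho> l j f) = (\<Sum>l\<in>{1..n}. S l j * \<rho> i l f)"
      using arg_cong[OF S[rule_format, OF ij], of "aut_eval f"] unfolding ev[OF v(1)] v(2)[OF f] .
  qed
  ultimately show ?thesis unfolding irreducible_representation_def by blast
qed

text \<open>\<open>B\<close> and \<open>C\<close> are dual bases of a subspace of \<open>\<complex>\<^sup>V\<close>, and \<open>p\<close> is a projection onto it that is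
  invariant under automorphisms, so that the subspace is a representation.\<close>

lemma irreducible_representation_of_subspace:
  fixes B C :: "nat \<Rightarrow> 'v \<Rightarrow> complex"
  assumes dual: "\<And>i j. i \<in> {1..n} \<Longrightarrow> j \<in> {1..n} \<Longrightarrow> (\<Sum>x\<in>V. C i x * B j x) = of_bool (i = j)"
    and proj: "\<And>x y. x \<in> V \<Longrightarrow> y \<in> V \<Longrightarrow> (\<Sum>j\<in>{1..n}. B j x * C j y) = p x y"
    and inv: "\<And>f x y. f \<in> Aut \<Longrightarrow> x \<in> V \<Longrightarrow> y \<in> V \<Longrightarrow> p (f x) (f y) = p x y"
    and scalar: "\<And>t. (\<And>f x y. f \<in> Aut \<Longrightarrow> x \<in> V \<Longrightarrow> y \<in> V \<Longrightarrow> t (f x) (f y) = t x y) \<Longrightarrow>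
      \<exists>c. \<forall>x\<in>V. \<forall>j\<in>{1..n}. (\<Sum>y\<in>V. t x y * B j y) = c * B j x"
  shows "\<exists>v. irreducible_representation (A_graph V E) n v"
proof (rule irreducible_representation_of_matrices)
  note One_nat_def [simp del]
  \<comment> \<open>By duality this is the coefficient of \<open>B i\<close> in the function
    \<open>B j\<close> composed with \<open>f\<close>; composing on the right reverses the order of
    factors, as required.\<close>
  define \<rho> where "\<rho> i j f = (\<Sum>x\<in>V. C i x * B j (f x))" for i j f
  have delta: "(\<Sum>l\<in>{1..n}. g l * of_bool (l = i)) = g i" "(\<Sum>l\<in>{1..n}. of_bool (i = l) * g l) = g i"
    if "i \<in> {1..n}" for g :: "nat \<Rightarrow> complex" and i
    using that by (simp_all add: of_bool_def if_distrib if_distribR cong: if_cong)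
  have pB: "(\<Sum>y\<in>V. p x y * B j y) = B j x" if "x \<in> V" "j \<in> {1..n}" for x j
  proof -
    have "(\<Sum>y\<in>V. p x y * B j y) = (\<Sum>y\<in>V. \<Sum>l\<in>{1..n}. B l x * (C l y * B j y))"
      using that by (intro sum.cong) (simp_all add: sum_distrib_right mult.assoc flip: proj)
    also have "\<dots> = (\<Sum>l\<in>{1..n}. B l x * (\<Sum>y\<in>V. C l y * B j y))"
      by (subst sum.swap) (simp add: sum_distrib_left)
    also have "\<dots> = B j x" using that by (simp add: dual delta)
    finally show ?thesis .
  qed
  have Cp: "(\<Sum>x\<in>V. C i x * p x y) = C i y" if "y \<in> V" "i \<in> {1..n}" for y i
  proof -
    have "(\<Sum>x\<in>V. C i x * p x y) = (\<Sum>x\<in>V. \<Sum>l\<in>{1..n}. C i x * B l x * C l y)"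
      using that by (intro sum.cong) (simp_all add: sum_distrib_left mult.assoc flip: proj)
    also have "\<dots> = (\<Sum>l\<in>{1..n}. (\<Sum>x\<in>V. C i x * B l x) * C l y)"
      by (subst sum.swap) (simp add: sum_distrib_right)
    also have "\<dots> = C i y" using that by (simp add: dual delta)
    finally show ?thesis .
  qed
  have reindex: "(\<Sum>x\<in>V. g (f x)) = (\<Sum>x\<in>V. g x)" if "f \<in> Aut" for f and g :: "'v \<Rightarrow> complex"
    by (rule sum.reindex_bij_betw[OF Aut_bij[OF that]])
  have \<rho>C: "(\<Sum>j\<in>{1..n}. \<rho> i j f * C j (f y)) = C i y"
    if "f \<in> Aut" "i \<in> {1..n}" "y \<in> V" for i f y
  proof -
    have "(\<Sum>j\<in>{1..n}. \<rho> i j f * C j (f y)) = (\<Sum>x\<in>V. C i x * (\<Sum>j\<in>{1..n}. B j (f x) * C j (f y)))"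
      unfolding \<rho>_def sum_distrib_left sum_distrib_right by (subst sum.swap) (simp add: mult.assoc)
    also have "\<dots> = (\<Sum>x\<in>V. C i x * p x y)"
      using that by (intro sum.cong) (simp_all add: proj inv Aut_closed)
    finally show ?thesis using Cp that by simp
  qed
  have B\<rho>: "(\<Sum>l\<in>{1..n}. B l x * \<rho> l j f) = B j (f x)"
    if "f \<in> Aut" "j \<in> {1..n}" "x \<in> V" for j f x
  proof -
    have "(\<Sum>l\<in>{1..n}. B l x * \<rho> l j f) = (\<Sum>y\<in>V. (\<Sum>l\<in>{1..n}. B l x * C l y) * B j (f y))"
      unfolding \<rho>_def sum_distrib_left sum_distrib_right by (subst sum.swap) (simp add: mult.assoc)
    also have "\<dots> = (\<Sum>y\<in>V. p (f x) (f y) * B j (f y))"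
      using that by (intro sum.cong) (simp_all add: proj inv)
    also have "\<dots> = B j (f x)"
      using reindex[OF that(1), of "\<lambda>y. p (f x) y * B j y"] pB that Aut_closed by simp
    finally show ?thesis .
  qed
  show "\<rho> i j (compose V g f) = (\<Sum>l\<in>{1..n}. \<rho> i l f * \<rho> l j g)"
    if "f \<in> Aut" "g \<in> Aut" "i \<in> {1..n}" "j \<in> {1..n}" for f g i j
  proof -
    have "(\<Sum>l\<in>{1..n}. \<rho> i l f * \<rho> l j g) = (\<Sum>x\<in>V. C i x * (\<Sum>l\<in>{1..n}. B l (f x) * \<rho> l j g))"
      unfolding \<rho>_def[of i _ f] sum_distrib_left sum_distrib_right by (subst sum.swap) (simp add: mult.assoc)
    also have "\<dots> = \<rho> i j (compose V g f)"
      unfolding \<rho>_def[of i j] using that by (intro sum.cong) (simp_all add: B\<rho> Aut_closed compose_def)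
    finally show ?thesis ..
  qed
  show "\<rho> i j (restrict id V) = of_bool (i = j)" if "i \<in> {1..n}" "j \<in> {1..n}" for i j
    using dual[OF that] by (simp add: \<rho>_def)
  fix T :: "nat \<Rightarrow> nat \<Rightarrow> complex"
  assume T: "\<And>f i j. f \<in> Aut \<Longrightarrow> i \<in> {1..n} \<Longrightarrow> j \<in> {1..n} \<Longrightarrow>
    (\<Sum>l\<in>{1..n}. T i l * \<rho> l j f) = (\<Sum>l\<in>{1..n}. T l j * \<rho> i l f)"
  \<comment> \<open>The kernel on \<open>V\<close> of the operator that acts as \<open>T\<close> on
    the span of the \<open>B i\<close>. Commutation of \<open>T\<close> with \<rho> becomes
    invariance of this kernel under automorphisms.\<close>
  define t where "t x y = (\<Sum>i\<in>{1..n}. \<Sum>j\<in>{1..n}. B i x * T i j * C j y)" for x y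
  have "t (f x) (f y) = t x y" if f: "f \<in> Aut" and x: "x \<in> V" and y: "y \<in> V" for f x y
  proof -
    have "t (f x) (f y) = (\<Sum>i\<in>{1..n}. \<Sum>j\<in>{1..n}. (\<Sum>l\<in>{1..n}. B l x * \<rho> l i f) * T i j * C j (f y))"
      unfolding t_def using f x by (intro sum.cong) (simp_all add: B\<rho>)
    also have "\<dots> = (\<Sum>l\<in>{1..n}. \<Sum>j\<in>{1..n}. B l x * (\<Sum>i\<in>{1..n}. T i j * \<rho> l i f) * C j (f y))"
    proof -
      have "(\<Sum>i\<in>{1..n}. \<Sum>j\<in>{1..n}. (\<Sum>l\<in>{1..n}. B l x * \<rho> l i f) * T i j * C j (f y)) =
          (\<Sum>i\<in>{1..n}. \<Sum>j\<in>{1..n}. \<Sum>l\<in>{1..n}. B l x * (T i j * \<rho> l i f) * C j (f y))"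
        by (simp add: sum_distrib_right sum_distrib_left mult_ac)
      also have "\<dots> = (\<Sum>i\<in>{1..n}. \<Sum>l\<in>{1..n}. \<Sum>j\<in>{1..n}. B l x * (T i j * \<rho> l i f) * C j (f y))"
        by (intro sum.cong refl sum.swap)
      also have "\<dots> = (\<Sum>l\<in>{1..n}. \<Sum>i\<in>{1..n}. \<Sum>j\<in>{1..n}. B l x * (T i j * \<rho> l i f) * C j (f y))"
        by (rule sum.swap)
      also have "\<dots> = (\<Sum>l\<in>{1..n}. \<Sum>j\<in>{1..n}. \<Sum>i\<in>{1..n}. B l x * (T i j * \<rho> l i f) * C j (f y))"
        by (intro sum.cong refl sum.swap)
      finally show ?thesis by (simp add: sum_distrib_right sum_distrib_left)
    qed
    also have "\<dots> = (\<Sum>l\<in>{1..n}. \<Sum>j\<in>{1..n}. B l x * (\<Sum>i\<in>{1..n}. T l i * \<rho> i j f) * C j (f y))"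
      using f T by (intro sum.cong refl) simp
    also have "\<dots> = (\<Sum>l\<in>{1..n}. \<Sum>j\<in>{1..n}. \<Sum>i\<in>{1..n}. B l x * T l i * (\<rho> i j f * C j (f y)))"
      by (simp add: sum_distrib_left sum_distrib_right mult_ac)
    also have "\<dots> = (\<Sum>l\<in>{1..n}. \<Sum>i\<in>{1..n}. \<Sum>j\<in>{1..n}. B l x * T l i * (\<rho> i j f * C j (f y)))"
      by (intro sum.cong refl sum.swap)
    also have "\<dots> = (\<Sum>l\<in>{1..n}. \<Sum>i\<in>{1..n}. B l x * T l i * (\<Sum>j\<in>{1..n}. \<rho> i j f * C j (f y)))"
      by (simp only: sum_distrib_left)
    also have "\<dots> = t x y" unfolding t_def using f y by (intro sum.cong refl) (simp add: \<rho>C)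
    finally show ?thesis .
  qed
  then obtain c where c: "\<And>x j. x \<in> V \<Longrightarrow> j \<in> {1..n} \<Longrightarrow> (\<Sum>y\<in>V. t x y * B j y) = c * B j x"
    using scalar[of t] by blast
  have tB: "(\<Sum>y\<in>V. t x y * B j y) = (\<Sum>i\<in>{1..n}. B i x * T i j)" if "j \<in> {1..n}" for x j
  proof -
    have "(\<Sum>y\<in>V. t x y * B j y) = (\<Sum>y\<in>V. \<Sum>i\<in>{1..n}. \<Sum>l\<in>{1..n}. B i x * T i l * (C l y * B j y))"
      by (simp add: t_def sum_distrib_right mult.assoc)
    also have "\<dots> = (\<Sum>i\<in>{1..n}. \<Sum>y\<in>V. \<Sum>l\<in>{1..n}. B i x * T i l * (C l y * B j y))"
      by (rule sum.swap)
    also have "\<dots> = (\<Sum>i\<in>{1..n}. \<Sum>l\<in>{1..n}. \<Sum>y\<in>V. B i x * T i l * (C l y * B j y))"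
      by (intro sum.cong refl sum.swap)
    also have "\<dots> = (\<Sum>i\<in>{1..n}. \<Sum>l\<in>{1..n}. B i x * T i l * of_bool (l = j))"
      using that by (intro sum.cong refl) (simp add: dual flip: sum_distrib_left)
    also have "\<dots> = (\<Sum>i\<in>{1..n}. B i x * T i j)" using that by (simp add: delta)
    finally show ?thesis .
  qed
  have "T i j = c * of_bool (i = j)" if ij: "i \<in> {1..n}" "j \<in> {1..n}" for i j
  proof -
    \<comment> \<open>Pairing with the dual vector \<open>C i\<close> recovers the coefficients of
      \<open>T\<close> from the scalar action on the subspace.\<close>
    have "(\<Sum>x\<in>V. C i x * (c * B j x)) = (\<Sum>x\<in>V. C i x * (\<Sum>l\<in>{1..n}. B l x * T l j))"
    proof (rule sum.cong[OF refl])
      fix x assume "x \<in> V"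
      have "c * B j x = (\<Sum>l\<in>{1..n}. B l x * T l j)"
        using c[OF \<open>x \<in> V\<close> ij(2)] unfolding tB[OF ij(2)] by (rule sym)
      thus "C i x * (c * B j x) = C i x * (\<Sum>l\<in>{1..n}. B l x * T l j)" by (simp only:)
    qed
    also have "\<dots> = (\<Sum>l\<in>{1..n}. (\<Sum>x\<in>V. C i x * B l x) * T l j)"
      unfolding sum_distrib_left sum_distrib_right by (subst sum.swap) (simp add: mult.assoc)
    also have "\<dots> = T i j" using ij by (simp add: dual delta)
    finally have "T i j = c * (\<Sum>x\<in>V. C i x * B j x)" by (simp add: sum_distrib_left mult_ac)
    thus ?thesis using dual ij by simp
  qed
  thus "\<exists>c. \<forall>i\<in>{1..n}. \<forall>j\<in>{1..n}. T i j = c * of_bool (i = j)" by blast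
qed

text \<open>An algebra of functions is commutative, and commutativity passes to the image of a
  homomorphism.\<close>

lemma not_hopf_isomorphic:
  assumes "\<exists>x\<in>carrier H. \<exists>y\<in>carrier H. x \<otimes>\<^bsub>H\<^esub> y \<noteq> y \<otimes>\<^bsub>H\<^esub> x"
  shows "\<not> hopf_isomorphic (A_graph V E) H"
proof
  interpret A: function_model "A_graph V E" Aut aut_eval by (rule A_graph_model)
  assume "hopf_isomorphic (A_graph V E) H"
  then obtain f where f: "f \<in> star_hom (A_graph V E) H" "f ` carrier (A_graph V E) = carrier H"
    unfolding hopf_isomorphic_def bij_betw_def by blast
  hence hom: "f \<in> ring_hom (A_graph V E) H" by (simp add: star_hom_def)
  obtain x y where "x \<in> carrier H" "y \<in> carrier H" and ne: "x \<otimes>\<^bsub>H\<^esub> y \<noteq> y \<otimes>\<^bsub>H\<^esub> x" using assms by blast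
  then obtain a b where ab: "a \<in> carrier (A_graph V E)" "b \<in> carrier (A_graph V E)" "x = f a" "y = f b"
    using f(2) by blast
  have "f a \<otimes>\<^bsub>H\<^esub> f b = f b \<otimes>\<^bsub>H\<^esub> f a"
    using A.mult_commute[OF ab(1,2)] ring_hom_mult[OF hom ab(1,2)] ring_hom_mult[OF hom ab(2,1)] by simp
  thus False using ne ab by simp
qed

end

section \<open>The Petersen graph\<close>

lemma sum_1_5: "(\<Sum>j\<in>{1..5::nat}. g j) = g 1 + g 2 + g 3 + g 4 + g 5"
proof -
  have "{1..5::nat} = {1, 2, 3, 4, 5}" by auto
  thus ?thesis by (simp add: add.assoc)
qed

lemma petersen_verts_eq:
  "petersen_verts = {{1,2}, {1,3}, {1,4}, {1,5}, {2,3}, {2,4}, {2,5}, {3,4}, {3,5}, {4,5}}"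
proof -
  have W: "{1..5::nat} = {1, 2, 3, 4, 5}" by auto
  show ?thesis
  proof (intro equalityI subsetI)
    fix x assume "x \<in> petersen_verts"
    then obtain a b where ab: "x = {a, b}" "a \<noteq> b" "a \<in> {1, 2, 3, 4, 5}" "b \<in> {1, 2, 3, 4, 5}"
      unfolding petersen_verts_def W card_2_iff by auto
    have "{a, b} \<in> {{1,2}, {1,3}, {1,4}, {1,5}, {2,3}, {2,4}, {2,5}, {3,4}, {3,5}, {4,5}}"
      using ab(2-4) by (elim insertE emptyE) (simp_all add: doubleton_eq_iff)
    thus "x \<in> {{1,2}, {1,3}, {1,4}, {1,5}, {2,3}, {2,4}, {2,5}, {3,4}, {3,5}, {4,5}}"
      using ab(1) by simp
  qed (auto simp: petersen_verts_def)
qed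

lemma sum_petersen:
  "(\<Sum>x\<in>petersen_verts. g x) = g {1,2} + g {1,3} + g {1,4} + g {1,5} + g {2,3} + g {2,4} + g {2,5} +
    g {3,4} + g {3,5} + g {4,5}"
  unfolding petersen_verts_eq by (simp add: doubleton_eq_iff add.assoc)

text \<open>The size of the intersection encodes the relation of two vertices: 2 for equal, 0 for
  adjacent, 1 for distance two. In the last case the complement of the union has two elements and is
  itself a vertex, the common neighbour.\<close>

lemma petersen_card_Un:
  assumes "j \<in> petersen_verts" "l \<in> petersen_verts"
  shows "card (j \<union> l) = 4 - card (j \<inter> l)" "card (j \<inter> l) = 2 \<longleftrightarrow> j = l"
    "card (j \<inter> l) \<le> 2" "card ({1..5} - (j \<union> l)) = 1 + card (j \<inter> l)"
proof -
  have fin: "finite j" "finite l" "card j = 2" "card l = 2" "j \<subseteq> {1..5}" "l \<subseteq> {1..5}"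
    using assms by (auto simp: petersen_verts_def intro: finite_subset)
  show le: "card (j \<inter> l) \<le> 2" using card_mono[of j "j \<inter> l"] fin by simp
  show Un: "card (j \<union> l) = 4 - card (j \<inter> l)" using card_Un_Int[OF fin(1,2)] fin by simp
  show "card (j \<inter> l) = 2 \<longleftrightarrow> j = l"
  proof
    assume "card (j \<inter> l) = 2"
    hence "j \<inter> l = j" "j \<inter> l = l"
      using card_subset_eq[OF fin(1), of "j \<inter> l"] card_subset_eq[OF fin(2), of "j \<inter> l"] fin by auto
    thus "j = l" by simp
  qed (use fin in simp)
  have "card ({1..5} - (j \<union> l)) = 5 - card (j \<union> l)"
    using fin by (subst card_Diff_subset) auto
  thus "card ({1..5} - (j \<union> l)) = 1 + card (j \<inter> l)" using Un le by simp
qed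

text \<open>A common neighbour of two vertices is a pair inside the complement of their union, which
  has at most two elements if they differ. The neighbours of \<open>s\<close> are the three pairs in
  its three-element complement.\<close>

lemma petersen_moore: "moore_graph petersen_verts petersen_adj"
proof
  show "finite petersen_verts" by (simp add: petersen_verts_eq)
  show "petersen_adj j i" if "petersen_adj i j" for i j
    using that by (auto simp: petersen_adj_def)
next
  fix j l assume jl: "j \<in> petersen_verts" "l \<in> petersen_verts" "j \<noteq> l" "\<not> petersen_adj j l"
  let ?s = "{1..5} - (j \<union> l)"
  have "finite j" using jl(1) by (auto simp: petersen_verts_def intro: finite_subset)
  hence "card (j \<inter> l) \<noteq> 0" using jl(4) by (simp add: petersen_adj_def)
  hence "card ?s = 2" using petersen_card_Un[OF jl(1,2)] jl(3) by linarith
  hence "?s \<in> petersen_verts" by (auto simp: petersen_verts_def)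
  moreover have "petersen_adj j ?s" "petersen_adj ?s l" by (auto simp: petersen_adj_def)
  ultimately show "\<exists>s\<in>petersen_verts. petersen_adj j s \<and> petersen_adj s l" by blast
next
  fix j l s t assume V: "j \<in> petersen_verts" "l \<in> petersen_verts" "s \<in> petersen_verts" "t \<in> petersen_verts"
    and "j \<noteq> l" and adj: "petersen_adj j s" "petersen_adj s l" "petersen_adj j t" "petersen_adj t l"
  let ?C = "{1..5} - (j \<union> l)"
  have "card ?C \<le> 2" using petersen_card_Un[OF V(1,2)] \<open>j \<noteq> l\<close> by linarith
  moreover have "s \<subseteq> ?C" "t \<subseteq> ?C" "card s = 2" "card t = 2"
    using V adj by (auto simp: petersen_verts_def petersen_adj_def)
  ultimately have "s = ?C" "t = ?C" using card_seteq[of ?C s] card_seteq[of ?C t] by simp_all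
  thus "s = t" by simp
next
  fix s j k l x assume V: "s \<in> petersen_verts" "j \<in> petersen_verts" "k \<in> petersen_verts"
      "l \<in> petersen_verts" "x \<in> petersen_verts"
    and adj: "petersen_adj s j" "petersen_adj s k" "petersen_adj s l" "petersen_adj s x"
    and dist: "distinct [j, k, l]"
  let ?C = "{1..5} - s" and ?N = "{y. y \<subseteq> {1..5} - s \<and> card y = 2}"
  have s: "s \<subseteq> {1..5}" "card s = 2" "finite s"
    using V(1) by (auto simp: petersen_verts_def intro: finite_subset)
  have "card ?C = 3" using s by (subst card_Diff_subset) auto
  hence "card ?N = 3" by (subst n_subsets) (simp_all add: numeral_eq_Suc)
  moreover have "finite ?N" by simp
  moreover have "{j, k, l} \<subseteq> ?N" "x \<in> ?N"
    using V adj by (auto simp: petersen_verts_def petersen_adj_def)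
  moreover have "card {j, k, l} = 3" using dist by simp
  ultimately show "x \<in> {j, k, l}" using card_subset_eq[of ?N "{j, k, l}"] by simp
qed

interpretation petersen: moore_graph_algebra petersen_verts petersen_adj
  by (intro moore_graph_algebra.intro petersen_moore)

section \<open>Automorphisms induced by permutations of the five symbols\<close>

lemma permutation_aut:
  assumes \<sigma>: "bij_betw \<sigma> {1..5} {1..5}"
  shows "restrict ((`) \<sigma>) petersen_verts \<in> graph_aut petersen_verts petersen_adj"
proof -
  have inj: "inj_on \<sigma> {1..5}" and im: "\<sigma> ` {1..5} = {1..5}" using \<sigma> by (auto simp: bij_betw_def)
  have sub: "x \<subseteq> {1..5}" "card x = 2" if "x \<in> petersen_verts" for x
    using that by (auto simp: petersen_verts_def)
  have closed: "\<sigma> ` x \<in> petersen_verts" if "x \<in> petersen_verts" for x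
  proof -
    have "\<sigma> ` x \<subseteq> {1..5}" using image_mono[OF sub(1)[OF that], of \<sigma>] im by simp
    moreover have "card (\<sigma> ` x) = 2"
      using card_image[OF inj_on_subset[OF inj sub(1)[OF that]]] sub(2)[OF that] by simp
    ultimately show ?thesis by (simp add: petersen_verts_def)
  qed
  have "petersen_adj (\<sigma> ` x) (\<sigma> ` y) = petersen_adj x y"
    if "x \<in> petersen_verts" "y \<in> petersen_verts" for x y
    using inj_on_image_Int[OF inj sub(1)[OF that(1)] sub(1)[OF that(2)]]
    by (simp add: petersen_adj_def flip: image_empty) (metis image_is_empty)
  moreover have "inj_on (restrict ((`) \<sigma>) petersen_verts) petersen_verts"
  proof (rule inj_onI)
    fix x y assume "x \<in> petersen_verts" "y \<in> petersen_verts"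
      "restrict ((`) \<sigma>) petersen_verts x = restrict ((`) \<sigma>) petersen_verts y"
    thus "x = y" using inj_on_image_eq_iff[OF inj sub(1) sub(1)] by simp
  qed
  ultimately show ?thesis using closed by (simp add: graph_aut_def)
qed

text \<open>The two sets cut \<open>W\<close> into four cells, whose sizes are determined by the
  given cardinalities. Bijections between corresponding cells are glued together.\<close>

lemma permutation_of_pair:
  assumes "finite W" "x \<subseteq> W" "y \<subseteq> W" "x' \<subseteq> W" "y' \<subseteq> W"
    and card: "card x = card x'" "card y = card y'" "card (x \<inter> y) = card (x' \<inter> y')"
  shows "\<exists>\<sigma>. bij_betw \<sigma> W W \<and> \<sigma> ` x = x' \<and> \<sigma> ` y = y'"
proof -
  note fin = finite_subset[OF _ assms(1)]
  have fin: "finite x" "finite y" "finite x'" "finite y'" using assms fin by auto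
  have "card (x \<union> y) = card (x' \<union> y')"
    using card_Un_Int[OF fin(1,2)] card_Un_Int[OF fin(3,4)] card by simp
  hence "card (W - (x \<union> y)) = card (W - (x' \<union> y'))"
    using assms fin by (simp add: card_Diff_subset)
  moreover have "card (x - y) = card (x' - y')" "card (y - x) = card (y' - x')"
    using card card_Int_Diff[OF fin(1), of y] card_Int_Diff[OF fin(3), of y']
      card_Int_Diff[OF fin(2), of x] card_Int_Diff[OF fin(4), of x'] by (simp_all add: Int_commute)
  ultimately obtain f1 f2 f3 f4 where
    "bij_betw f1 (x \<inter> y) (x' \<inter> y')" "bij_betw f2 (x - y) (x' - y')" "bij_betw f3 (y - x) (y' - x')"
    "bij_betw f4 (W - (x \<union> y)) (W - (x' \<union> y'))"
    using fin assms(1) card(3) finite_same_card_bij by (metis finite_Diff finite_Int)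
  hence im: "f1 ` (x \<inter> y) = x' \<inter> y'" "f2 ` (x - y) = x' - y'" "f3 ` (y - x) = y' - x'"
    "f4 ` (W - (x \<union> y)) = W - (x' \<union> y')" by (simp_all add: bij_betw_def)
  define \<sigma> where "\<sigma> i = (if i \<in> x then if i \<in> y then f1 i else f2 i else if i \<in> y then f3 i else f4 i)" for i
  have \<sigma>: "\<sigma> ` (x \<inter> y) = x' \<inter> y'" "\<sigma> ` (x - y) = x' - y'" "\<sigma> ` (y - x) = y' - x'"
    "\<sigma> ` (W - (x \<union> y)) = W - (x' \<union> y')"
    unfolding im[symmetric] by (auto intro!: image_cong simp: \<sigma>_def)
  have "x = (x \<inter> y) \<union> (x - y)" "y = (x \<inter> y) \<union> (y - x)" by auto
  hence x: "\<sigma> ` x = (x' \<inter> y') \<union> (x' - y')" and y: "\<sigma> ` y = (x' \<inter> y') \<union> (y' - x')"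
    using \<sigma> by (metis image_Un)+
  have "W = (W - (x \<union> y)) \<union> x \<union> y" using assms by auto
  hence "\<sigma> ` W = (W - (x' \<union> y')) \<union> \<sigma> ` x \<union> \<sigma> ` y" using \<sigma>(4) by (metis image_Un)
  hence W: "\<sigma> ` W = W" using x y assms(4,5) by auto
  hence "inj_on \<sigma> W" by (intro eq_card_imp_inj_on assms(1)) simp
  moreover have "\<sigma> ` x = x'" "\<sigma> ` y = y'" using x y by auto
  ultimately show ?thesis using W by (auto simp: bij_betw_def)
qed

text \<open>Induced automorphisms act transitively on the ordered pairs of vertices with a given
  size of intersection, so an invariant kernel takes only three values.\<close>

lemma petersen_invariant:
  assumes t: "\<And>f x y. f \<in> graph_aut petersen_verts petersen_adj \<Longrightarrow> x \<in> petersen_verts \<Longrightarrow>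
      y \<in> petersen_verts \<Longrightarrow> t (f x) (f y) = t x y"
    and V: "x \<in> petersen_verts" "y \<in> petersen_verts" "x' \<in> petersen_verts" "y' \<in> petersen_verts"
    and card: "card (x \<inter> y) = card (x' \<inter> y')"
  shows "t x y = t x' y'"
proof -
  have sub: "z \<subseteq> {1..5}" "card z = 2" if "z \<in> petersen_verts" for z
    using that by (auto simp: petersen_verts_def)
  obtain \<sigma> where \<sigma>: "bij_betw \<sigma> {1..5} {1..5}" "\<sigma> ` x = x'" "\<sigma> ` y = y'"
    using permutation_of_pair[of "{1..5}" x y x' y'] V card sub by auto
  show ?thesis using t[OF permutation_aut[OF \<sigma>(1)] V(1,2)] \<sigma> V by simp
qed

text \<open>Polytabloids of shape \<open>(3, 2)\<close>: they span the functions on the edges of \<open>K\<^sub>5\<close> whose sum over the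
  edges at each vertex vanishes, i.e. the eigenspace of the Petersen graph for the eigenvalue \<open>1\<close>.\<close>

definition polytabloid :: "nat \<Rightarrow> nat set \<Rightarrow> complex" where
  "polytabloid j x = (let t = (\<lambda>i. of_bool (i \<in> x)) in
     if j = 1 then (t 1 - t 4) * (t 2 - t 5)
     else if j = 2 then (t 1 - t 3) * (t 2 - t 5)
     else if j = 3 then (t 1 - t 3) * (t 2 - t 4)
     else if j = 4 then (t 1 - t 2) * (t 3 - t 5)
     else (t 1 - t 2) * (t 3 - t 4))"

text \<open>The coefficients are those of the inverse of the Gram matrix of the polytabloids.\<close>

definition dual_polytabloid :: "nat \<Rightarrow> nat set \<Rightarrow> complex" where
  "dual_polytabloid j x = (let b = (\<lambda>i. polytabloid i x) in
     (if j = 1 then 3 * b 1 - b 2 - b 3 - b 4 + 2 * b 5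
      else if j = 2 then - b 1 + 3 * b 2 - b 3 - b 4
      else if j = 3 then - b 1 - b 2 + 3 * b 3 + b 4 - 2 * b 5
      else if j = 4 then - b 1 - b 2 + b 3 + 3 * b 4 - 2 * b 5
      else 2 * b 1 - 2 * b 3 - 2 * b 4 + 4 * b 5) / 6)"

text \<open>The indices stand for the five standard tableaux of shape \<open>(3, 2)\<close>, with
  second rows 45, 35, 34, 25, 24; each factor of a polytabloid is a column of length two. Tabulating
  the values turns the finite checks below into rewriting.\<close>

lemma polytabloid_table:
  "map (polytabloid 1) [{1,2}, {1,3}, {1,4}, {1,5}, {2,3}, {2,4}, {2,5}, {3,4}, {3,5}, {4,5}] =
    [1, 0, 0, -1, 0, -1, 0, 0, 0, 1]"
  "map (polytabloid 2) [{1,2}, {1,3}, {1,4}, {1,5}, {2,3}, {2,4}, {2,5}, {3,4}, {3,5}, {4,5}] =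
    [1, 0, 0, -1, -1, 0, 0, 0, 1, 0]"
  "map (polytabloid 3) [{1,2}, {1,3}, {1,4}, {1,5}, {2,3}, {2,4}, {2,5}, {3,4}, {3,5}, {4,5}] =
    [1, 0, -1, 0, -1, 0, 0, 1, 0, 0]"
  "map (polytabloid 4) [{1,2}, {1,3}, {1,4}, {1,5}, {2,3}, {2,4}, {2,5}, {3,4}, {3,5}, {4,5}] =
    [0, 1, 0, -1, -1, 0, 1, 0, 0, 0]"
  "map (polytabloid 5) [{1,2}, {1,3}, {1,4}, {1,5}, {2,3}, {2,4}, {2,5}, {3,4}, {3,5}, {4,5}] =
    [0, 1, -1, 0, -1, 1, 0, 0, 0, 0]"
  by (simp_all add: polytabloid_def Let_def)

text \<open>Splits the equations of lists into single values. Only the listed rules are applied, so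
  the literal \<open>1\<close> survives; the proofs that use these rules therefore delete
  \<open>One_nat_def\<close>.\<close>

lemmas polytabloid_simps = polytabloid_table[simplified list.map list.inject simp_thms]

lemma dual_polytabloid_table:
  "map (dual_polytabloid 1) [{1,2}, {1,3}, {1,4}, {1,5}, {2,3}, {2,4}, {2,5}, {3,4}, {3,5}, {4,5}] =
    [1/6, 1/6, -1/6, -1/6, 1/6, -1/6, -1/6, -1/6, -1/6, 1/2]"
  "map (dual_polytabloid 2) [{1,2}, {1,3}, {1,4}, {1,5}, {2,3}, {2,4}, {2,5}, {3,4}, {3,5}, {4,5}] =
    [1/6, -1/6, 1/6, -1/6, -1/6, 1/6, -1/6, -1/6, 1/2, -1/6]"
  "map (dual_polytabloid 3) [{1,2}, {1,3}, {1,4}, {1,5}, {2,3}, {2,4}, {2,5}, {3,4}, {3,5}, {4,5}] =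
    [1/6, -1/6, -1/6, 1/6, -1/6, -1/6, 1/6, 1/2, -1/6, -1/6]"
  "map (dual_polytabloid 4) [{1,2}, {1,3}, {1,4}, {1,5}, {2,3}, {2,4}, {2,5}, {3,4}, {3,5}, {4,5}] =
    [-1/6, 1/6, 1/6, -1/6, -1/6, -1/6, 1/2, 1/6, -1/6, -1/6]"
  "map (dual_polytabloid 5) [{1,2}, {1,3}, {1,4}, {1,5}, {2,3}, {2,4}, {2,5}, {3,4}, {3,5}, {4,5}] =
    [0, 1/3, -1/3, 0, 0, 1/3, -1/3, -1/3, 0, 1/3]"
  by (simp_all add: dual_polytabloid_def Let_def polytabloid_simps del: One_nat_def)

lemmas dual_polytabloid_simps = dual_polytabloid_table[simplified list.map list.inject simp_thms]

lemma in_1_5: "j \<in> {1..5::nat} \<longleftrightarrow> j = 1 \<or> j = 2 \<or> j = 3 \<or> j = 4 \<or> j = 5"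
  by auto

lemma dual_polytabloid:
  assumes "i \<in> {1..5}" "j \<in> {1..5}"
  shows "(\<Sum>x\<in>petersen_verts. dual_polytabloid i x * polytabloid j x) = of_bool (i = j)"
  using assms unfolding in_1_5 sum_petersen
  by (elim disjE; hypsubst; simp add: dual_polytabloid_simps polytabloid_simps del: One_nat_def)

text \<open>The adjacency matrix \<open>A\<close> satisfies \<open>A\<^sup>2 = 2 I - A + J\<close>,
  with \<open>J\<close> the all-ones matrix. The spectral projection for the eigenvalue 1 is
  \<open>(A - 3)(A + 2) / ((1 - 3)(1 + 2))\<close>, which equals \<open>(4 I + 2 A - J) / 6\<close>;
  its entries are 1/2, 1/6 and -1/6.\<close>

definition eigenprojection :: "nat set \<Rightarrow> nat set \<Rightarrow> complex" where
  "eigenprojection x y = (if x = y then 1/2 else if petersen_adj x y then 1/6 else -1/6)"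

text \<open>A basis combined with its dual under the inverse Gram matrix gives the orthogonal
  projection onto its span; the proof checks the hundred entries.\<close>

lemma polytabloid_projection:
  assumes "x \<in> petersen_verts" "y \<in> petersen_verts"
  shows "(\<Sum>j\<in>{1..5}. polytabloid j x * dual_polytabloid j y) = eigenprojection x y"
  using assms unfolding petersen_verts_eq sum_1_5
  by (elim insertE emptyE; hypsubst;
      simp add: dual_polytabloid_simps polytabloid_simps eigenprojection_def petersen_adj_def
        doubleton_eq_iff del: One_nat_def)

lemma polytabloid_sum:
  assumes "j \<in> {1..5}"
  shows "(\<Sum>y\<in>petersen_verts. polytabloid j y) = 0"
  using assms unfolding in_1_5 sum_petersen
  by (elim disjE; hypsubst; simp add: polytabloid_simps del: One_nat_def)

lemma sum_delta_petersen:
  fixes g :: "nat set \<Rightarrow> complex"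
  assumes "x \<in> petersen_verts"
  shows "(\<Sum>y\<in>petersen_verts. of_bool (x = y) * g y) = g x"
proof -
  have "(\<Sum>y\<in>petersen_verts. of_bool (x = y) * g y) = (\<Sum>y\<in>petersen_verts. if x = y then g y else 0)"
    by (intro sum.cong) auto
  thus ?thesis using assms petersen.finite_V by simp
qed

text \<open>The projection \<open>(4 I + 2 A - J) / 6\<close> fixes a polytabloid and
  \<open>J\<close> annihilates it, so \<open>A\<close> must fix it as well.\<close>

lemma polytabloid_eigenvector:
  assumes j: "j \<in> {1..5}" and x: "x \<in> petersen_verts"
  shows "(\<Sum>y\<in>petersen_verts. of_bool (petersen_adj x y) * polytabloid j y) = polytabloid j x"
proof -
  let ?b = "polytabloid j" and ?S = "sum (\<lambda>y. of_bool (petersen_adj x y) * polytabloid j y) petersen_verts"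
  have "x \<noteq> {}" using x by (auto simp: petersen_verts_def)
  hence P: "eigenprojection x y * ?b y =
      2/3 * (of_bool (x = y) * ?b y) + 1/3 * (of_bool (petersen_adj x y) * ?b y) - 1/6 * ?b y" for y
    by (auto simp: eigenprojection_def petersen_adj_def)
  have "?b x = (\<Sum>l\<in>{1..5}. polytabloid l x * of_bool (l = j))"
    using j by (simp add: of_bool_def if_distrib cong: if_cong)
  also have "\<dots> = (\<Sum>l\<in>{1..5}. \<Sum>y\<in>petersen_verts. polytabloid l x * dual_polytabloid l y * ?b y)"
    using j by (intro sum.cong refl) (simp only: dual_polytabloid[symmetric] sum_distrib_left mult.assoc)
  also have "\<dots> = (\<Sum>y\<in>petersen_verts. eigenprojection x y * ?b y)"
    using x by (subst sum.swap, intro sum.cong refl)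
      (simp only: polytabloid_projection[symmetric] sum_distrib_right)
  also have "\<dots> = 2/3 * (\<Sum>y\<in>petersen_verts. of_bool (x = y) * ?b y) + 1/3 * ?S -
      1/6 * (\<Sum>y\<in>petersen_verts. ?b y)"
    unfolding P by (simp only: sum.distrib sum_subtractf sum_distrib_left)
  also have "(\<Sum>y\<in>petersen_verts. of_bool (x = y) * ?b y) = ?b x"
    by (rule sum_delta_petersen[OF x])
  finally show ?thesis unfolding polytabloid_sum[OF j] by (simp add: field_simps)
qed

text \<open>An invariant kernel is a combination of \<open>I\<close>, \<open>A\<close> and
  \<open>J\<close>. On the eigenspace these act as 1, 1 and 0, so the kernel acts as a
  scalar.\<close>

lemma petersen_irreducible_representation: "\<exists>v. irreducible_representation A_petersen 5 v"
  unfolding A_petersen_def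
proof (rule petersen.irreducible_representation_of_subspace)
  show "(\<Sum>x\<in>petersen_verts. dual_polytabloid i x * polytabloid j x) = of_bool (i = j)"
    if "i \<in> {1..5}" "j \<in> {1..5}" for i j using that by (rule dual_polytabloid)
  show "(\<Sum>j\<in>{1..5}. polytabloid j x * dual_polytabloid j y) = eigenprojection x y"
    if "x \<in> petersen_verts" "y \<in> petersen_verts" for x y using that by (rule polytabloid_projection)
  show "eigenprojection (f x) (f y) = eigenprojection x y"
    if "f \<in> graph_aut petersen_verts petersen_adj" "x \<in> petersen_verts" "y \<in> petersen_verts" for f x y
    using that by (simp add: eigenprojection_def petersen.Aut_adj inj_on_eq_iff[OF petersen.Aut_inj])
  fix t :: "nat set \<Rightarrow> nat set \<Rightarrow> complex"
  assume t: "\<And>f x y. f \<in> graph_aut petersen_verts petersen_adj \<Longrightarrow> x \<in> petersen_verts \<Longrightarrow>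
    y \<in> petersen_verts \<Longrightarrow> t (f x) (f y) = t x y"
  \<comment> \<open>One representative for each orbit of pairs: equal, disjoint, and meeting in one
    symbol.\<close>
  define \<alpha> \<beta> \<gamma> where "\<alpha> = t {1,2} {1,2}" and "\<beta> = t {1,2} {3,4}" and "\<gamma> = t {1,2} {1,3}"
  have txy: "t x y = \<gamma> + (\<alpha> - \<gamma>) * of_bool (x = y) + (\<beta> - \<gamma>) * of_bool (petersen_adj x y)"
    if V: "x \<in> petersen_verts" "y \<in> petersen_verts" for x y
  proof -
    have base: "{1,2} \<in> petersen_verts" "{3,4} \<in> petersen_verts" "{1,3} \<in> petersen_verts"
      by (simp_all add: petersen_verts_eq)
    have finx: "finite x" "x \<noteq> {}" using V(1) by (auto simp: petersen_verts_def intro: finite_subset)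
    have disj: "card (x \<inter> y) = 0 \<longleftrightarrow> petersen_adj x y" using finx by (simp add: petersen_adj_def)
    consider "card (x \<inter> y) = 2" | "card (x \<inter> y) = 0" | "card (x \<inter> y) = 1"
      using petersen_card_Un(3)[OF V] by linarith
    thus ?thesis
    proof cases
      case 1
      hence eq: "card (x \<inter> y) = card ({1,2::nat} \<inter> {1,2})" by simp
      have "t x y = \<alpha>"
        unfolding \<alpha>_def by (rule petersen_invariant[OF _ V base(1) base(1) eq]) (rule t)
      thus ?thesis using 1 petersen_card_Un(2)[OF V] disj by simp
    next
      case 2
      hence eq: "card (x \<inter> y) = card ({1,2::nat} \<inter> {3,4})" by simp
      have "t x y = \<beta>"
        unfolding \<beta>_def by (rule petersen_invariant[OF _ V base(1) base(2) eq]) (rule t)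
      thus ?thesis using 2 petersen_card_Un(2)[OF V] disj by simp
    next
      case 3
      hence eq: "card (x \<inter> y) = card ({1,2::nat} \<inter> {1,3})" by simp
      have "t x y = \<gamma>"
        unfolding \<gamma>_def by (rule petersen_invariant[OF _ V base(1) base(3) eq]) (rule t)
      thus ?thesis using 3 petersen_card_Un(2)[OF V] disj by simp
    qed
  qed
  have "(\<Sum>y\<in>petersen_verts. t x y * polytabloid j y) = (\<alpha> + \<beta> - 2 * \<gamma>) * polytabloid j x"
    if x: "x \<in> petersen_verts" and j: "j \<in> {1..5}" for x j
  proof -
    have "(\<Sum>y\<in>petersen_verts. t x y * polytabloid j y) =
        (\<Sum>y\<in>petersen_verts. \<gamma> * polytabloid j y + (\<alpha> - \<gamma>) * (of_bool (x = y) * polytabloid j y) +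
          (\<beta> - \<gamma>) * (of_bool (petersen_adj x y) * polytabloid j y))"
      using x by (intro sum.cong) (simp_all add: txy algebra_simps)
    also have "\<dots> = \<gamma> * (\<Sum>y\<in>petersen_verts. polytabloid j y) +
        (\<alpha> - \<gamma>) * (\<Sum>y\<in>petersen_verts. of_bool (x = y) * polytabloid j y) +
        (\<beta> - \<gamma>) * (\<Sum>y\<in>petersen_verts. of_bool (petersen_adj x y) * polytabloid j y)"
      by (simp only: sum.distrib sum_distrib_left)
    also have "(\<Sum>y\<in>petersen_verts. of_bool (x = y) * polytabloid j y) = polytabloid j x"
      by (rule sum_delta_petersen[OF x])
    finally show ?thesis
      unfolding polytabloid_sum[OF j] polytabloid_eigenvector[OF j x] by (simp add: algebra_simps)
  qed
  thus "\<exists>c. \<forall>x\<in>petersen_verts. \<forall>j\<in>{1..5}.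
      (\<Sum>y\<in>petersen_verts. t x y * polytabloid j y) = c * polytabloid j x" by blast
qed

theorem theorem8p1:
  shows "(\<exists>v. irreducible_representation A_petersen 5 v) \<and> \<not> hopf_isomorphic A_petersen (A_s 5)"
  using petersen_irreducible_representation petersen.not_hopf_isomorphic[OF A_s_5_noncommutative]
  unfolding A_petersen_def by blast

end
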